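(* Let $A \in M_n$ and let $k$ be an integer with $1 \le k \le n$. Then $$\Lambda_k(A) = \Omega_k(A) = \bigcap_{\xi \in [0, 2\pi)} \left\{\mu \in \mathbb{C} : e^{i\xi}\mu + e^{-i\xi}\bar\mu \le \lambda_k(e^{i\xi}A + e^{-i\xi}A^* )\right\}.$$
   Context: $M_n$ is the algebra of $n\times n$ complex matrices, $A^*$ is the conjugate transpose of $A$, and $I_n$ is the identity matrix. For a Hermitian matrix $H \in M_n$, $\lambda_k(H)$ denotes the $k$th largest eigenvalue of $H$ (counted with multiplicity). The rank-$k$ numerical range of $A \in M_n$ is $$\Lambda_k(A) = \{\lambda \in \mathbb{C} : PAP = \lambda P \text{ for some rank-}k \text{ orthogonal projection } P \in M_n\}.$$ $\Omega_k(A)$ is the set of $\mu \in \mathbb{C}$ such that for each $\xi \in [0,2\pi)$ the Hermitian matrix $e^{i\xi}(A-\mu I_n) + e^{-i\xi}(A-\mu I_n)^*$ has at least $k$ nonnegative eigenvalues (counted with multiplicity). *)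

theory Defs
  imports
    "Jordan_Normal_Form.Schur_Decomposition"
    "Jordan_Normal_Form.DL_Rank"
    "HOL-Computational_Algebra.Polynomial"
begin

definition orth_proj_rank :: "nat \<Rightarrow> nat \<Rightarrow> complex mat \<Rightarrow> bool" where
  "orth_proj_rank n k P \<longleftrightarrow>
     P \<in> carrier_mat n n \<and> P * P = P \<and> mat_adjoint P = P \<and> vec_space.rank n P = k"

definition rank_numerical_range :: "nat \<Rightarrow> complex mat \<Rightarrow> complex set" where
  "rank_numerical_range k A =
     {\<mu>. \<exists>P. orth_proj_rank (dim_row A) k P \<and> P * A * P = \<mu> \<cdot>\<^sub>m P}"

text \<open>Meant for Hermitian matrices only: all roots of the characteristic polynomial are
  then real (lemma \<open>hermitian_char_poly_root_real\<close> below), so \<^const>\<open>Re\<close> is a mere type coercion.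
  Multiplicities are those of the roots of the characteristic polynomial.\<close>

definition herm_eigvals :: "complex mat \<Rightarrow> real multiset" where
  "herm_eigvals H = image_mset Re (proots (char_poly H))"

text \<open>The \<open>k\<close>-th largest eigenvalue, for \<open>1 \<le> k \<le> n\<close>; list positions are counted from \<open>0\<close>.\<close>

definition kth_eigval :: "nat \<Rightarrow> complex mat \<Rightarrow> real" where
  "kth_eigval k H = rev (sorted_list_of_multiset (herm_eigvals H)) ! (k - 1)"

definition Omega_set :: "nat \<Rightarrow> complex mat \<Rightarrow> complex set" where
  "Omega_set k A =
     {\<mu>. \<forall>\<xi>\<in>{0..<2*pi}.
        let B = A - \<mu> \<cdot>\<^sub>m 1\<^sub>m (dim_row A);
            H = exp (\<i> * of_real \<xi>) \<cdot>\<^sub>m B + exp (- \<i> * of_real \<xi>) \<cdot>\<^sub>m mat_adjoint B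
        in k \<le> size {# x \<in># herm_eigvals H. 0 \<le> x #}}"

lemma mat_adjoint_index:
  assumes "i < dim_col A" "j < dim_row A"
  shows "mat_adjoint A $$ (i, j) = conjugate (A $$ (j, i))"
  using assms by (simp add: mat_adjoint_def mat_of_rows_def)

lemma size_herm_eigvals:
  assumes "H \<in> carrier_mat n n"
  shows "size (herm_eigvals H) = n"
proof -
  obtain as where "char_poly H = (\<Prod>a\<leftarrow>as. [:- a, 1:])" "length as = n"
    using char_poly_factorized[OF assms] by blast
  moreover have "proots (\<Prod>a\<leftarrow>as. [:- a, 1:]) = mset as" for as :: "complex list"
  proof (induction as)
    case (Cons a as)
    have "(\<Prod>a\<leftarrow>as. [:- a, 1:]) \<noteq> 0"
      by (auto simp: prod_list_zero_iff)
    then have "proots ([:- a, 1:] * (\<Prod>a\<leftarrow>as. [:- a, 1:]))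
        = proots [:- a, 1:] + proots (\<Prod>a\<leftarrow>as. [:- a, 1:])"
      by (intro proots_mult) auto
    moreover have "proots [:- a, 1:] = {#a#}"
      using proots_linear_factor[of "-a"] by simp
    ultimately show ?case using Cons.IH by simp
  qed simp
  ultimately show ?thesis
    by (simp add: herm_eigvals_def)
qed

lemma hermitian_char_poly_root_real:
  fixes H :: "complex mat"
  assumes H: "H \<in> carrier_mat n n" "mat_adjoint H = H"
    and x: "x \<in># proots (char_poly H)"
  shows "Im x = 0"
proof -
  have "char_poly H \<noteq> 0" using degree_monic_char_poly[OF H(1)] by auto
  then have "poly (char_poly H) x = 0"
    using x by simp
  then have "eigenvalue H x"
    using eigenvalue_root_char_poly[OF H(1)] by simp
  then obtain v where v: "v \<in> carrier_vec n" "v \<noteq> 0\<^sub>v n" "H *\<^sub>v v = x \<cdot>\<^sub>v v"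
    using H by (auto simp: eigenvalue_def eigenvector_def)
  have herm: "cnj (H $$ (i, j)) = H $$ (j, i)" if "i < n" "j < n" for i j
    using mat_adjoint_index[of j H i] that H by simp
  have Hv: "(\<Sum>j<n. H $$ (i, j) * v $ j) = x * v $ i" if "i < n" for i
  proof -
    have "(H *\<^sub>v v) $ i = (\<Sum>j<n. H $$ (i, j) * v $ j)"
      using that H(1) v(1) by (simp add: scalar_prod_def lessThan_atLeast0)
    then show ?thesis using that v(1,3) by simp
  qed
  define s where "s = (\<Sum>i<n. cnj (v $ i) * v $ i)"
  define q where "q = (\<Sum>i<n. cnj (v $ i) * (\<Sum>j<n. H $$ (i, j) * v $ j))"
  have q: "q = x * s"
    unfolding q_def s_def sum_distrib_left[of x]
    by (rule sum.cong) (simp_all add: Hv)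
  have "cnj q = (\<Sum>i<n. \<Sum>j<n. v $ i * (H $$ (j, i) * cnj (v $ j)))"
    unfolding q_def by (simp add: herm sum_distrib_left)
  also have "\<dots> = (\<Sum>j<n. \<Sum>i<n. v $ i * (H $$ (j, i) * cnj (v $ j)))"
    by (rule sum.swap)
  also have "\<dots> = q"
    unfolding q_def by (simp add: sum_distrib_left mult_ac)
  finally have "cnj q = q" .
  moreover have s: "s = of_real (\<Sum>i<n. (cmod (v $ i))\<^sup>2)"
    unfolding s_def of_real_sum
    by (rule sum.cong) (simp_all add: complex_norm_square[symmetric] mult.commute del: of_real_power)
  moreover have "(\<Sum>i<n. (cmod (v $ i))\<^sup>2) \<noteq> 0"
  proof
    assume "(\<Sum>i<n. (cmod (v $ i))\<^sup>2) = 0"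
    then have "v $ i = 0" if "i < n" for i
      using that by (simp add: sum_nonneg_eq_0_iff)
    with v show False by auto
  qed
  ultimately have "cnj x = x"
    using q by (metis complex_cnj_complex_of_real complex_cnj_mult mult_cancel_right of_real_eq_0_iff)
  then show ?thesis by (simp add: complex_eq_iff)
qed

end

theory Submission
  imports Defs
begin

text \<open>
  Write \<open>q x = x\<^sup>* A x\<close>. The point \<open>0\<close> lies in the rank-\<open>k\<close> numerical range iff \<open>q\<close> vanishes on
  some \<open>k\<close>-dimensional subspace, and the eigenvalue condition says that every form
  \<open>Re (exp (i \<xi>) q)\<close> is nonnegative on some \<open>k\<close>-dimensional subspace depending on \<open>\<xi>\<close>. That the
  second property implies the first is shown by induction on \<open>n\<close>, without canonical forms.

  Suppose \<open>q x = 0\<close> and \<open>A x\<close>, \<open>A\<^sup>* x\<close> are multiples of one vector \<open>p\<close>. Then \<open>x\<close> can be split off: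
  compressing \<open>A\<close> to the orthogonal complement of \<open>x\<close> and \<open>p\<close> lowers \<open>k\<close> by one only. If
  \<open>\<lambda>\<^sub>k\<close> of \<open>H = exp (i \<xi>) A + exp (- i \<xi>) A\<^sup>*\<close> vanishes for some \<open>\<xi>\<close>, such an \<open>x\<close> exists in the
  kernel of \<open>H\<close>, since otherwise the derivative of the family would be definite on that kernel
  and \<open>\<lambda>\<^sub>k\<close> would become negative nearby. If \<open>\<lambda>\<^sub>k > 0\<close> for all \<open>\<xi>\<close> and \<open>n \<le> 2 k\<close>, all these
  matrices are nonsingular and an eigenvector of the pencil \<open>(A, A\<^sup>*)\<close> serves as \<open>x\<close>.
  If \<open>\<lambda>\<^sub>k > 0\<close> for all \<open>\<xi>\<close> and \<open>n > 2 k\<close>, moving along \<open>A - t I\<close> in both directions until \<open>\<lambda>\<^sub>k\<close>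
  vanishes gives \<open>k\<close>-dimensional subspaces on which \<open>q\<close> is \<open>t |x|\<^sup>2\<close> and \<open>- r |x|\<^sup>2\<close> with \<open>t, r > 0\<close>;
  on their \<open>2 k\<close>-dimensional sum the condition holds trivially, and the induction hypothesis applies.
\<close>

section \<open>Quadratic forms and frames\<close>

text \<open>The obstacle is that the nonnegative subspaces at different angles are unrelated, while
  a single isotropic subspace has to serve all of them. Splitting off \<open>x\<close> may cost two
  dimensions of the space but only one of a nonnegative subspace: if the subspace contains
  \<open>x\<close>, nonnegativity already makes it orthogonal to \<open>p\<close>; if it does not,
  orthogonality to \<open>p\<close> is the only condition to impose. With
  \<open>A x = \<alpha> p\<close> and \<open>\<beta> p\<close> for the image of \<open>x\<close>
  under the adjoint, the first alternative requires \<open>p = 0\<close> or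
  \<open>exp (\<i> \<xi>) \<alpha> + exp (- \<i> \<xi>) \<beta>\<close> to be nonzero. Angles where
  this fails are recovered from nearby ones, since the \<open>k\<close>-th eigenvalue depends
  continuously on the angle. The threshold \<open>2 k\<close> has this origin: positivity at an
  angle and at the opposite angle gives \<open>k\<close>-dimensional subspaces on which one and the
  same form is positive and negative. Such subspaces leave no room for a kernel when
  \<open>n \<le> 2 k\<close>. For larger \<open>n\<close> nonsingularity may fail, and the detour
  through their shifted analogues leads to a space of dimension \<open>2 k < n\<close>.\<close>

lemma cdot_sum: 
  fixes x y :: "complex vec"
  assumes "x \<in> carrier_vec n" "y \<in> carrier_vec n"
  shows "x \<bullet>c y = (\<Sum>i<n. x $ i * cnj (y $ i))"
  using assms by (simp add: scalar_prod_def lessThan_atLeast0)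

lemma mult_mat_vec_sum:
  fixes A :: "complex mat"
  assumes "A \<in> carrier_mat n m" "x \<in> carrier_vec m" "i < n"
  shows "(A *\<^sub>v x) $ i = (\<Sum>j<m. A $$ (i, j) * x $ j)"
  using assms by (simp add: scalar_prod_def lessThan_atLeast0)

lemma dim_adjoint [simp]:
  "dim_row (mat_adjoint A) = dim_col A" "dim_col (mat_adjoint A) = dim_row A"
  by (simp_all add: mat_adjoint_def mat_of_rows_def)

lemma adjoint_carrier [simp]:
  assumes "A \<in> carrier_mat n m"
  shows "mat_adjoint A \<in> carrier_mat m n"
  using assms by (auto simp: mat_adjoint_def mat_of_rows_def)

lemma cdot_adjoint:
  fixes A :: "complex mat"
  assumes A: "A \<in> carrier_mat n m" and x: "x \<in> carrier_vec m" and y: "y \<in> carrier_vec n"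
  shows "(A *\<^sub>v x) \<bullet>c y = x \<bullet>c (mat_adjoint A *\<^sub>v y)"
proof -
  have "(A *\<^sub>v x) \<bullet>c y = (\<Sum>i<n. \<Sum>j<m. A $$ (i, j) * x $ j * cnj (y $ i))"
    unfolding cdot_sum[OF mult_mat_vec_carrier[OF A x] y]
    by (intro sum.cong refl) (simp add: mult_mat_vec_sum[OF A x] sum_distrib_right)
  also have "\<dots> = (\<Sum>j<m. \<Sum>i<n. A $$ (i, j) * x $ j * cnj (y $ i))"
    by (rule sum.swap)
  also have "\<dots> = x \<bullet>c (mat_adjoint A *\<^sub>v y)"
    unfolding cdot_sum[OF x mult_mat_vec_carrier[OF adjoint_carrier[OF A] y]]
  proof (intro sum.cong refl)
    fix j assume "j \<in> {..<m}"
    then have j: "j < m" by simp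
    have "(\<Sum>i<n. mat_adjoint A $$ (j, i) * y $ i) = (\<Sum>i<n. cnj (A $$ (i, j)) * y $ i)"
      using A j by (intro sum.cong refl) (simp add: mat_adjoint_index)
    then show "(\<Sum>i<n. A $$ (i, j) * x $ j * cnj (y $ i)) = x $ j * cnj ((mat_adjoint A *\<^sub>v y) $ j)"
      unfolding mult_mat_vec_sum[OF adjoint_carrier[OF A] y j]
      by (simp add: sum_distrib_left mult_ac)
  qed
  finally show ?thesis .
qed

lemma adjoint_adjoint [simp]:
  fixes A :: "complex mat"
  assumes "A \<in> carrier_mat n m"
  shows "mat_adjoint (mat_adjoint A) = A"
  using assms adjoint_carrier[OF assms]
  by (intro eq_matI) (auto simp: mat_adjoint_index)

lemma adjoint_mult:
  fixes A :: "complex mat"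
  assumes A: "A \<in> carrier_mat n m" and B: "B \<in> carrier_mat m l"
  shows "mat_adjoint (A * B) = mat_adjoint B * mat_adjoint A"
  using A B
  by (intro eq_matI) (auto simp: mat_adjoint_index scalar_prod_def mult_ac intro!: sum.cong)

definition sqn :: "complex vec \<Rightarrow> real" where
  "sqn x = Re (x \<bullet>c x)"

definition qf :: "complex mat \<Rightarrow> complex vec \<Rightarrow> complex" where
  "qf A x = (A *\<^sub>v x) \<bullet>c x"

text \<open>A \<open>k\<close>-dimensional subspace is encoded by an injective matrix having it as
  range. Orthonormal columns are not demanded, so that products and concatenations of bases qualify
  directly.\<close>

definition frame :: "nat \<Rightarrow> nat \<Rightarrow> complex mat \<Rightarrow> bool" where
  "frame n k U \<longleftrightarrow> U \<in> carrier_mat n k \<and> (\<forall>v\<in>carrier_vec k. U *\<^sub>v v = 0\<^sub>v n \<longrightarrow> v = 0\<^sub>v k)"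

lemma cdot_commute:
  fixes x y :: "complex vec"
  assumes "x \<in> carrier_vec n" "y \<in> carrier_vec n"
  shows "y \<bullet>c x = cnj (x \<bullet>c y)"
  using assms by (simp add: cdot_sum mult.commute)

lemma sqn_sum:
  assumes "x \<in> carrier_vec n"
  shows "sqn x = (\<Sum>i<n. (cmod (x $ i))\<^sup>2)"
  using assms by (simp add: sqn_def cdot_sum cmod_def power2_eq_square)

lemma cdot_self:
  fixes x :: "complex vec"
  shows "x \<bullet>c x = of_real (sqn x)"
proof -
  have x: "x \<in> carrier_vec (dim_vec x)" by simp
  show ?thesis
    unfolding sqn_sum[OF x] cdot_sum[OF x x] of_real_sum
    by (simp add: complex_norm_square[symmetric] del: of_real_power)
qed

lemma sqn_nonneg [simp]: "0 \<le> sqn x"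
proof -
  have x: "x \<in> carrier_vec (dim_vec x)" by simp
  show ?thesis unfolding sqn_sum[OF x] by (simp add: sum_nonneg)
qed

lemma sqn_eq_0:
  assumes "x \<in> carrier_vec n"
  shows "sqn x = 0 \<longleftrightarrow> x = 0\<^sub>v n"
proof
  assume "sqn x = 0"
  then show "x = 0\<^sub>v n" using assms
    by (auto simp: sqn_sum sum_nonneg_eq_0_iff)
qed (use sqn_sum[OF assms] in simp)

lemma sqn_smult:
  "sqn (c \<cdot>\<^sub>v x) = (cmod c)\<^sup>2 * sqn x"
proof -
  have x: "x \<in> carrier_vec (dim_vec x)" by simp
  have x': "c \<cdot>\<^sub>v x \<in> carrier_vec (dim_vec x)" by simp
  show ?thesis unfolding sqn_sum[OF x] sqn_sum[OF x']
    by (simp add: norm_mult power_mult_distrib sum_distrib_left)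
qed

lemma frameD:
  assumes "frame n k U"
  shows "U \<in> carrier_mat n k" "v \<in> carrier_vec k \<Longrightarrow> U *\<^sub>v v = 0\<^sub>v n \<Longrightarrow> v = 0\<^sub>v k"
  using assms by (auto simp: frame_def)

lemma frame_mult:
  assumes U: "frame n m U" and V: "frame m k V"
  shows "frame n k (U * V)"
  unfolding frame_def
proof (intro conjI ballI impI)
  show "U * V \<in> carrier_mat n k" using frameD(1)[OF U] frameD(1)[OF V] by simp
  fix v :: "complex vec" assume v: "v \<in> carrier_vec k" "U * V *\<^sub>v v = 0\<^sub>v n"
  then have "U *\<^sub>v (V *\<^sub>v v) = 0\<^sub>v n"
    using frameD(1)[OF U] frameD(1)[OF V] by simp
  then have "V *\<^sub>v v = 0\<^sub>v m"
    using frameD(1)[OF V] v by (intro frameD(2)[OF U]) auto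
  then show "v = 0\<^sub>v k" by (rule frameD(2)[OF V v(1)])
qed

lemma isometry_sqn:
  assumes U: "U \<in> carrier_mat n k" "mat_adjoint U * U = 1\<^sub>m k" and v: "v \<in> carrier_vec k"
  shows "sqn (U *\<^sub>v v) = sqn v"
proof -
  have "(U *\<^sub>v v) \<bullet>c (U *\<^sub>v v) = v \<bullet>c (mat_adjoint U *\<^sub>v (U *\<^sub>v v))"
    by (rule cdot_adjoint[OF U(1) v]) (use U v in auto)
  also have "mat_adjoint U *\<^sub>v (U *\<^sub>v v) = v"
    using assoc_mult_mat_vec[OF adjoint_carrier[OF U(1)] U(1) v] U v by simp
  finally show ?thesis by (simp add: sqn_def)
qed

lemma frame_isometry:
  assumes U: "U \<in> carrier_mat n k" "mat_adjoint U * U = 1\<^sub>m k"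
  shows "frame n k U"
  unfolding frame_def
proof (intro conjI ballI impI)
  fix v :: "complex vec" assume v: "v \<in> carrier_vec k" "U *\<^sub>v v = 0\<^sub>v n"
  then have "sqn v = 0"
    using isometry_sqn[OF U v(1)] sqn_eq_0[of "0\<^sub>v n" n] by simp
  then show "v = 0\<^sub>v k" using v by (simp add: sqn_eq_0)
qed fact

lemma cdot_add:
  fixes x y z :: "complex vec"
  assumes "x \<in> carrier_vec n" "y \<in> carrier_vec n" "z \<in> carrier_vec n"
  shows "(x + y) \<bullet>c z = x \<bullet>c z + y \<bullet>c z" "z \<bullet>c (x + y) = z \<bullet>c x + z \<bullet>c y"
  using assms
  by (simp_all add: cdot_sum[of _ n] distrib_left distrib_right sum.distrib)

lemma qf_add:
  assumes A: "A \<in> carrier_mat n n" and x: "x \<in> carrier_vec n" and y: "y \<in> carrier_vec n"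
  shows "qf A (x + y) = qf A x + qf A y + (A *\<^sub>v x) \<bullet>c y + (A *\<^sub>v y) \<bullet>c x"
proof -
  have Ax: "A *\<^sub>v x \<in> carrier_vec n" and Ay: "A *\<^sub>v y \<in> carrier_vec n" using assms by auto
  have "A *\<^sub>v (x + y) = A *\<^sub>v x + A *\<^sub>v y" using assms by (rule mult_add_distrib_mat_vec)
  then show ?thesis unfolding qf_def
    using Ax Ay x y 
    by (simp add: cdot_add[of _ n])
qed

lemma cdot_smult:
  fixes x y :: "complex vec"
  assumes "x \<in> carrier_vec n" "y \<in> carrier_vec n"
  shows "(c \<cdot>\<^sub>v x) \<bullet>c y = c * (x \<bullet>c y)" "x \<bullet>c (c \<cdot>\<^sub>v y) = cnj c * (x \<bullet>c y)"
  using assms by (simp_all add: cdot_sum sum_distrib_left mult_ac)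

lemma qf_smult:
  assumes A: "A \<in> carrier_mat n n" and x: "x \<in> carrier_vec n"
  shows "qf A (c \<cdot>\<^sub>v x) = of_real ((cmod c)\<^sup>2) * qf A x"
proof -
  have Ax: "A *\<^sub>v x \<in> carrier_vec n" using assms by auto
  have "A *\<^sub>v (c \<cdot>\<^sub>v x) = c \<cdot>\<^sub>v (A *\<^sub>v x)" using assms by (rule mult_mat_vec)
  then show ?thesis unfolding qf_def
    using Ax x by (simp add: cdot_smult[of _ n] complex_norm_square mult.commute del: of_real_power)
qed

lemma qf_congruence:
  assumes A: "A \<in> carrier_mat n n" and W: "W \<in> carrier_mat n m" and x: "x \<in> carrier_vec m"
  shows "qf (mat_adjoint W * A * W) x = qf A (W *\<^sub>v x)"
proof -
  have Wx: "W *\<^sub>v x \<in> carrier_vec n" using assms by auto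
  have "mat_adjoint W * A * W *\<^sub>v x = mat_adjoint W *\<^sub>v (A *\<^sub>v (W *\<^sub>v x))"
    using assms Wx
    by (simp add: assoc_mult_mat_vec[OF mult_carrier_mat[OF adjoint_carrier[OF W] A] W x]
        assoc_mult_mat_vec[OF adjoint_carrier[OF W] A Wx])
  then show ?thesis unfolding qf_def
    using cdot_adjoint[OF adjoint_carrier[OF W], of "A *\<^sub>v (W *\<^sub>v x)" x] assms Wx W
    by simp
qed

lemma qf_smult_mat:
  assumes A: "A \<in> carrier_mat n n" and x: "x \<in> carrier_vec n"
  shows "qf (c \<cdot>\<^sub>m A) x = c * qf A x"
proof -
  have "c \<cdot>\<^sub>m A *\<^sub>v x = c \<cdot>\<^sub>v (A *\<^sub>v x)"
    using assms by (intro eq_vecI) auto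
  then show ?thesis unfolding qf_def
    using assms by (simp add: cdot_smult[of _ n])
qed

lemma qf_add_mat:
  assumes A: "A \<in> carrier_mat n n" and B: "B \<in> carrier_mat n n" and x: "x \<in> carrier_vec n"
  shows "qf (A + B) x = qf A x + qf B x"
proof -
  have "(A + B) *\<^sub>v x = A *\<^sub>v x + B *\<^sub>v x" using A B x by (rule add_mult_distrib_mat_vec)
  moreover have "A *\<^sub>v x \<in> carrier_vec n" "B *\<^sub>v x \<in> carrier_vec n" using assms by auto
  ultimately show ?thesis unfolding qf_def
    using x by (simp add: cdot_add[of _ n])
qed

lemma qf_adjoint:
  assumes A: "A \<in> carrier_mat n n" and x: "x \<in> carrier_vec n"
  shows "qf (mat_adjoint A) x = cnj (qf A x)"
  unfolding qf_def
  using cdot_adjoint[OF A x x] cdot_commute[OF x mult_mat_vec_carrier[OF adjoint_carrier[OF A] x]]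
  by simp

lemma qf_one: 
  assumes "x \<in> carrier_vec n"
  shows "qf (1\<^sub>m n) x = of_real (sqn x)"
  using assms by (simp add: qf_def cdot_self)

text \<open>Twice the Hermitian part of \<open>exp (\<i> * of_real \<xi>) \<cdot>\<^sub>m A\<close>;
  hence the factor 2 wherever \<open>lam\<close> is compared with real parts of
  \<open>qf A\<close>.\<close>

definition rot :: "real \<Rightarrow> complex mat \<Rightarrow> complex mat" where
  "rot \<xi> A = exp (\<i> * of_real \<xi>) \<cdot>\<^sub>m A + exp (- \<i> * of_real \<xi>) \<cdot>\<^sub>m mat_adjoint A"

lemma rot_carrier [simp]:
  "A \<in> carrier_mat n n \<Longrightarrow> rot \<xi> A \<in> carrier_mat n n"
  unfolding rot_def by auto

lemma cnj_exp_i: 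
  "cnj (exp (\<i> * of_real \<xi>)) = exp (- \<i> * of_real \<xi>)"
  "cnj (exp (- \<i> * of_real \<xi>)) = exp (\<i> * of_real \<xi>)"
  using cis_cnj[of \<xi>] cis_cnj[of "- \<xi>"] by (simp_all add: cis_conv_exp)

lemma rot_hermitian:
  assumes A: "A \<in> carrier_mat n n"
  shows "mat_adjoint (rot \<xi> A) = rot \<xi> A"
  using A adjoint_carrier[OF A] adjoint_carrier[OF rot_carrier[OF A, of \<xi>]]
  by (intro eq_matI) (auto simp: rot_def mat_adjoint_index cnj_exp_i[simplified])

lemma qf_rot:
  assumes A: "A \<in> carrier_mat n n" and x: "x \<in> carrier_vec n"
  shows "qf (rot \<xi> A) x = of_real (2 * Re (exp (\<i> * of_real \<xi>) * qf A x))"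
proof -
  have "qf (rot \<xi> A) x = exp (\<i> * of_real \<xi>) * qf A x + cnj (exp (\<i> * of_real \<xi>) * qf A x)"
    unfolding rot_def cnj_exp_i(1) complex_cnj_mult
    using A x adjoint_carrier[OF A]
    by (simp add: qf_add_mat[of _ n] qf_smult_mat[of _ n] qf_adjoint[of _ n] smult_carrier_mat)
  then show ?thesis by (simp add: complex_add_cnj del: complex_cnj_mult)
qed

text \<open>Fewer than \<open>k\<close> homogeneous equations in \<open>k\<close> unknowns have a
  nonzero solution: the selected rows, padded with zero rows to a square matrix, have determinant 0.
  The dimension counts below rest on this.\<close>

lemma kernel_vector:
  fixes M :: "complex mat"
  assumes M: "M \<in> carrier_mat n k" and I: "finite I" "card I < k" "I \<subseteq> {..<n}"
  shows "\<exists>v. v \<in> carrier_vec k \<and> v \<noteq> 0\<^sub>v k \<and> (\<forall>i\<in>I. (M *\<^sub>v v) $ i = 0)"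
proof -
  obtain l where l: "set l = I" "distinct l" using finite_distinct_list[OF I(1)] by blast
  have len: "length l < k" using I(2) l distinct_card by fastforce
  define c where "c i = (if i < length l then row M (l ! i) else 0\<^sub>v k)" for i
  \<comment> \<open>\<open>c\<close> already vanishes at \<open>length l\<close>; the case
    distinction only reproduces the shape that \<open>det_row_0\<close> expects.\<close>
  define B where "B = mat\<^sub>r k k (\<lambda>i. if i = length l then 0\<^sub>v k else c i)"
  have cc: "c i \<in> carrier_vec k" for i
    using M unfolding c_def by auto
  then have "det B = 0" unfolding B_def by (intro det_row_0[OF len]) auto
  moreover have B: "B \<in> carrier_mat k k" unfolding B_def by simp
  ultimately obtain v where v: "v \<in> carrier_vec k" "v \<noteq> 0\<^sub>v k" "B *\<^sub>v v = 0\<^sub>v k"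
    using det_0_iff_vec_prod_zero[OF B] by blast
  have "(M *\<^sub>v v) $ i = 0" if i: "i \<in> I" for i
  proof -
    obtain j where j: "j < length l" "l ! j = i" using i l by (metis in_set_conv_nth)
    have "row B j = c j" unfolding B_def using j len cc by (subst row_mat_of_row_fun) auto
    then have "(B *\<^sub>v v) $ j = (M *\<^sub>v v) $ i"
      using j len i I(3) B M by (auto simp: c_def)
    then show ?thesis using v(3) j len by simp
  qed
  then show ?thesis using v by blast
qed

section \<open>Matrices with orthonormal columns\<close>

definition isom :: "nat \<Rightarrow> nat \<Rightarrow> complex mat \<Rightarrow> bool" where
  "isom n k U \<longleftrightarrow> U \<in> carrier_mat n k \<and> mat_adjoint U * U = 1\<^sub>m k"

lemma index_adjoint_mult:
  fixes U V :: "complex mat"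
  assumes "U \<in> carrier_mat n k" "V \<in> carrier_mat n l" "i < k" "j < l"
  shows "(mat_adjoint U * V) $$ (i, j) = col V j \<bullet>c col U i"
  using assms by (auto simp: scalar_prod_def mat_adjoint_index mult.commute intro!: sum.cong)

lemma isom_iff:
  "isom n k U \<longleftrightarrow> U \<in> carrier_mat n k \<and>
    (\<forall>i<k. \<forall>j<k. col U j \<bullet>c col U i = (if i = j then 1 else 0))"
proof (cases "U \<in> carrier_mat n k")
  case True
  have "mat_adjoint U * U = 1\<^sub>m k \<longleftrightarrow> (\<forall>i<k. \<forall>j<k. (mat_adjoint U * U) $$ (i, j) = 1\<^sub>m k $$ (i, j))"
    using True by (auto simp del: index_mult_mat(1) index_one_mat(1) intro!: eq_matI)
  also have "\<dots> \<longleftrightarrow> (\<forall>i<k. \<forall>j<k. col U j \<bullet>c col U i = (if i = j then 1 else 0))"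
    using index_adjoint_mult[OF True True] by (simp del: index_mult_mat(1))
  finally show ?thesis using True by (simp add: isom_def)
qed (simp add: isom_def)

lemma isomD:
  assumes "isom n k U"
  shows "U \<in> carrier_mat n k" "mat_adjoint U * U = 1\<^sub>m k"
    "i < k \<Longrightarrow> j < k \<Longrightarrow> col U j \<bullet>c col U i = (if i = j then 1 else 0)"
  using assms isom_iff[of n k U] by (auto simp: isom_def)

lemma isom_adjoint_mult_vec:
  assumes U: "isom n k U" and v: "v \<in> carrier_vec k"
  shows "mat_adjoint U *\<^sub>v (U *\<^sub>v v) = v"
  using assoc_mult_mat_vec[OF adjoint_carrier[OF isomD(1)[OF U]] isomD(1)[OF U] v] isomD(2)[OF U] v
  by simp

lemma isom_cdot:
  assumes U: "isom n k U" and v: "v \<in> carrier_vec k" and w: "w \<in> carrier_vec k"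
  shows "(U *\<^sub>v v) \<bullet>c (U *\<^sub>v w) = v \<bullet>c w"
  using cdot_adjoint[OF isomD(1)[OF U] v mult_mat_vec_carrier[OF isomD(1)[OF U] w]]
  by (simp add: isom_adjoint_mult_vec[OF U w])

lemma isom_mult:
  assumes U: "isom n m U" and V: "isom m k V"
  shows "isom n k (U * V)"
  using assms unfolding isom_iff
proof (intro conjI allI impI)
  show "U * V \<in> carrier_mat n k" using isomD(1)[OF U] isomD(1)[OF V] by simp
  fix i j assume ij: "i < k" "j < k"
  then have "(U *\<^sub>v col V j) \<bullet>c (U *\<^sub>v col V i) = col V j \<bullet>c col V i"
    using isomD(1)[OF V] by (intro isom_cdot[OF U]) auto
  then have "col (U * V) j \<bullet>c col (U * V) i = col V j \<bullet>c col V i"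
    unfolding col_mult2[OF isomD(1)[OF U] isomD(1)[OF V] ij(1)]
      col_mult2[OF isomD(1)[OF U] isomD(1)[OF V] ij(2)] .
  then show "col (U * V) j \<bullet>c col (U * V) i = (if i = j then 1 else 0)"
    using isomD(3)[OF V ij] by simp
qed

lemma isom_sqn:
  assumes "isom n k U" "v \<in> carrier_vec k"
  shows "sqn (U *\<^sub>v v) = sqn v"
  using isom_cdot[OF assms(1,2,2)] by (simp add: sqn_def)

lemma isom_frame:
  assumes U: "isom n k U"
  shows "frame n k U"
  by (rule frame_isometry) (use isomD[OF U] in auto)

section \<open>Concatenation of columns and orthonormal completion\<close>

definition hcat :: "complex mat \<Rightarrow> complex mat \<Rightarrow> complex mat" where
  "hcat A B = mat (dim_row A) (dim_col A + dim_col B)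
     (\<lambda>(i, j). if j < dim_col A then A $$ (i, j) else B $$ (i, j - dim_col A))"

lemma hcat_carrier [simp]:
  "A \<in> carrier_mat n a \<Longrightarrow> B \<in> carrier_mat n b \<Longrightarrow> hcat A B \<in> carrier_mat n (a + b)"
  by (simp add: hcat_def)

lemma col_hcat:
  assumes "A \<in> carrier_mat n a" "B \<in> carrier_mat n b" "j < a + b"
  shows "col (hcat A B) j = (if j < a then col A j else col B (j - a))"
  using assms by (intro eq_vecI) (auto simp: hcat_def)

lemma sum_add_split:
  fixes f :: "nat \<Rightarrow> 'a::comm_monoid_add"
  shows "(\<Sum>i<a + b. f i) = (\<Sum>i<a. f i) + (\<Sum>i<b. f (a + i))"
  by (induction b) (simp_all add: add.assoc)

lemma hcat_mult_vec:
  assumes A: "A \<in> carrier_mat n a" and B: "B \<in> carrier_mat n b"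
    and v: "v \<in> carrier_vec a" and w: "w \<in> carrier_vec b"
  shows "hcat A B *\<^sub>v (v @\<^sub>v w) = A *\<^sub>v v + B *\<^sub>v w"
proof (intro eq_vecI)
  fix i assume "i < dim_vec (A *\<^sub>v v + B *\<^sub>v w)"
  then have i: "i < n" using B by simp
  have "(hcat A B *\<^sub>v (v @\<^sub>v w)) $ i = (\<Sum>j<a + b. hcat A B $$ (i, j) * (v @\<^sub>v w) $ j)"
    using assms i by (intro mult_mat_vec_sum) auto
  also have "\<dots> = (A *\<^sub>v v) $ i + (B *\<^sub>v w) $ i"
    unfolding mult_mat_vec_sum[OF A v i] mult_mat_vec_sum[OF B w i] sum_add_split
    using assms i by (intro arg_cong2[of _ _ _ _ "(+)"] sum.cong refl) (auto simp: hcat_def)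
  finally show "(hcat A B *\<^sub>v (v @\<^sub>v w)) $ i = (A *\<^sub>v v + B *\<^sub>v w) $ i"
    using A B i by simp
qed (use A B in \<open>auto simp: hcat_def\<close>)

lemma isom_hcat:
  assumes A: "isom n a A" and B: "isom n b B"
    and AB: "\<And>i j. i < a \<Longrightarrow> j < b \<Longrightarrow> col B j \<bullet>c col A i = 0"
  shows "isom n (a + b) (hcat A B)"
  unfolding isom_iff
proof (intro conjI allI impI)
  show "hcat A B \<in> carrier_mat n (a + b)" using isomD(1)[OF A] isomD(1)[OF B] by simp
  fix i j assume ij: "i < a + b" "j < a + b"
  have "col A i \<bullet>c col B j = 0" if "i < a" "j < b" for i j
    using cdot_commute[of "col B j" n "col A i"] AB[OF that] isomD(1)[OF A] isomD(1)[OF B] that by simp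
  then show "col (hcat A B) j \<bullet>c col (hcat A B) i = (if i = j then 1 else 0)"
    using ij isomD(3)[OF A] isomD(3)[OF B] AB
    by (auto simp: col_hcat[OF isomD(1)[OF A] isomD(1)[OF B]])
qed

definition colmat :: "complex vec \<Rightarrow> complex mat" where
  "colmat v = mat (dim_vec v) 1 (\<lambda>(i, j). v $ i)"

lemma colmat_carrier [simp]: "v \<in> carrier_vec n \<Longrightarrow> colmat v \<in> carrier_mat n (Suc 0)"
  by (simp add: colmat_def)

lemma col_colmat [simp]: "col (colmat v) 0 = v"
  by (auto simp: colmat_def)

lemma colmat_mult_vec:
  assumes "v \<in> carrier_vec n" "c \<in> carrier_vec 1"
  shows "colmat v *\<^sub>v c = (c $ 0) \<cdot>\<^sub>v v"
  using assms by (intro eq_vecI) (auto simp: colmat_def scalar_prod_def)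

lemma isom_colmat:
  assumes "v \<in> carrier_vec n" "sqn v = 1"
  shows "isom n 1 (colmat v)"
  using assms by (simp add: isom_iff cdot_self)

lemma isom_empty:
  "isom n 0 (0\<^sub>m n 0)"
  by (simp add: isom_iff)

lemma normalize_vec:
  fixes v :: "complex vec"
  assumes v: "v \<in> carrier_vec n" "v \<noteq> 0\<^sub>v n"
  defines "c \<equiv> complex_of_real (1 / sqrt (sqn v))"
  shows "c \<noteq> 0" "c \<cdot>\<^sub>v v \<in> carrier_vec n" "sqn (c \<cdot>\<^sub>v v) = 1"
proof -
  have "sqn v > 0" using sqn_eq_0[OF v(1)] v(2) sqn_nonneg[of v] by linarith
  then show "c \<noteq> 0" "c \<cdot>\<^sub>v v \<in> carrier_vec n" "sqn (c \<cdot>\<^sub>v v) = 1"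
    using v by (auto simp: c_def sqn_smult norm_divide power_divide)
qed

text \<open>One column at a time: the next vector has to satisfy the \<open>r\<close> equations of
  \<open>B\<close> and \<open>j\<close> orthogonality relations, and \<open>r + j < k\<close> leaves
  a nonzero solution.\<close>

lemma orthonormal_kernel:
  fixes B :: "complex mat"
  assumes B: "B \<in> carrier_mat r k" and "j + r \<le> k"
  shows "\<exists>Q. isom k j Q \<and> B * Q = 0\<^sub>m r j"
  using assms(2)
proof (induction j)
  case 0
  then show ?case using isom_empty[of k] B by (intro exI[of _ "0\<^sub>m k 0"]) auto
next
  case (Suc j)
  then obtain Q where Q: "isom k j Q" "B * Q = 0\<^sub>m r j" by auto
  \<comment> \<open>The rows below those of \<open>B\<close> are the conjugated columns of
    \<open>Q\<close>, so a vector killed by \<open>M\<close> lies in the kernel of \<open>B\<close>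
    and is orthogonal to the columns found so far.\<close>
  define M where "M = mat (r + j) k (\<lambda>(i, l). if i < r then B $$ (i, l) else cnj (Q $$ (l, i - r)))"
  have M: "M \<in> carrier_mat (r + j) k" by (simp add: M_def)
  obtain v where v: "v \<in> carrier_vec k" "v \<noteq> 0\<^sub>v k" "\<And>i. i < r + j \<Longrightarrow> (M *\<^sub>v v) $ i = 0"
    using kernel_vector[OF M, of "{..<r + j}"] Suc.prems by auto
  define u where "u = complex_of_real (1 / sqrt (sqn v)) \<cdot>\<^sub>v v"
  note u = normalize_vec[OF v(1,2), folded u_def]
  have Mu: "(M *\<^sub>v u) $ i = 0" if "i < r + j" for i
    using v(3)[OF that] mult_mat_vec[OF M v(1)] M that by (simp add: u_def)
  have "row B i \<bullet> u = 0" if "i < r" for i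
  proof -
    have "row M i = row B i" using B that by (intro eq_vecI) (auto simp: M_def)
    then show ?thesis using Mu[of i] M that by simp
  qed
  note Bu = this
  have Qu: "u \<bullet>c col Q i = 0" if "i < j" for i
  proof -
    have "row M (r + i) = conjugate (col Q i)"
      using isomD(1)[OF Q(1)] that by (intro eq_vecI) (auto simp: M_def)
    then show ?thesis using Mu[of "r + i"] M that u(2) isomD(1)[OF Q(1)]
      by (simp add: comm_scalar_prod[of u k])
  qed
  have cu: "colmat u \<in> carrier_mat k 1" using u(2) by simp
  have "isom k (j + 1) (hcat Q (colmat u))"
    using Q(1) isom_colmat[OF u(2,3)] Qu by (intro isom_hcat) auto
  moreover have "B * hcat Q (colmat u) = 0\<^sub>m r (j + 1)"
  proof (intro eq_matI)
    fix i l assume "i < dim_row (0\<^sub>m r (j + 1) :: complex mat)" "l < dim_col (0\<^sub>m r (j + 1) :: complex mat)"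
    then have il: "i < r" "l < j + 1" by auto
    have "(B * hcat Q (colmat u)) $$ (i, l) = row B i \<bullet> col (hcat Q (colmat u)) l"
      using B il hcat_carrier[OF isomD(1)[OF Q(1)] cu] by (intro index_mult_mat(1)) auto
    also have "\<dots> = 0"
    proof (cases "l < j")
      case True
      have "(B * Q) $$ (i, l) = row B i \<bullet> col Q l"
        using B il True isomD(1)[OF Q(1)] by (intro index_mult_mat(1)) auto
      then show ?thesis using True il Q(2) by (simp add: col_hcat[OF isomD(1)[OF Q(1)] cu])
    next
      case False
      then have "l = j" using il by simp
      then show ?thesis using Bu[OF il(1)] by (simp add: col_hcat[OF isomD(1)[OF Q(1)] cu])
    qed
    finally show "(B * hcat Q (colmat u)) $$ (i, l) = 0\<^sub>m r (j + 1) $$ (i, l)" using il by simp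
  qed (use B in \<open>auto simp: hcat_def colmat_def\<close>, use isomD(1)[OF Q(1)] in auto)
  ultimately show ?case by (intro exI[of _ "hcat Q (colmat u)"]) simp
qed

lemma frame_dim_le:
  assumes "frame n k U"
  shows "k \<le> n"
proof (rule ccontr)
  assume "\<not> k \<le> n"
  then obtain v where v: "v \<in> carrier_vec k" "v \<noteq> 0\<^sub>v k" "\<And>i. i < n \<Longrightarrow> (U *\<^sub>v v) $ i = 0"
    using kernel_vector[OF frameD(1)[OF assms], of "{..<n}"] by auto
  then have "U *\<^sub>v v = 0\<^sub>v n" using frameD(1)[OF assms] by (intro eq_vecI) auto
  then show False using frameD(2)[OF assms] v by blast
qed

lemma adjoint_hcat_mult_vec:
  assumes A: "A \<in> carrier_mat n a" and B: "B \<in> carrier_mat n b" and y: "y \<in> carrier_vec n"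
  shows "mat_adjoint (hcat A B) *\<^sub>v y = (mat_adjoint A *\<^sub>v y) @\<^sub>v (mat_adjoint B *\<^sub>v y)"
proof -
  have row: "row (mat_adjoint M) j = conjugate (col M j)" if "j < dim_col M" for M :: "complex mat" and j
    using that by (intro eq_vecI) (auto simp: mat_adjoint_index)
  show ?thesis
    using A B y carrier_matD[OF hcat_carrier[OF A B]]
    by (intro eq_vecI) (auto simp: row col_hcat[OF A B])
qed

text \<open>\<open>hcat V W\<close> is square with orthonormal columns, so its adjoint is also a
  right inverse. Written out in blocks, this is the orthogonal decomposition of
  \<open>y\<close>.\<close>

lemma orthonormal_complement:
  assumes V: "isom n r V"
  shows "\<exists>W. isom n (n - r) W \<and> mat_adjoint V * W = 0\<^sub>m r (n - r) \<and> 
    (\<forall>y\<in>carrier_vec n. V *\<^sub>v (mat_adjoint V *\<^sub>v y) + W *\<^sub>v (mat_adjoint W *\<^sub>v y) = y)"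
proof -
  note V' = isomD(1)[OF V]
  have r: "r \<le> n" by (rule frame_dim_le[OF isom_frame[OF V]])
  obtain W where W: "isom n (n - r) W" "mat_adjoint V * W = 0\<^sub>m r (n - r)"
    using orthonormal_kernel[OF adjoint_carrier[OF V'], of "n - r"] r by auto
  note W' = isomD(1)[OF W(1)]
  have "col W j \<bullet>c col V i = 0" if "i < r" "j < n - r" for i j
    using index_adjoint_mult[OF V' W' that] W(2) that by simp
  then have "isom n (r + (n - r)) (hcat V W)" by (intro isom_hcat[OF V W(1)])
  then have G: "isom n n (hcat V W)" using r by simp
  have GG: "hcat V W * mat_adjoint (hcat V W) = 1\<^sub>m n"
    by (rule mat_mult_left_right_inverse[OF adjoint_carrier[OF isomD(1)[OF G]] isomD(1)[OF G] isomD(2)[OF G]])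
  have "V *\<^sub>v (mat_adjoint V *\<^sub>v y) + W *\<^sub>v (mat_adjoint W *\<^sub>v y) = y" if y: "y \<in> carrier_vec n" for y
  proof -
    have "V *\<^sub>v (mat_adjoint V *\<^sub>v y) + W *\<^sub>v (mat_adjoint W *\<^sub>v y)
        = hcat V W *\<^sub>v (mat_adjoint (hcat V W) *\<^sub>v y)"
      unfolding adjoint_hcat_mult_vec[OF V' W' y]
      by (rule hcat_mult_vec[OF V' W', symmetric])
        (rule mult_mat_vec_carrier[OF adjoint_carrier[OF V'] y], rule mult_mat_vec_carrier[OF adjoint_carrier[OF W'] y])
    also have "\<dots> = (hcat V W * mat_adjoint (hcat V W)) *\<^sub>v y"
      by (rule assoc_mult_mat_vec[OF isomD(1)[OF G] adjoint_carrier[OF isomD(1)[OF G]] y, symmetric])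
    also have "\<dots> = y" unfolding GG by (rule one_mult_mat_vec[OF y])
    finally show ?thesis .
  qed
  then show ?thesis using W by blast
qed

section \<open>The spectral theorem and the Courant-Fischer principle\<close>

lemma eigenvector_exists:
  fixes A :: "complex mat"
  assumes A: "A \<in> carrier_mat n n" and n: "0 < n"
  obtains v e where "v \<in> carrier_vec n" "v \<noteq> 0\<^sub>v n" "A *\<^sub>v v = e \<cdot>\<^sub>v v"
proof -
  have "degree (char_poly A) \<noteq> 0" using degree_monic_char_poly[OF A] n by simp
  then obtain e where "poly (char_poly A) e = 0"
    using fundamental_theorem_of_algebra[of "char_poly A"] constant_degree[of "char_poly A"] by auto
  then have "eigenvalue A e" using eigenvalue_root_char_poly[OF A] by simp
  then show ?thesis using that A by (auto simp: eigenvalue_def eigenvector_def)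
qed

lemma qf_hermitian_real:
  assumes H: "H \<in> carrier_mat n n" "mat_adjoint H = H" and x: "x \<in> carrier_vec n"
  shows "qf H x = of_real (Re (qf H x))"
proof -
  have "cnj (qf H x) = qf H x" using qf_adjoint[OF H(1) x] H(2) by simp
  then show ?thesis by (simp add: complex_eq_iff)
qed

lemma zero_mat_mult_vec:
  fixes x :: "complex vec"
  assumes "x \<in> carrier_vec m"
  shows "0\<^sub>m n m *\<^sub>v x = 0\<^sub>v n"
  using assms by (intro eq_vecI) auto

lemma mult_zero_vec:
  fixes M :: "complex mat"
  assumes "M \<in> carrier_mat n m"
  shows "M *\<^sub>v 0\<^sub>v m = 0\<^sub>v n"
  using assms by (intro eq_vecI) auto

lemma nonzero_index:
  fixes v :: "complex vec"
  assumes "v \<in> carrier_vec n" "v \<noteq> 0\<^sub>v n"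
  shows "\<exists>j<n. v $ j \<noteq> 0"
proof (rule ccontr)
  assume "\<not> ?thesis"
  then have "v = 0\<^sub>v n" using assms(1) by (intro eq_vecI) auto
  then show False using assms(2) by blast
qed

text \<open>Deflation: since \<open>H\<close> is Hermitian, it maps the complement of a unit
  eigenvector \<open>v\<close> to itself, so eigenvectors of the compression \<open>H'\<close> lift
  through \<open>W\<close>. The order of the eigenvalues is left open here and arranged in
  \<open>spectral_theorem\<close>.\<close>

lemma spectral_eigenvectors:
  fixes H :: "complex mat"
  assumes "H \<in> carrier_mat n n" "mat_adjoint H = H"
  shows "\<exists>P d. isom n n P \<and> (\<forall>j<n. H *\<^sub>v col P j = of_real (d j) \<cdot>\<^sub>v col P j)"
  using assms
proof (induction n arbitrary: H)
  case 0
  then show ?case using isom_empty[of 0] by (intro exI[of _ "0\<^sub>m 0 0"]) auto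
next
  case (Suc n)
  note H = Suc.prems
  obtain w e where w: "w \<in> carrier_vec (Suc n)" "w \<noteq> 0\<^sub>v (Suc n)" "H *\<^sub>v w = e \<cdot>\<^sub>v w"
    using eigenvector_exists[OF H(1)] by blast
  define v where "v = complex_of_real (1 / sqrt (sqn w)) \<cdot>\<^sub>v w"
  note v = normalize_vec(2,3)[OF w(1,2), folded v_def]
  have Hv: "H *\<^sub>v v = e \<cdot>\<^sub>v v"
    unfolding v_def using mult_mat_vec[OF H(1) w(1)] w(3) by (simp add: smult_smult_assoc mult.commute)
  have "qf H v = e" unfolding qf_def Hv using v by (simp add: cdot_smult[of _ "Suc n"] cdot_self)
  then have e: "e = of_real (Re e)" using qf_hermitian_real[OF H v(1)] by simp
  have V: "isom (Suc n) 1 (colmat v)" by (rule isom_colmat[OF v])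
  note Vc = isomD(1)[OF V]
  obtain W where W: "isom (Suc n) n W" "mat_adjoint (colmat v) * W = 0\<^sub>m 1 n"
    and dec: "\<And>y. y \<in> carrier_vec (Suc n) \<Longrightarrow>
      colmat v *\<^sub>v (mat_adjoint (colmat v) *\<^sub>v y) + W *\<^sub>v (mat_adjoint W *\<^sub>v y) = y"
    using orthonormal_complement[OF V, unfolded diff_Suc_1] by blast
  note Wc = isomD(1)[OF W(1)]
  have Wv: "(W *\<^sub>v x) \<bullet>c v = 0" if x: "x \<in> carrier_vec n" for x
  proof -
    have "mat_adjoint (colmat v) *\<^sub>v (W *\<^sub>v x) = mat_adjoint (colmat v) * W *\<^sub>v x"
      by (rule assoc_mult_mat_vec[OF adjoint_carrier[OF Vc] Wc x, symmetric])
    also have "\<dots> = 0\<^sub>v 1" unfolding W(2) by (rule zero_mat_mult_vec[OF x])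
    finally have "(mat_adjoint (colmat v) *\<^sub>v (W *\<^sub>v x)) $ 0 = 0" by simp
    moreover have "row (mat_adjoint (colmat v)) 0 = conjugate v"
      using v by (intro eq_vecI) (auto simp: mat_adjoint_index colmat_def)
    ultimately show ?thesis
      using v(1) Wc x Vc by (simp add: comm_scalar_prod[of "W *\<^sub>v x" "Suc n"])
  qed
  define H' where "H' = mat_adjoint W * H * W"
  have H': "H' \<in> carrier_mat n n" unfolding H'_def
    by (rule mult_carrier_mat[OF mult_carrier_mat[OF adjoint_carrier[OF Wc] H(1)] Wc])
  have "mat_adjoint H' = mat_adjoint W * (H * W)"
    unfolding H'_def adjoint_mult[OF mult_carrier_mat[OF adjoint_carrier[OF Wc] H(1)] Wc]
      adjoint_mult[OF adjoint_carrier[OF Wc] H(1)] adjoint_adjoint[OF Wc] H(2) ..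
  also have "\<dots> = H'" unfolding H'_def
    by (rule assoc_mult_mat[OF adjoint_carrier[OF Wc] H(1) Wc, symmetric])
  finally obtain P d where P: "isom n n P" "\<And>j. j < n \<Longrightarrow> H' *\<^sub>v col P j = of_real (d j) \<cdot>\<^sub>v col P j"
    using Suc.IH[OF H'] by blast
  note Pc = isomD(1)[OF P(1)]
  note WP = isom_mult[OF W(1) P(1)]
  have colWP: "col (W * P) j = W *\<^sub>v col P j" if "j < n" for j
    using that by (simp add: col_mult2[OF Wc Pc])
  have "isom (Suc n) (1 + n) (hcat (colmat v) (W * P))"
  proof (rule isom_hcat[OF V WP])
    fix i j :: nat assume ij: "i < 1" "j < n"
    have "(W *\<^sub>v col P j) \<bullet>c v = 0" using Pc ij by (intro Wv) auto
    then show "col (W * P) j \<bullet>c col (colmat v) i = 0" using ij colWP by simp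
  qed
  then have iso: "isom (Suc n) (Suc n) (hcat (colmat v) (W * P))" by simp
  have "H *\<^sub>v (W *\<^sub>v p) = of_real a \<cdot>\<^sub>v (W *\<^sub>v p)"
    if p: "p \<in> carrier_vec n" "H' *\<^sub>v p = of_real a \<cdot>\<^sub>v p" for p a
  proof -
    have Wp: "W *\<^sub>v p \<in> carrier_vec (Suc n)" by (rule mult_mat_vec_carrier[OF Wc p(1)])
    have HWp: "H *\<^sub>v (W *\<^sub>v p) \<in> carrier_vec (Suc n)" by (rule mult_mat_vec_carrier[OF H(1) Wp])
    have "(H *\<^sub>v (W *\<^sub>v p)) \<bullet>c v = (W *\<^sub>v p) \<bullet>c (e \<cdot>\<^sub>v v)"
      using cdot_adjoint[OF H(1) Wp v(1)] H(2) Hv by simp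
    also have "\<dots> = 0" using cdot_smult(2)[OF Wp v(1)] Wv[OF p(1)] by simp
    finally have 1: "(H *\<^sub>v (W *\<^sub>v p)) \<bullet>c v = 0" .
    have "mat_adjoint (colmat v) *\<^sub>v (H *\<^sub>v (W *\<^sub>v p)) = 0\<^sub>v 1"
    proof (rule eq_vecI)
      fix i assume "i < dim_vec (0\<^sub>v 1 :: complex vec)"
      then have i: "i = 0" by simp
      have "row (mat_adjoint (colmat v)) 0 = conjugate v"
        using v by (intro eq_vecI) (auto simp: mat_adjoint_index colmat_def)
      then show "(mat_adjoint (colmat v) *\<^sub>v (H *\<^sub>v (W *\<^sub>v p))) $ i = 0\<^sub>v 1 $ i"
        using 1 comm_scalar_prod[OF HWp carrier_vec_conjugate[OF v(1)]] i v(1)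
        by (simp add: colmat_def)
    qed (use Vc in simp)
    moreover have "mat_adjoint W *\<^sub>v (H *\<^sub>v (W *\<^sub>v p)) = H' *\<^sub>v p"
      unfolding H'_def
      by (simp add: assoc_mult_mat_vec[OF mult_carrier_mat[OF adjoint_carrier[OF Wc] H(1)] Wc p(1)]
        assoc_mult_mat_vec[OF adjoint_carrier[OF Wc] H(1) Wp])
    ultimately have "H *\<^sub>v (W *\<^sub>v p) = colmat v *\<^sub>v 0\<^sub>v 1 + W *\<^sub>v (of_real a \<cdot>\<^sub>v p)"
      using dec[OF HWp] p(2) by simp
    then show ?thesis
      using mult_mat_vec[OF Wc p(1), of "of_real a"] Wp v(1) Wc
      by (simp add: colmat_mult_vec[OF v(1)]) (intro eq_vecI, auto)
  qed
  note ev = this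
  have "H *\<^sub>v col (hcat (colmat v) (W * P)) j
      = of_real (if j = 0 then Re e else d (j - 1)) \<cdot>\<^sub>v col (hcat (colmat v) (W * P)) j" if j: "j < Suc n" for j
  proof (cases "j = 0")
    case True
    then show ?thesis using col_hcat[OF Vc isomD(1)[OF WP], of 0] Hv e[symmetric] by simp
  next
    case False
    have "H *\<^sub>v (W *\<^sub>v col P (j - 1)) = of_real (d (j - 1)) \<cdot>\<^sub>v (W *\<^sub>v col P (j - 1))"
      using Pc j False P(2)[of "j - 1"] by (intro ev) auto
    then show ?thesis
      using False col_hcat[OF Vc isomD(1)[OF WP], of j] j colWP[of "j - 1"] by simp
  qed
  then show ?case
    by (intro exI[of _ "hcat (colmat v) (W * P)"] exI[of _ "\<lambda>j. if j = 0 then Re e else d (j - 1)"])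
      (use iso in blast)
qed

lemma mult_mat_diag_eigenvectors:
  fixes P :: "complex mat"
  assumes P: "P \<in> carrier_mat n n" and H: "H \<in> carrier_mat n n" 
    and ev: "\<forall>j<n. H *\<^sub>v col P j = d j \<cdot>\<^sub>v col P j"
  shows "H * P = P * mat_diag n d"
proof (rule eq_matI)
  fix i j assume "i < dim_row (P * mat_diag n d)" "j < dim_col (P * mat_diag n d)"
  then have ij: "i < n" "j < n" using P carrier_matD[OF mat_diag_dim[of n d]] by auto
  have "(H * P) $$ (i, j) = (H *\<^sub>v col P j) $ i" using H P ij by simp
  also have "\<dots> = d j * P $$ (i, j)" using ev P ij by simp
  also have "\<dots> = (P * mat_diag n d) $$ (i, j)" unfolding mat_diag_mult_right[OF P] using ij by simp
  finally show "(H * P) $$ (i, j) = (P * mat_diag n d) $$ (i, j)" .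
qed (use H P carrier_matD[OF mat_diag_dim[of n d]] in auto)

section \<open>Eigenvalues in decreasing order and their description by subspaces\<close>

definition eigval_list :: "complex mat \<Rightarrow> real list" where
  "eigval_list H = rev (sorted_list_of_multiset (herm_eigvals H))"

lemma eigval_list:
  assumes "H \<in> carrier_mat n n"
  shows "length (eigval_list H) = n" "mset (eigval_list H) = herm_eigvals H"
    "i \<le> j \<Longrightarrow> j < n \<Longrightarrow> eigval_list H ! j \<le> eigval_list H ! i"
proof -
  show m: "mset (eigval_list H) = herm_eigvals H" by (simp add: eigval_list_def)
  show l: "length (eigval_list H) = n"
    using size_herm_eigvals[OF assms] m by (metis size_mset)
  have "sorted (rev (eigval_list H))" by (simp add: eigval_list_def)
  then show "i \<le> j \<Longrightarrow> j < n \<Longrightarrow> eigval_list H ! j \<le> eigval_list H ! i"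
    using l by (metis sorted_rev_iff_nth_mono)
qed

text \<open>Links the definition through roots of the characteristic polynomial with an eigenbasis:
  \<open>H\<close> is similar to the diagonal matrix of the \<open>d j\<close>, and similar matrices
  share their characteristic polynomial.\<close>

lemma herm_eigvals_diagonalized:
  assumes H: "H \<in> carrier_mat n n" and P: "isom n n P" 
    and ev: "\<forall>j<n. H *\<^sub>v col P j = of_real (d j) \<cdot>\<^sub>v col P j"
  shows "herm_eigvals H = mset (map d [0..<n])"
proof -
  let ?D = "mat_diag n (\<lambda>j. complex_of_real (d j))"
  note Pc = isomD(1)[OF P]
  have PP: "P * mat_adjoint P = 1\<^sub>m n"
    by (rule mat_mult_left_right_inverse[OF adjoint_carrier[OF Pc] Pc isomD(2)[OF P]])
  have HP: "H * P = P * ?D" by (rule mult_mat_diag_eigenvectors[OF Pc H ev])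
  have "P * ?D * mat_adjoint P = H * (P * mat_adjoint P)"
    unfolding HP[symmetric] by (rule assoc_mult_mat[OF H Pc adjoint_carrier[OF Pc]])
  also have "\<dots> = H" unfolding PP using H by simp
  finally have "similar_mat_wit H ?D P (mat_adjoint P)"
    unfolding similar_mat_wit_def using H Pc PP isomD(2)[OF P] by (auto simp: Let_def)
  then have "char_poly H = char_poly ?D" by (intro char_poly_similar) (auto simp: similar_mat_def)
  also have "\<dots> = (\<Prod>a\<leftarrow>diag_mat ?D. [:- a, 1:])"
    by (rule char_poly_upper_triangular[of _ n]) (auto simp: mat_diag_def)
  also have "diag_mat ?D = map (\<lambda>j. complex_of_real (d j)) [0..<n]"
    by (auto simp: diag_mat_def mat_diag_def)
  finally have cp: "char_poly H = (\<Prod>a\<leftarrow>map (\<lambda>j. complex_of_real (d j)) [0..<n]. [:- a, 1:])" .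
  have pr: "proots (\<Prod>a\<leftarrow>as. [:- a, 1:]) = mset as" for as :: "complex list"
  proof (induction as)
    case (Cons a as)
    have "(\<Prod>a\<leftarrow>as. [:- a, 1:]) \<noteq> 0" by (auto simp: prod_list_zero_iff)
    then show ?case using Cons proots_mult[of "[:- a, 1:]" "\<Prod>a\<leftarrow>as. [:- a, 1:]"] by simp
  qed simp
  show ?thesis unfolding herm_eigvals_def cp pr by (simp add: image_mset.compositionality comp_def)
qed

text \<open>The eigenvalues belonging to any orthonormal eigenbasis and \<open>eigval_list H\<close>
  agree as multisets, so a permutation of the columns puts the basis in decreasing order.\<close>

lemma spectral_theorem:
  assumes H: "H \<in> carrier_mat n n" "mat_adjoint H = H"
  shows "\<exists>P. isom n n P \<and> (\<forall>j<n. H *\<^sub>v col P j = of_real (eigval_list H ! j) \<cdot>\<^sub>v col P j)"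
proof -
  obtain P d where P: "isom n n P" and ev: "\<forall>j<n. H *\<^sub>v col P j = of_real (d j) \<cdot>\<^sub>v col P j"
    using spectral_eigenvectors[OF H] by blast
  have "mset (eigval_list H) = mset (map d [0..<n])"
    using herm_eigvals_diagonalized[OF H(1) P ev] eigval_list(2)[OF H(1)] by simp
  then obtain p where p: "p permutes {..<n}" "permute_list p (map d [0..<n]) = eigval_list H"
    using mset_eq_permutation[of "eigval_list H" "map d [0..<n]"] by auto
  have pn: "p j < n" if "j < n" for j using permutes_in_image[OF p(1), of j] that by simp
  have d: "eigval_list H ! j = d (p j)" if "j < n" for j
    using p that pn[OF that] by (metis (no_types, lifting) add_0 diff_zero length_map length_upt nth_map nth_upt permute_list_nth)
  define Q where "Q = mat n n (\<lambda>(i, j). P $$ (i, p j))"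
  have colQ: "col Q j = col P (p j)" if "j < n" for j
    using that pn[OF that] isomD(1)[OF P] by (intro eq_vecI) (auto simp: Q_def)
  have "p i = p j \<longleftrightarrow> i = j" for i j using permutes_inj[OF p(1)] by (auto simp: inj_def)
  then have "isom n n Q"
    unfolding isom_iff using colQ pn isomD(3)[OF P] by (auto simp: Q_def)
  moreover have "H *\<^sub>v col Q j = of_real (eigval_list H ! j) \<cdot>\<^sub>v col Q j" if "j < n" for j
    unfolding colQ[OF that] d[OF that] using ev pn[OF that] by blast
  ultimately show ?thesis by blast
qed

lemma mult_vec_diagonalized:
  fixes H P :: "complex mat" and d :: "nat \<Rightarrow> real"
  assumes H: "H \<in> carrier_mat n n" and P: "P \<in> carrier_mat n n"
    and ev: "\<forall>j<n. H *\<^sub>v col P j = of_real (d j) \<cdot>\<^sub>v col P j"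
    and s: "s \<in> carrier_vec n"
  shows "H *\<^sub>v (P *\<^sub>v s) = P *\<^sub>v vec n (\<lambda>i. of_real (d i) * s $ i)"
proof -
  have "H *\<^sub>v (P *\<^sub>v s) = (H * P) *\<^sub>v s" by (rule assoc_mult_mat_vec[OF H P s, symmetric])
  also have "\<dots> = (P * mat_diag n (\<lambda>j. of_real (d j))) *\<^sub>v s"
    unfolding mult_mat_diag_eigenvectors[OF P H ev] ..
  also have "\<dots> = P *\<^sub>v (mat_diag n (\<lambda>j. of_real (d j)) *\<^sub>v s)"
    by (rule assoc_mult_mat_vec[OF P mat_diag_dim s])
  also have "mat_diag n (\<lambda>j. of_real (d j)) *\<^sub>v s = vec n (\<lambda>i. of_real (d i) * s $ i)"
  proof (rule eq_vecI)
    fix i assume "i < dim_vec (vec n (\<lambda>i. of_real (d i) * s $ i))"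
    then have i: "i < n" by simp
    have "(mat_diag n (\<lambda>j. of_real (d j)) *\<^sub>v s) $ i = (\<Sum>j<n. (if i = j then of_real (d j) * s $ j else 0))"
      unfolding mult_mat_vec_sum[OF mat_diag_dim s i] using i
      by (intro sum.cong refl) (simp add: mat_diag_def)
    then show "(mat_diag n (\<lambda>j. of_real (d j)) *\<^sub>v s) $ i = vec n (\<lambda>i. of_real (d i) * s $ i) $ i"
      using i by simp
  qed (simp add: mat_diag_def)
  finally show ?thesis .
qed

lemma qf_diagonalized:
  fixes d :: "nat \<Rightarrow> real"
  assumes H: "H \<in> carrier_mat n n" and P: "isom n n P"
    and ev: "\<forall>j<n. H *\<^sub>v col P j = of_real (d j) \<cdot>\<^sub>v col P j"
    and s: "s \<in> carrier_vec n"
  shows "qf H (P *\<^sub>v s) = of_real (\<Sum>i<n. d i * (cmod (s $ i))\<^sup>2)"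
proof -
  let ?t = "vec n (\<lambda>i. of_real (d i) * s $ i)"
  have "qf H (P *\<^sub>v s) = (P *\<^sub>v ?t) \<bullet>c (P *\<^sub>v s)"
    unfolding qf_def mult_vec_diagonalized[OF H isomD(1)[OF P] ev s] ..
  also have "\<dots> = ?t \<bullet>c s" using s by (intro isom_cdot[OF P]) auto
  also have "\<dots> = of_real (\<Sum>i<n. d i * (cmod (s $ i))\<^sup>2)"
    using s by (simp add: cdot_sum[of _ n] mult.assoc complex_norm_square[symmetric] del: of_real_power)
  finally show ?thesis .
qed

lemma isom_surj:
  assumes P: "isom n n P" and y: "y \<in> carrier_vec n"
  shows "P *\<^sub>v (mat_adjoint P *\<^sub>v y) = y"
proof -
  note Pc = isomD(1)[OF P]
  have PP: "P * mat_adjoint P = 1\<^sub>m n"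
    by (rule mat_mult_left_right_inverse[OF adjoint_carrier[OF Pc] Pc isomD(2)[OF P]])
  have "P *\<^sub>v (mat_adjoint P *\<^sub>v y) = (P * mat_adjoint P) *\<^sub>v y"
    by (rule assoc_mult_mat_vec[OF Pc adjoint_carrier[OF Pc] y, symmetric])
  then show ?thesis unfolding PP using y by simp
qed

lemma first_columns:
  assumes P: "isom n n P" and k: "k \<le> n"
  shows "isom n k (mat n k (\<lambda>(i, j). P $$ (i, j)))"
    "v \<in> carrier_vec k \<Longrightarrow> mat n k (\<lambda>(i, j). P $$ (i, j)) *\<^sub>v v = P *\<^sub>v (v @\<^sub>v 0\<^sub>v (n - k))"
proof -
  let ?U = "mat n k (\<lambda>(i, j). P $$ (i, j))"
  note Pc = isomD(1)[OF P]
  have Uc: "?U \<in> carrier_mat n k" by simp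
  have "col ?U j = col P j" if "j < k" for j
    using that Pc k by (intro eq_vecI) auto
  then show "isom n k ?U" unfolding isom_iff using k isomD(3)[OF P] Uc by auto
  assume v: "v \<in> carrier_vec k"
  have s: "v @\<^sub>v 0\<^sub>v (n - k) \<in> carrier_vec n" using append_carrier_vec[OF v zero_carrier_vec[of "n - k"]] k by simp
  show "?U *\<^sub>v v = P *\<^sub>v (v @\<^sub>v 0\<^sub>v (n - k))"
  proof (rule eq_vecI)
    fix i assume "i < dim_vec (P *\<^sub>v (v @\<^sub>v 0\<^sub>v (n - k)))"
    then have i: "i < n" using Pc by simp
    have "(P *\<^sub>v (v @\<^sub>v 0\<^sub>v (n - k))) $ i = (\<Sum>j<k + (n - k). P $$ (i, j) * (v @\<^sub>v 0\<^sub>v (n - k)) $ j)"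
      unfolding mult_mat_vec_sum[OF Pc s i] using k by simp
    also have "\<dots> = (?U *\<^sub>v v) $ i"
      unfolding sum_add_split mult_mat_vec_sum[OF Uc v i] using v i by simp
    finally show "(?U *\<^sub>v v) $ i = (P *\<^sub>v (v @\<^sub>v 0\<^sub>v (n - k))) $ i" ..
  qed (use Pc in auto)
qed

text \<open>Courant-Fischer, phrased for a lower bound \<open>c\<close>. The first \<open>k\<close>
  eigenvectors span a suitable subspace. Conversely, every \<open>k\<close>-dimensional subspace
  meets the span of the eigenvectors at positions \<open>k - 1\<close> and above; if all their
  eigenvalues were below \<open>c\<close>, the form would be too small there.\<close>

lemma le_kth_eigval_iff:
  assumes H: "H \<in> carrier_mat n n" "mat_adjoint H = H" and k: "1 \<le> k" "k \<le> n"
  shows "c \<le> kth_eigval k H \<longleftrightarrow>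
    (\<exists>U. frame n k U \<and> (\<forall>v\<in>carrier_vec k. c * sqn (U *\<^sub>v v) \<le> Re (qf H (U *\<^sub>v v))))"
proof -
  let ?d = "eigval_list H"
  have kth: "kth_eigval k H = ?d ! (k - 1)" by (simp add: kth_eigval_def eigval_list_def)
  obtain P where P: "isom n n P" 
    and ev: "\<forall>j<n. H *\<^sub>v col P j = of_real (?d ! j) \<cdot>\<^sub>v col P j"
    using spectral_theorem[OF H] by blast
  note Pc = isomD(1)[OF P]
  show ?thesis
  proof
    assume c: "c \<le> kth_eigval k H"
    define U where "U = mat n k (\<lambda>(i, j). P $$ (i, j))"
    note U = first_columns[OF P k(2), folded U_def]
    note Uv = U(2)
    have "c * sqn (U *\<^sub>v v) \<le> Re (qf H (U *\<^sub>v v))" if v: "v \<in> carrier_vec k" for v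
    proof -
      have s: "v @\<^sub>v 0\<^sub>v (n - k) \<in> carrier_vec n" using v k by (metis append_carrier_vec le_add_diff_inverse zero_carrier_vec)
      have "sqn (U *\<^sub>v v) = (\<Sum>i<n. (cmod ((v @\<^sub>v 0\<^sub>v (n - k)) $ i))\<^sup>2)"
        unfolding Uv[OF v] isom_sqn[OF P s] by (rule sqn_sum[OF s])
      moreover have "Re (qf H (U *\<^sub>v v)) = (\<Sum>i<n. ?d ! i * (cmod ((v @\<^sub>v 0\<^sub>v (n - k)) $ i))\<^sup>2)"
        unfolding Uv[OF v] qf_diagonalized[OF H(1) P ev s] by simp
      moreover have le: "c * (cmod ((v @\<^sub>v 0\<^sub>v (n - k)) $ i))\<^sup>2 \<le> ?d ! i * (cmod ((v @\<^sub>v 0\<^sub>v (n - k)) $ i))\<^sup>2"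
        if i: "i < n" for i
      proof (cases "i < k")
        case True
        then have "c \<le> ?d ! i" using c kth eigval_list(3)[OF H(1), of i "k - 1"] k by fastforce
        then show ?thesis by (rule mult_right_mono) simp
      qed (use v k i in simp)
      ultimately show ?thesis
        by (simp only: sum_distrib_left) (rule sum_mono, simp only: lessThan_iff le)
    qed
    then show "\<exists>U. frame n k U \<and> (\<forall>v\<in>carrier_vec k. c * sqn (U *\<^sub>v v) \<le> Re (qf H (U *\<^sub>v v)))"
      using isom_frame[OF U(1)] by blast
  next
    assume "\<exists>U. frame n k U \<and> (\<forall>v\<in>carrier_vec k. c * sqn (U *\<^sub>v v) \<le> Re (qf H (U *\<^sub>v v)))"
    then obtain U where U: "frame n k U" 
      and ge: "\<And>v. v \<in> carrier_vec k \<Longrightarrow> c * sqn (U *\<^sub>v v) \<le> Re (qf H (U *\<^sub>v v))" by blast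
    note Uc = frameD(1)[OF U]
    show "c \<le> kth_eigval k H"
    proof (rule ccontr)
      assume "\<not> c \<le> kth_eigval k H"
      then have less: "?d ! i < c" if "k - 1 \<le> i" "i < n" for i
        using eigval_list(3)[OF H(1) that] kth by simp
      \<comment> \<open>\<open>k - 1\<close> equations in \<open>k\<close> unknowns: some nonzero
        vector of the subspace has vanishing coordinates along the first \<open>k - 1\<close>
        eigenvectors.\<close>
      have "\<exists>v. v \<in> carrier_vec k \<and> v \<noteq> 0\<^sub>v k \<and> (\<forall>i\<in>{..<k - 1}. (mat_adjoint P * U *\<^sub>v v) $ i = 0)"
        by (rule kernel_vector[OF mult_carrier_mat[OF adjoint_carrier[OF Pc] Uc]]) (use k in auto)
      then obtain v where v: "v \<in> carrier_vec k" "v \<noteq> 0\<^sub>v k" 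
        and z: "\<And>i. i < k - 1 \<Longrightarrow> (mat_adjoint P * U *\<^sub>v v) $ i = 0"
        by blast
      have Uv: "U *\<^sub>v v \<in> carrier_vec n" by (rule mult_mat_vec_carrier[OF Uc v(1)])
      define s where "s = mat_adjoint P *\<^sub>v (U *\<^sub>v v)"
      have s: "s \<in> carrier_vec n" unfolding s_def by (rule mult_mat_vec_carrier[OF adjoint_carrier[OF Pc] Uv])
      have Ps: "P *\<^sub>v s = U *\<^sub>v v" unfolding s_def by (rule isom_surj[OF P Uv])
      have sz: "s $ i = 0" if "i < k - 1" for i
        using z[OF that] assoc_mult_mat_vec[OF adjoint_carrier[OF Pc] Uc v(1)] by (simp add: s_def)
      have "U *\<^sub>v v \<noteq> 0\<^sub>v n" using frameD(2)[OF U v(1)] v(2) by blast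
      then have "s \<noteq> 0\<^sub>v n" using Ps mult_zero_vec[OF Pc] by auto
      then obtain j where j: "j < n" "s $ j \<noteq> 0" using nonzero_index[OF s] by blast
      have le: "?d ! i * (cmod (s $ i))\<^sup>2 \<le> c * (cmod (s $ i))\<^sup>2" if "i < n" for i
        using sz[of i] less[of i] that by (cases "i < k - 1") (auto intro: mult_right_mono)
      have "Re (qf H (U *\<^sub>v v)) = (\<Sum>i<n. ?d ! i * (cmod (s $ i))\<^sup>2)"
        using qf_diagonalized[OF H(1) P ev s] by (simp add: Ps)
      also have "\<dots> < (\<Sum>i<n. c * (cmod (s $ i))\<^sup>2)"
      proof (rule sum_strict_mono_ex1)
        have "\<not> j < k - 1" using sz j by blast
        then have "?d ! j * (cmod (s $ j))\<^sup>2 < c * (cmod (s $ j))\<^sup>2"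
          using less[of j] j by (intro mult_strict_right_mono) auto
        then show "\<exists>i\<in>{..<n}. ?d ! i * (cmod (s $ i))\<^sup>2 < c * (cmod (s $ i))\<^sup>2" using j by blast
      qed (use le in auto)
      also have "\<dots> = c * sqn (U *\<^sub>v v)"
        using isom_sqn[OF P s] by (simp add: Ps sqn_sum[OF s] sum_distrib_left)
      finally show False using ge[OF v(1)] by simp
    qed
  qed
qed

text \<open>In a decreasing list the entries that are at least \<open>c\<close> form an initial
  segment; there are at least \<open>k\<close> of them exactly when position \<open>k - 1\<close>
  belongs to it.\<close>

lemma le_kth_eigval_count:
  assumes H: "H \<in> carrier_mat n n" and k: "1 \<le> k" "k \<le> n"
  shows "k \<le> size {#x \<in># herm_eigvals H. c \<le> x#} \<longleftrightarrow> c \<le> kth_eigval k H"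
proof -
  let ?d = "eigval_list H"
  have "size {#x \<in># herm_eigvals H. c \<le> x#} = length (filter ((\<le>) c) ?d)"
    unfolding eigval_list(2)[OF H, symmetric] by (metis mset_filter size_mset)
  also have "\<dots> = card {i. i < n \<and> c \<le> ?d ! i}"
    by (simp add: length_filter_conv_card eigval_list(1)[OF H])
  finally have s: "size {#x \<in># herm_eigvals H. c \<le> x#} = card {i. i < n \<and> c \<le> ?d ! i}" .
  have kth: "kth_eigval k H = ?d ! (k - 1)" by (simp add: kth_eigval_def eigval_list_def)
  show ?thesis
  proof
    assume c: "c \<le> kth_eigval k H"
    have "{..<k} \<subseteq> {i. i < n \<and> c \<le> ?d ! i}"
    proof
      fix i assume i: "i \<in> {..<k}"
      have "?d ! (k - 1) \<le> ?d ! i" using i k by (intro eigval_list(3)[OF H]) auto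
      then show "i \<in> {i. i < n \<and> c \<le> ?d ! i}" using c kth i k by simp
    qed
    from card_mono[OF _ this] show "k \<le> size {#x \<in># herm_eigvals H. c \<le> x#}" using s by simp
  next
    assume a: "k \<le> size {#x \<in># herm_eigvals H. c \<le> x#}"
    show "c \<le> kth_eigval k H"
    proof (rule ccontr)
      assume c: "\<not> c \<le> kth_eigval k H"
      have "{i. i < n \<and> c \<le> ?d ! i} \<subseteq> {..<k - 1}"
      proof
        fix i assume "i \<in> {i. i < n \<and> c \<le> ?d ! i}"
        then have i: "i < n" "c \<le> ?d ! i" by auto
        show "i \<in> {..<k - 1}"
        proof (rule ccontr)
          assume "i \<notin> {..<k - 1}"
          then have "?d ! i \<le> ?d ! (k - 1)" using i by (intro eigval_list(3)[OF H]) auto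
          then show False using c i kth by simp
        qed
      qed
      from card_mono[OF _ this] show False using s a k by simp
    qed
  qed
qed

section \<open>The \<open>k\<close>-th eigenvalue of the rotated Hermitian parts\<close>

lemma qf_sum:
  assumes A: "A \<in> carrier_mat n n" and x: "x \<in> carrier_vec n"
  shows "qf A x = (\<Sum>i<n. \<Sum>j<n. A $$ (i, j) * x $ j * cnj (x $ i))"
  unfolding qf_def cdot_sum[OF mult_mat_vec_carrier[OF A x] x]
  by (intro sum.cong refl) (simp add: mult_mat_vec_sum[OF A x] sum_distrib_right)

text \<open>Some constant is enough, since it only serves to make \<open>lam\<close> continuous. The
  sum of the moduli of all entries works because the product of two coordinates is bounded by the
  squared norm.\<close>

lemma qf_bound:
  assumes A: "A \<in> carrier_mat n n"
  shows "\<exists>C\<ge>0. \<forall>x\<in>carrier_vec n. cmod (qf A x) \<le> C * sqn x"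
proof (intro exI conjI ballI)
  let ?C = "\<Sum>i<n. \<Sum>j<n. cmod (A $$ (i, j))"
  show "0 \<le> ?C" by (intro sum_nonneg) simp
  fix x :: "complex vec" assume x: "x \<in> carrier_vec n"
  have le: "(cmod (x $ i))\<^sup>2 \<le> sqn x" if "i < n" for i
    unfolding sqn_sum[OF x] using that by (intro member_le_sum) auto
  have ij: "cmod (x $ j) * cmod (x $ i) \<le> sqn x" if "i < n" "j < n" for i j
    using le[OF that(1)] le[OF that(2)] sum_squares_bound[of "cmod (x $ j)" "cmod (x $ i)"] by linarith
  have "cmod (qf A x) \<le> (\<Sum>i<n. \<Sum>j<n. cmod (A $$ (i, j) * x $ j * cnj (x $ i)))"
    unfolding qf_sum[OF A x] by (intro order_trans[OF norm_sum] sum_mono norm_sum)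
  also have "\<dots> \<le> (\<Sum>i<n. \<Sum>j<n. cmod (A $$ (i, j)) * sqn x)"
    using ij by (intro sum_mono) (simp add: norm_mult mult.assoc mult_left_mono)
  finally show "cmod (qf A x) \<le> ?C * sqn x" by (simp add: sum_distrib_right)
qed

definition lam :: "nat \<Rightarrow> complex mat \<Rightarrow> real \<Rightarrow> real" where
  "lam k A \<xi> = kth_eigval k (rot \<xi> A)"

lemma le_lam_iff:
  assumes A: "A \<in> carrier_mat n n" and k: "1 \<le> k" "k \<le> n"
  shows "c \<le> lam k A \<xi> \<longleftrightarrow> (\<exists>U. frame n k U \<and>
    (\<forall>v\<in>carrier_vec k. c * sqn (U *\<^sub>v v) \<le> 2 * Re (exp (\<i> * of_real \<xi>) * qf A (U *\<^sub>v v))))"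
proof -
  have "qf (rot \<xi> A) (U *\<^sub>v v) = of_real (2 * Re (exp (\<i> * of_real \<xi>) * qf A (U *\<^sub>v v)))"
    if "frame n k U" "v \<in> carrier_vec k" for U v
    by (rule qf_rot[OF A mult_mat_vec_carrier[OF frameD(1)[OF that(1)] that(2)]])
  then show ?thesis
    unfolding lam_def le_kth_eigval_iff[OF rot_carrier[OF A] rot_hermitian[OF A] k]
    by (simp cong: conj_cong)
qed

text \<open>A subspace that is optimal at \<xi> competes at \<eta>. On it the form changes, relative
  to the squared norm, by at most \<open>2 * C\<close> times the distance of the two unit
  numbers.\<close>

lemma lam_lipschitz:
  assumes A: "A \<in> carrier_mat n n" and k: "1 \<le> k" "k \<le> n"
    and C: "\<forall>x\<in>carrier_vec n. cmod (qf A x) \<le> C * sqn x"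
  shows "lam k A \<xi> - 2 * C * cmod (exp (\<i> * of_real \<xi>) - exp (\<i> * of_real \<eta>)) \<le> lam k A \<eta>"
proof -
  let ?e = "exp (\<i> * of_real \<xi>) - exp (\<i> * of_real \<eta>)"
  obtain U where U: "frame n k U" "\<forall>v\<in>carrier_vec k. lam k A \<xi> * sqn (U *\<^sub>v v)
      \<le> 2 * Re (exp (\<i> * of_real \<xi>) * qf A (U *\<^sub>v v))"
    using le_lam_iff[OF A k, of "lam k A \<xi>" \<xi>] by auto
  have "(lam k A \<xi> - 2 * C * cmod ?e) * sqn (U *\<^sub>v v) \<le> 2 * Re (exp (\<i> * of_real \<eta>) * qf A (U *\<^sub>v v))"
    if v: "v \<in> carrier_vec k" for v
  proof -
    have Uv: "U *\<^sub>v v \<in> carrier_vec n" by (rule mult_mat_vec_carrier[OF frameD(1)[OF U(1)] v])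
    have "Re (?e * qf A (U *\<^sub>v v)) \<le> cmod ?e * cmod (qf A (U *\<^sub>v v))"
      by (metis complex_Re_le_cmod norm_mult)
    also have "\<dots> \<le> cmod ?e * (C * sqn (U *\<^sub>v v))" using C Uv by (intro mult_left_mono) auto
    finally have "Re (exp (\<i> * of_real \<xi>) * qf A (U *\<^sub>v v)) - Re (exp (\<i> * of_real \<eta>) * qf A (U *\<^sub>v v))
        \<le> cmod ?e * C * sqn (U *\<^sub>v v)"
      by (simp add: left_diff_distrib mult.assoc del: times_complex.simps)
    moreover have "lam k A \<xi> * sqn (U *\<^sub>v v) \<le> 2 * Re (exp (\<i> * of_real \<xi>) * qf A (U *\<^sub>v v))" using U(2) v by blast
    ultimately show ?thesis by (simp add: left_diff_distrib algebra_simps del: times_complex.simps)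
  qed
  then show ?thesis using le_lam_iff[OF A k] U(1) by blast
qed

lemma isCont_lam:
  assumes A: "A \<in> carrier_mat n n" and k: "1 \<le> k" "k \<le> n"
  shows "isCont (lam k A) \<xi>"
proof -
  obtain C where C: "C \<ge> 0" "\<forall>x\<in>carrier_vec n. cmod (qf A x) \<le> C * sqn x" using qf_bound[OF A] by blast
  have "norm (lam k A \<eta> - lam k A \<xi>) \<le> 2 * C * cmod (exp (\<i> * of_real \<eta>) - exp (\<i> * of_real \<xi>))" for \<eta>
    using lam_lipschitz[OF A k C(2), of \<xi> \<eta>] lam_lipschitz[OF A k C(2), of \<eta> \<xi>]
    by (simp add: abs_le_iff norm_minus_commute)
  then have b: "norm (lam k A \<eta> - lam k A \<xi>) \<le> norm (exp (\<i> * of_real \<eta>) - exp (\<i> * of_real \<xi>)) * (2 * C)" for \<eta>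
    by (simp only: mult_ac)
  have "((\<lambda>\<eta>. exp (\<i> * of_real \<eta>) - exp (\<i> * of_real \<xi>)) \<longlongrightarrow> exp (\<i> * of_real \<xi>) - exp (\<i> * of_real \<xi>)) (at \<xi>)"
    by (intro tendsto_intros)
  then have e: "((\<lambda>\<eta>. exp (\<i> * of_real \<eta>) - exp (\<i> * of_real \<xi>)) \<longlongrightarrow> 0) (at \<xi>)"
    by (simp only: diff_self)
  have "((\<lambda>\<eta>. lam k A \<eta> - lam k A \<xi>) \<longlongrightarrow> 0) (at \<xi>)"
    by (rule tendsto_0_le[OF e], rule always_eventually, rule allI, rule b)
  then show ?thesis unfolding isCont_def by (rule LIM_zero_cancel)
qed

definition isotropic :: "nat \<Rightarrow> nat \<Rightarrow> complex mat \<Rightarrow> bool" where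
  "isotropic n k A \<longleftrightarrow> (\<exists>S. frame n k S \<and> (\<forall>v\<in>carrier_vec k. qf A (S *\<^sub>v v) = 0))"

text \<open>The eigenvalue condition in terms of subspaces. For \<open>1 \<le> k \<le> n\<close> it
  amounts to \<open>0 \<le> lam k A \<xi>\<close>; unlike \<open>lam\<close> it keeps its meaning
  for \<open>k = 0\<close>, which the induction reaches by splitting off vectors.\<close>

definition nonneg_frame :: "nat \<Rightarrow> nat \<Rightarrow> complex mat \<Rightarrow> real \<Rightarrow> bool" where
  "nonneg_frame n k A \<xi> \<longleftrightarrow> (\<exists>U. frame n k U \<and>
    (\<forall>v\<in>carrier_vec k. 0 \<le> Re (exp (\<i> * of_real \<xi>) * qf A (U *\<^sub>v v))))"

lemma nonneg_frame_iff:
  assumes A: "A \<in> carrier_mat n n" and k: "1 \<le> k" "k \<le> n"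
  shows "nonneg_frame n k A \<xi> \<longleftrightarrow> 0 \<le> lam k A \<xi>"
  unfolding le_lam_iff[OF A k] nonneg_frame_def by simp

lemma nonneg_frame_0: "nonneg_frame n 0 A \<xi>"
proof -
  have "0\<^sub>m n 0 *\<^sub>v v = 0\<^sub>v n" if "v \<in> carrier_vec 0" for v :: "complex vec" by (rule zero_mat_mult_vec[OF that])
  moreover have "qf A (0\<^sub>v n) = 0" by (simp add: qf_def scalar_prod_def)
  ultimately show ?thesis unfolding nonneg_frame_def
    using isom_frame[OF isom_empty[of n]] by (intro exI[of _ "0\<^sub>m n 0"]) auto
qed

lemma isotropic_0: "isotropic n 0 A"
proof -
  have "0\<^sub>m n 0 *\<^sub>v v = 0\<^sub>v n" if "v \<in> carrier_vec 0" for v :: "complex vec" by (rule zero_mat_mult_vec[OF that])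
  moreover have "qf A (0\<^sub>v n) = 0" by (simp add: qf_def scalar_prod_def)
  ultimately show ?thesis unfolding isotropic_def
    using isom_frame[OF isom_empty[of n]] by (intro exI[of _ "0\<^sub>m n 0"]) auto
qed

section \<open>Splitting off an isotropic vector\<close>

lemma adjoint_colmat_mult_vec:
  assumes v: "v \<in> carrier_vec n" and y: "y \<in> carrier_vec n"
  shows "mat_adjoint (colmat v) *\<^sub>v y = vec 1 (\<lambda>_. y \<bullet>c v)"
proof (rule eq_vecI)
  fix i assume "i < dim_vec (vec 1 (\<lambda>_. y \<bullet>c v))"
  then have i: "i = 0" by simp
  have "row (mat_adjoint (colmat v)) 0 = conjugate v"
    using v by (intro eq_vecI) (auto simp: mat_adjoint_index colmat_def)
  then show "(mat_adjoint (colmat v) *\<^sub>v y) $ i = vec 1 (\<lambda>_. y \<bullet>c v) $ i"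
    using comm_scalar_prod[OF y carrier_vec_conjugate[OF v]] i v by (simp add: colmat_def)
qed (simp add: colmat_def)

lemma adjoint_mult_zero_cdot:
  fixes V W :: "complex mat" and w :: "complex vec"
  assumes V: "V \<in> carrier_mat n r" and W: "W \<in> carrier_mat n m" and VW: "mat_adjoint V * W = 0\<^sub>m r m"
    and v: "v \<in> carrier_vec r" and w: "w \<in> carrier_vec m"
  shows "(W *\<^sub>v w) \<bullet>c (V *\<^sub>v v) = 0"
proof -
  have Vv: "V *\<^sub>v v \<in> carrier_vec n" by (rule mult_mat_vec_carrier[OF V v])
  have Ww: "W *\<^sub>v w \<in> carrier_vec n" by (rule mult_mat_vec_carrier[OF W w])
  have "mat_adjoint V *\<^sub>v (W *\<^sub>v w) = mat_adjoint V * W *\<^sub>v w"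
    by (rule assoc_mult_mat_vec[OF adjoint_carrier[OF V] W w, symmetric])
  also have "\<dots> = 0\<^sub>v r" unfolding VW by (rule zero_mat_mult_vec[OF w])
  finally have "(mat_adjoint V *\<^sub>v (W *\<^sub>v w)) \<bullet>c v = 0"
    using v by (simp add: cdot_sum[of _ r])
  then show ?thesis
    using cdot_adjoint[OF adjoint_carrier[OF V] Ww v] unfolding adjoint_adjoint[OF V] by simp
qed

text \<open>The case \<open>p = 0\<close> occurs when \<open>x\<close> lies in the kernels of both \<open>A\<close> and \<open>A\<^sup>*\<close>.\<close>

lemma complement_pair:
  assumes x: "x \<in> carrier_vec n" "sqn x = 1" and p: "p \<in> carrier_vec n" "p \<bullet>c x = 0"
  shows "\<exists>m R. m < n \<and> isom n m R \<and> (\<forall>w\<in>carrier_vec m. (R *\<^sub>v w) \<bullet>c x = 0 \<and> (R *\<^sub>v w) \<bullet>c p = 0) \<and>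
    (\<forall>y\<in>carrier_vec n. y \<bullet>c p = 0 \<longrightarrow> (y \<bullet>c x) \<cdot>\<^sub>v x + R *\<^sub>v (mat_adjoint R *\<^sub>v y) = y)"
proof -
  have X: "isom n 1 (colmat x)" by (rule isom_colmat[OF x])
  note Xc = isomD(1)[OF X]
  have one: "colmat u *\<^sub>v vec 1 (\<lambda>_. c) = c \<cdot>\<^sub>v u" if "u \<in> carrier_vec n" for u c
    by (simp add: colmat_mult_vec[OF that])
  show ?thesis
  proof (cases "p = 0\<^sub>v n")
    case True
    obtain R where R: "isom n (n - 1) R" "mat_adjoint (colmat x) * R = 0\<^sub>m 1 (n - 1)"
      and dec: "\<And>y. y \<in> carrier_vec n \<Longrightarrow>
        colmat x *\<^sub>v (mat_adjoint (colmat x) *\<^sub>v y) + R *\<^sub>v (mat_adjoint R *\<^sub>v y) = y"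
      using orthonormal_complement[OF X] by blast
    have "0 < n" using frame_dim_le[OF isom_frame[OF X]] by simp
    moreover have "(R *\<^sub>v w) \<bullet>c x = 0" if "w \<in> carrier_vec (n - 1)" for w
      using adjoint_mult_zero_cdot[OF Xc isomD(1)[OF R(1)] R(2) _ that, of "vec 1 (\<lambda>_. 1)"] one[OF x(1)] by simp
    moreover have "(R *\<^sub>v w) \<bullet>c p = 0" if "w \<in> carrier_vec (n - 1)" for w
      using mult_mat_vec_carrier[OF isomD(1)[OF R(1)] that] True by (simp add: cdot_sum[of _ n])
    moreover have "(y \<bullet>c x) \<cdot>\<^sub>v x + R *\<^sub>v (mat_adjoint R *\<^sub>v y) = y" if "y \<in> carrier_vec n" for y
      using dec[OF that] unfolding adjoint_colmat_mult_vec[OF x(1) that] one[OF x(1)] .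
    ultimately show ?thesis using R(1) by (intro exI[of _ "n - 1"] exI[of _ R]) auto
  next
    case False
    define u where "u = complex_of_real (1 / sqrt (sqn p)) \<cdot>\<^sub>v p"
    note u = normalize_vec[OF p(1) False, folded u_def]
    have ux: "u \<bullet>c x = 0" unfolding u_def cdot_smult(1)[OF p(1) x(1)] p(2) by simp
    have Un: "isom n 1 (colmat u)" by (rule isom_colmat[OF u(2,3)])
    note Uc = isomD(1)[OF Un]
    have V: "isom n (1 + 1) (hcat (colmat x) (colmat u))"
      by (rule isom_hcat[OF X Un]) (use ux in simp)
    note Vc = isomD(1)[OF V]
    obtain R where R: "isom n (n - (1 + 1)) R" 
        "mat_adjoint (hcat (colmat x) (colmat u)) * R = 0\<^sub>m (1 + 1) (n - (1 + 1))"
      and dec: "\<And>y. y \<in> carrier_vec n \<Longrightarrow>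
        hcat (colmat x) (colmat u) *\<^sub>v (mat_adjoint (hcat (colmat x) (colmat u)) *\<^sub>v y)
          + R *\<^sub>v (mat_adjoint R *\<^sub>v y) = y"
      using orthonormal_complement[OF V] by blast
    have "1 + 1 \<le> n" using frame_dim_le[OF isom_frame[OF V]] .
    have h: "hcat (colmat x) (colmat u) *\<^sub>v (vec 1 (\<lambda>_. a) @\<^sub>v vec 1 (\<lambda>_. b)) = a \<cdot>\<^sub>v x + b \<cdot>\<^sub>v u" for a b
      by (subst hcat_mult_vec[OF Xc Uc]) (simp_all only: one[OF x(1)] one[OF u(2)] vec_carrier)
    have Rab: "(R *\<^sub>v w) \<bullet>c (a \<cdot>\<^sub>v x + b \<cdot>\<^sub>v u) = 0" if "w \<in> carrier_vec (n - (1 + 1))" for w a b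
      using adjoint_mult_zero_cdot[OF Vc isomD(1)[OF R(1)] R(2) _ that, of "vec 1 (\<lambda>_. a) @\<^sub>v vec 1 (\<lambda>_. b)"]
      unfolding h by (metis append_carrier_vec vec_carrier)
    have x1: "1 \<cdot>\<^sub>v x + 0 \<cdot>\<^sub>v u = x" using x(1) u(2) by (intro eq_vecI) auto
    have "0 \<cdot>\<^sub>v x + complex_of_real (sqrt (sqn p)) \<cdot>\<^sub>v u = p"
      using x(1) p(1) u(1) by (intro eq_vecI) (auto simp: u_def)
    moreover have "(R *\<^sub>v w) \<bullet>c x = 0" if "w \<in> carrier_vec (n - (1 + 1))" for w
      using Rab[OF that, of 1 0] unfolding x1 .
    ultimately have "(R *\<^sub>v w) \<bullet>c x = 0 \<and> (R *\<^sub>v w) \<bullet>c p = 0" if "w \<in> carrier_vec (n - (1 + 1))" for w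
      using Rab[OF that, of 0 "complex_of_real (sqrt (sqn p))"] that by metis
    moreover have "(y \<bullet>c x) \<cdot>\<^sub>v x + R *\<^sub>v (mat_adjoint R *\<^sub>v y) = y" if y: "y \<in> carrier_vec n" "y \<bullet>c p = 0" for y
    proof -
      have "y \<bullet>c u = 0" unfolding u_def cdot_smult(2)[OF y(1) p(1)] y(2) by simp
      moreover have "(y \<bullet>c x) \<cdot>\<^sub>v x + 0 \<cdot>\<^sub>v u = (y \<bullet>c x) \<cdot>\<^sub>v x" using x(1) u(2) by (intro eq_vecI) auto
      ultimately show ?thesis using dec[OF y(1)]
        unfolding adjoint_hcat_mult_vec[OF Xc Uc y(1)] adjoint_colmat_mult_vec[OF x(1) y(1)]
          adjoint_colmat_mult_vec[OF u(2) y(1)] h by simp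
    qed
    moreover have "n - (1 + 1) < n" using \<open>1 + 1 \<le> n\<close> by simp
    ultimately show ?thesis using R(1) by blast
  qed
qed

text \<open>As \<open>p\<close> is orthogonal to \<open>x\<close>, the form vanishes at
  \<open>x\<close>, and the cross terms see \<open>z\<close> only through its product with
  \<open>p\<close>. In particular a multiple of \<open>x\<close> can be added to any
  \<open>z\<close> orthogonal to \<open>p\<close> without changing the form; this is what makes
  splitting off possible.\<close>

lemma qf_add_radical:
  assumes A: "A \<in> carrier_mat n n" and x: "x \<in> carrier_vec n" and p: "p \<in> carrier_vec n"
    and px: "p \<bullet>c x = 0" and Ax: "A *\<^sub>v x = \<alpha> \<cdot>\<^sub>v p" and Ax': "mat_adjoint A *\<^sub>v x = \<beta> \<cdot>\<^sub>v p"
    and z: "z \<in> carrier_vec n"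
  shows "qf A (a \<cdot>\<^sub>v x + z) = qf A z + a * \<alpha> * cnj (z \<bullet>c p) + cnj a * cnj \<beta> * (z \<bullet>c p)"
proof -
  have ax: "a \<cdot>\<^sub>v x \<in> carrier_vec n" using x by simp
  have Az: "A *\<^sub>v z \<in> carrier_vec n" by (rule mult_mat_vec_carrier[OF A z])
  have "qf A x = 0" unfolding qf_def Ax cdot_smult(1)[OF p x] px by simp
  then have "qf A (a \<cdot>\<^sub>v x) = 0" unfolding qf_smult[OF A x] by simp
  moreover have "(A *\<^sub>v (a \<cdot>\<^sub>v x)) \<bullet>c z = a * \<alpha> * cnj (z \<bullet>c p)"
    unfolding mult_mat_vec[OF A x] Ax smult_smult_assoc cdot_smult(1)[OF p z] cdot_commute[OF z p] ..
  moreover have "(A *\<^sub>v z) \<bullet>c (a \<cdot>\<^sub>v x) = cnj a * cnj \<beta> * (z \<bullet>c p)"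
    unfolding cdot_smult(2)[OF Az x] cdot_adjoint[OF A z x] Ax' cdot_smult(2)[OF z p]
    by (simp only: mult.assoc)
  ultimately show ?thesis using qf_add[OF A ax z] by simp
qed

text \<open>A vector on which a form vanishes lies in the radical of that form on any subspace
  where the form is nonnegative.\<close>

lemma nonneg_radical:
  assumes A: "A \<in> carrier_mat n n" and x: "x \<in> carrier_vec n" and p: "p \<in> carrier_vec n"
    and px: "p \<bullet>c x = 0" and Ax: "A *\<^sub>v x = \<alpha> \<cdot>\<^sub>v p" and Ax': "mat_adjoint A *\<^sub>v x = \<beta> \<cdot>\<^sub>v p"
    and y: "y \<in> carrier_vec n"
    and c: "exp (\<i> * of_real \<xi>) * \<alpha> + exp (- \<i> * of_real \<xi>) * \<beta> \<noteq> 0"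
    and nn: "\<And>z. 0 \<le> Re (exp (\<i> * of_real \<xi>) * qf A (1 \<cdot>\<^sub>v x + z \<cdot>\<^sub>v y))"
  shows "y \<bullet>c p = 0"
proof (rule ccontr)
  define q where "q = y \<bullet>c p"
  define e where "e = exp (\<i> * of_real \<xi>)"
  define c where "c = e * \<alpha> + cnj e * \<beta>"
  define h where "h = Re (e * qf A y)"
  assume "y \<bullet>c p \<noteq> 0"
  then have q: "q \<noteq> 0" by (simp add: q_def)
  have c0: "c \<noteq> 0" using c unfolding c_def e_def cnj_exp_i .
  define K where "K = (cmod (c * cnj q))\<^sup>2"
  have K: "K > 0" using q c0 by (simp add: K_def)
  define t where "t = 1 / (2 * (\<bar>h\<bar> + 1))"
  have t: "t > 0" "t * h < 1"
  proof -
    show "t > 0" by (simp add: t_def add_nonneg_pos)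
    have "2 * t * (\<bar>h\<bar> + 1) = 1" by (simp add: t_def)
    then have "2 * (t * \<bar>h\<bar>) + 2 * t = 1" by (simp add: algebra_simps)
    moreover have "t * h \<le> t * \<bar>h\<bar>" using \<open>t > 0\<close> by (intro mult_left_mono) auto
    ultimately show "t * h < 1" using \<open>t > 0\<close> by linarith
  qed
  \<comment> \<open>The phase of \<open>z\<close> turns the cross term into \<open>- t * K\<close>,
    while the quadratic term is \<open>t\<^sup>2 * K * h\<close>. Since \<open>t * h < 1\<close>,
    the linear term wins and the form becomes negative.\<close>
  define z where "z = - (of_real t * (c * cnj q))"
  have zy: "z \<cdot>\<^sub>v y \<in> carrier_vec n" using y by simp
  have "e * qf A (1 \<cdot>\<^sub>v x + z \<cdot>\<^sub>v y)
      = of_real ((cmod z)\<^sup>2) * (e * qf A y) + (e * \<alpha> * cnj (z * q) + e * cnj \<beta> * (z * q))"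
    unfolding qf_add_radical[OF A x p px Ax Ax' zy] qf_smult[OF A y] cdot_smult(1)[OF y p] q_def[symmetric]
    by (simp add: algebra_simps)
  moreover have "Re (e * cnj \<beta> * (z * q)) = Re (cnj e * \<beta> * cnj (z * q))"
    by (metis complex_cnj_cnj complex_cnj_mult complex_cnj(1) complex.sel(1) cnj.sel(1))
  moreover have "Re (of_real k * w) = k * Re w" for k w by simp
  ultimately have "Re (e * qf A (1 \<cdot>\<^sub>v x + z \<cdot>\<^sub>v y)) = (cmod z)\<^sup>2 * h + Re (c * cnj (z * q))"
    by (simp add: h_def c_def distrib_right del: times_complex.sel complex_cnj_mult of_real_power)
  also have "c * cnj (z * q) = - of_real (t * K)"
    unfolding z_def K_def complex_norm_square of_real_mult by simp
  also have "(cmod z)\<^sup>2 = t\<^sup>2 * K"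
    unfolding z_def K_def using t(1) by (simp add: norm_mult power_mult_distrib)
  finally have "Re (e * qf A (1 \<cdot>\<^sub>v x + z \<cdot>\<^sub>v y)) = t * K * (t * h - 1)"
    by (simp add: power2_eq_square algebra_simps)
  moreover have "t * K * (t * h - 1) < 0" using t K by (intro mult_pos_neg) auto
  ultimately show False using nn[of z] by (simp add: e_def)
qed

text \<open>The subspace is cut down by one linear condition, the row \<open>B\<close>, to a part
  that is orthogonal to \<open>p\<close> and meets the line of \<open>x\<close> only in 0. On this
  part the projection along \<open>x\<close> onto the range of \<open>R\<close> is injective, and by
  \<open>qf_add_radical\<close> it preserves the form.\<close>

lemma nonneg_frame_reduce:
  assumes A: "A \<in> carrier_mat n n" and x: "x \<in> carrier_vec n" "x \<noteq> 0\<^sub>v n" and p: "p \<in> carrier_vec n"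
    and px: "p \<bullet>c x = 0" and Ax: "A *\<^sub>v x = \<alpha> \<cdot>\<^sub>v p" and Ax': "mat_adjoint A *\<^sub>v x = \<beta> \<cdot>\<^sub>v p"
    and c: "p = 0\<^sub>v n \<or> exp (\<i> * of_real \<xi>) * \<alpha> + exp (- \<i> * of_real \<xi>) * \<beta> \<noteq> 0"
    and R: "isom n m R" "\<And>w. w \<in> carrier_vec m \<Longrightarrow> (R *\<^sub>v w) \<bullet>c p = 0"
    and dec: "\<And>y. y \<in> carrier_vec n \<Longrightarrow> y \<bullet>c p = 0 \<Longrightarrow> 
      (y \<bullet>c x) \<cdot>\<^sub>v x + R *\<^sub>v (mat_adjoint R *\<^sub>v y) = y"
    and nn: "nonneg_frame n (Suc k) A \<xi>"
  shows "nonneg_frame m k (mat_adjoint R * A * R) \<xi>"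
proof -
  note Rc = isomD(1)[OF R(1)]
  obtain U where U: "frame n (Suc k) U"
    and pos: "\<And>v. v \<in> carrier_vec (Suc k) \<Longrightarrow> 0 \<le> Re (exp (\<i> * of_real \<xi>) * qf A (U *\<^sub>v v))"
    using nn unfolding nonneg_frame_def by blast
  note Uc = frameD(1)[OF U]
  have Uw: "U *\<^sub>v w \<in> carrier_vec n" if "w \<in> carrier_vec (Suc k)" for w
    by (rule mult_mat_vec_carrier[OF Uc that])
  have "\<exists>B. B \<in> carrier_mat 1 (Suc k) \<and> (\<forall>w\<in>carrier_vec (Suc k). B *\<^sub>v w = 0\<^sub>v 1 \<longrightarrow>
      (U *\<^sub>v w) \<bullet>c p = 0 \<and> (\<forall>a. U *\<^sub>v w = a \<cdot>\<^sub>v x \<longrightarrow> w = 0\<^sub>v (Suc k)))"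
  proof (cases "\<exists>v\<in>carrier_vec (Suc k). U *\<^sub>v v = x")
    case True
    then obtain v where v: "v \<in> carrier_vec (Suc k)" "U *\<^sub>v v = x" by blast
    \<comment> \<open>The whole subspace is orthogonal to \<open>p\<close> here, so the row remains
      free to demand orthogonality to \<open>v\<close>, the coordinate vector of
      \<open>x\<close>.\<close>
    have up: "(U *\<^sub>v w) \<bullet>c p = 0" if w: "w \<in> carrier_vec (Suc k)" for w
    proof (cases "p = 0\<^sub>v n")
      case True
      then show ?thesis using Uw[OF w] by (simp add: cdot_sum[of _ n])
    next
      case False
      then have c': "exp (\<i> * of_real \<xi>) * \<alpha> + exp (- \<i> * of_real \<xi>) * \<beta> \<noteq> 0" using c by blast
      show ?thesis
      proof (rule nonneg_radical[OF A x(1) p px Ax Ax' Uw[OF w] c'])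
        fix z
        have zw: "z \<cdot>\<^sub>v w \<in> carrier_vec (Suc k)" using w by simp
        have "U *\<^sub>v (v + z \<cdot>\<^sub>v w) = 1 \<cdot>\<^sub>v x + z \<cdot>\<^sub>v (U *\<^sub>v w)"
          unfolding mult_add_distrib_mat_vec[OF Uc v(1) zw] mult_mat_vec[OF Uc w] v(2) one_smult_vec ..
        moreover have "v + z \<cdot>\<^sub>v w \<in> carrier_vec (Suc k)" using v(1) zw by simp
        ultimately show "0 \<le> Re (exp (\<i> * of_real \<xi>) * qf A (1 \<cdot>\<^sub>v x + z \<cdot>\<^sub>v (U *\<^sub>v w)))"
          using pos[of "v + z \<cdot>\<^sub>v w"] by simp
      qed
    qed
    have w0: "w = 0\<^sub>v (Suc k)"
      if w: "w \<in> carrier_vec (Suc k)" "mat_adjoint (colmat v) *\<^sub>v w = 0\<^sub>v 1" "U *\<^sub>v w = a \<cdot>\<^sub>v x" for w a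
    proof -
      have "w \<bullet>c v = (mat_adjoint (colmat v) *\<^sub>v w) $ 0"
        unfolding adjoint_colmat_mult_vec[OF v(1) w(1)] by simp
      then have wv: "w \<bullet>c v = 0" unfolding w(2) by simp
      have av: "(- a) \<cdot>\<^sub>v v \<in> carrier_vec (Suc k)" using v(1) by simp
      have "U *\<^sub>v (w + (- a) \<cdot>\<^sub>v v) = 0\<^sub>v n"
        unfolding mult_add_distrib_mat_vec[OF Uc w(1) av] mult_mat_vec[OF Uc v(1)] v(2) w(3)
        using x(1) by (intro eq_vecI) auto
      then have 0: "w + (- a) \<cdot>\<^sub>v v = 0\<^sub>v (Suc k)" using w(1) av by (intro frameD(2)[OF U]) auto
      have "(w + (- a) \<cdot>\<^sub>v v) \<bullet>c w = w \<bullet>c w"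
        unfolding cdot_add(1)[OF w(1) av w(1)] cdot_smult(1)[OF v(1) w(1)] cdot_commute[OF w(1) v(1)] wv by simp
      then have "sqn w = 0" unfolding 0 sqn_def using w(1) by (simp add: cdot_sum[of _ "Suc k"])
      then show ?thesis using sqn_eq_0[OF w(1)] by blast
    qed
    show ?thesis
      by (intro exI[of _ "mat_adjoint (colmat v)"] conjI ballI impI allI up w0)
        (use v(1) in \<open>auto intro: adjoint_carrier\<close>)
  next
    case False
    \<comment> \<open>The subspace contains no nonzero multiple of \<open>x\<close>, so the row can
      be spent on orthogonality to \<open>p\<close>.\<close>
    have Bc: "mat_adjoint (colmat p) * U \<in> carrier_mat 1 (Suc k)"
      by (rule mult_carrier_mat[OF adjoint_carrier[OF _] Uc]) (use p in simp)
    have cp: "colmat p \<in> carrier_mat n 1" using p by simp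
    have up: "(U *\<^sub>v w) \<bullet>c p = 0"
      if w: "w \<in> carrier_vec (Suc k)" "mat_adjoint (colmat p) * U *\<^sub>v w = 0\<^sub>v 1" for w
    proof -
      have "(U *\<^sub>v w) \<bullet>c p = (mat_adjoint (colmat p) *\<^sub>v (U *\<^sub>v w)) $ 0"
        unfolding adjoint_colmat_mult_vec[OF p Uw[OF w(1)]] by simp
      also have "\<dots> = 0" 
        unfolding assoc_mult_mat_vec[OF adjoint_carrier[OF cp] Uc w(1), symmetric] w(2) by simp
      finally show ?thesis .
    qed
    have w0: "w = 0\<^sub>v (Suc k)" if w: "w \<in> carrier_vec (Suc k)" "U *\<^sub>v w = a \<cdot>\<^sub>v x" for w a
    proof (cases "a = 0")
      case True
      have "U *\<^sub>v w = 0\<^sub>v n" unfolding w(2) True using x(1) by (intro eq_vecI) auto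
      then show ?thesis by (rule frameD(2)[OF U w(1)])
    next
      case a: False
      have "U *\<^sub>v ((1 / a) \<cdot>\<^sub>v w) = x"
        unfolding mult_mat_vec[OF Uc w(1)] w(2) smult_smult_assoc using a by simp
      then show ?thesis using False w(1) by (metis smult_carrier_vec)
    qed
    show ?thesis
      by (intro exI[of _ "mat_adjoint (colmat p) * U"] conjI ballI impI allI Bc up w0)
  qed
  then obtain B where B: "B \<in> carrier_mat 1 (Suc k)"
    and Bp: "\<And>w. w \<in> carrier_vec (Suc k) \<Longrightarrow> B *\<^sub>v w = 0\<^sub>v 1 \<Longrightarrow> (U *\<^sub>v w) \<bullet>c p = 0"
    and Bx: "\<And>w a. w \<in> carrier_vec (Suc k) \<Longrightarrow> B *\<^sub>v w = 0\<^sub>v 1 \<Longrightarrow> U *\<^sub>v w = a \<cdot>\<^sub>v x \<Longrightarrow> w = 0\<^sub>v (Suc k)"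
    by blast
  have "k + 1 \<le> Suc k" by simp
  then obtain Q where Q: "isom (Suc k) k Q" "B * Q = 0\<^sub>m 1 k" using orthonormal_kernel[OF B] by blast
  note Qc = isomD(1)[OF Q(1)]
  \<comment> \<open>\<open>U' w\<close> consists of the coordinates with respect to \<open>R\<close>
    of \<open>U (Q w)\<close>, whose remaining part is a multiple of \<open>x\<close>.\<close>
  define U' where "U' = mat_adjoint R * (U * Q)"
  have UQ: "U * Q \<in> carrier_mat n k" by (rule mult_carrier_mat[OF Uc Qc])
  have U'c: "U' \<in> carrier_mat m k" unfolding U'_def by (rule mult_carrier_mat[OF adjoint_carrier[OF Rc] UQ])
  have Qw: "Q *\<^sub>v w \<in> carrier_vec (Suc k)" if "w \<in> carrier_vec k" for w
    by (rule mult_mat_vec_carrier[OF Qc that])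
  have BQ: "B *\<^sub>v (Q *\<^sub>v w) = 0\<^sub>v 1" if "w \<in> carrier_vec k" for w
    unfolding assoc_mult_mat_vec[OF B Qc that, symmetric] Q(2) by (rule zero_mat_mult_vec[OF that])
  have U'w: "U' *\<^sub>v w = mat_adjoint R *\<^sub>v (U *\<^sub>v (Q *\<^sub>v w))" if "w \<in> carrier_vec k" for w
    unfolding U'_def assoc_mult_mat_vec[OF adjoint_carrier[OF Rc] UQ that] assoc_mult_mat_vec[OF Uc Qc that] ..
  have y: "U *\<^sub>v (Q *\<^sub>v w) = ((U *\<^sub>v (Q *\<^sub>v w)) \<bullet>c x) \<cdot>\<^sub>v x + R *\<^sub>v (U' *\<^sub>v w)"
    if "w \<in> carrier_vec k" for w
    unfolding U'w[OF that] by (rule dec[OF Uw[OF Qw[OF that]] Bp[OF Qw[OF that] BQ[OF that]], symmetric])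
  have "frame m k U'"
    unfolding frame_def
  proof (intro conjI ballI impI)
    fix w :: "complex vec" assume w: "w \<in> carrier_vec k" "U' *\<^sub>v w = 0\<^sub>v m"
    have "U *\<^sub>v (Q *\<^sub>v w) = ((U *\<^sub>v (Q *\<^sub>v w)) \<bullet>c x) \<cdot>\<^sub>v x"
      using y[OF w(1)] unfolding w(2) mult_zero_vec[OF Rc] using x(1) by (metis right_zero_vec smult_carrier_vec)
    then have "Q *\<^sub>v w = 0\<^sub>v (Suc k)" by (rule Bx[OF Qw[OF w(1)] BQ[OF w(1)]])
    then show "w = 0\<^sub>v k" by (rule frameD(2)[OF isom_frame[OF Q(1)] w(1)])
  qed (rule U'c)
  moreover have "0 \<le> Re (exp (\<i> * of_real \<xi>) * qf (mat_adjoint R * A * R) (U' *\<^sub>v w))"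
    if w: "w \<in> carrier_vec k" for w
  proof -
    have U'wc: "U' *\<^sub>v w \<in> carrier_vec m" by (rule mult_mat_vec_carrier[OF U'c w])
    have Rz: "R *\<^sub>v (U' *\<^sub>v w) \<in> carrier_vec n" by (rule mult_mat_vec_carrier[OF Rc U'wc])
    have "qf A (U *\<^sub>v (Q *\<^sub>v w)) = qf A (R *\<^sub>v (U' *\<^sub>v w))"
      by (subst y[OF w], subst qf_add_radical[OF A x(1) p px Ax Ax' Rz]) (simp add: R(2)[OF U'wc])
    then show ?thesis
      unfolding qf_congruence[OF A Rc U'wc] using pos[OF Qw[OF w]] by simp
  qed
  ultimately show ?thesis unfolding nonneg_frame_def by blast
qed

text \<open>\<open>x\<close> is adjoined as an additional first column. It is orthogonal to the
  range of \<open>R\<close>, which keeps the columns independent, and the lifted vectors are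
  orthogonal to \<open>p\<close>, so multiples of \<open>x\<close> do not affect the form.\<close>

lemma isotropic_lift:
  assumes A: "A \<in> carrier_mat n n" and x: "x \<in> carrier_vec n" "sqn x = 1" and p: "p \<in> carrier_vec n"
    and px: "p \<bullet>c x = 0" and Ax: "A *\<^sub>v x = \<alpha> \<cdot>\<^sub>v p" and Ax': "mat_adjoint A *\<^sub>v x = \<beta> \<cdot>\<^sub>v p"
    and R: "isom n m R" "\<And>w. w \<in> carrier_vec m \<Longrightarrow> (R *\<^sub>v w) \<bullet>c p = 0" "\<And>w. w \<in> carrier_vec m \<Longrightarrow> (R *\<^sub>v w) \<bullet>c x = 0"
    and iso: "isotropic m k (mat_adjoint R * A * R)"
  shows "isotropic n (Suc k) A"
proof -
  note Rc = isomD(1)[OF R(1)]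
  obtain S where S: "frame m k S"
    and S0: "\<And>v. v \<in> carrier_vec k \<Longrightarrow> qf (mat_adjoint R * A * R) (S *\<^sub>v v) = 0"
    using iso unfolding isotropic_def by blast
  note Sc = frameD(1)[OF S]
  note RS = frame_mult[OF isom_frame[OF R(1)] S]
  note RSc = frameD(1)[OF RS]
  have xc: "colmat x \<in> carrier_mat n 1" using x(1) by simp
  define T where "T = hcat (colmat x) (R * S)"
  have Tc: "T \<in> carrier_mat n (1 + k)" unfolding T_def by (rule hcat_carrier[OF xc RSc])
  have T: "\<exists>a w. w \<in> carrier_vec k \<and> v = vec 1 (\<lambda>_. a) @\<^sub>v w \<and> T *\<^sub>v v = a \<cdot>\<^sub>v x + R *\<^sub>v (S *\<^sub>v w)"
    if v: "v \<in> carrier_vec (1 + k)" for v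
  proof (intro exI conjI)
    have f: "vec_first v 1 = vec 1 (\<lambda>_. v $ 0)" unfolding vec_first_def by (intro eq_vecI) auto
    show w: "vec_last v k \<in> carrier_vec k" by simp
    show e: "v = vec 1 (\<lambda>_. v $ 0) @\<^sub>v vec_last v k"
      using vec_first_last_append[OF v] unfolding f by (rule sym)
    have "T *\<^sub>v (vec 1 (\<lambda>_. v $ 0) @\<^sub>v vec_last v k) = (v $ 0) \<cdot>\<^sub>v x + R *\<^sub>v (S *\<^sub>v vec_last v k)"
      unfolding T_def hcat_mult_vec[OF xc RSc vec_carrier w] colmat_mult_vec[OF x(1) vec_carrier]
        assoc_mult_mat_vec[OF Rc Sc w] by simp
    then show "T *\<^sub>v v = (v $ 0) \<cdot>\<^sub>v x + R *\<^sub>v (S *\<^sub>v vec_last v k)" using e by metis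
  qed
  have "frame n (1 + k) T" unfolding frame_def
  proof (intro conjI ballI impI)
    fix v assume v: "v \<in> carrier_vec (1 + k)" "T *\<^sub>v v = 0\<^sub>v n"
    obtain a w where w: "w \<in> carrier_vec k" "v = vec 1 (\<lambda>_. a) @\<^sub>v w" "T *\<^sub>v v = a \<cdot>\<^sub>v x + R *\<^sub>v (S *\<^sub>v w)"
      using T[OF v(1)] by blast
    have Sw: "S *\<^sub>v w \<in> carrier_vec m" by (rule mult_mat_vec_carrier[OF Sc w(1)])
    have Rz: "R *\<^sub>v (S *\<^sub>v w) \<in> carrier_vec n" by (rule mult_mat_vec_carrier[OF Rc Sw])
    have ax: "a \<cdot>\<^sub>v x \<in> carrier_vec n" using x(1) by simp
    have eq0: "a \<cdot>\<^sub>v x + R *\<^sub>v (S *\<^sub>v w) = 0\<^sub>v n" using v(2) w(3) by simp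
    have "(a \<cdot>\<^sub>v x + R *\<^sub>v (S *\<^sub>v w)) \<bullet>c x = a"
      unfolding cdot_add(1)[OF ax Rz x(1)] cdot_smult(1)[OF x(1) x(1)] R(3)[OF Sw] cdot_self x(2) by simp
    then have a: "a = 0" unfolding eq0 using x(1) by (simp add: cdot_sum[of _ n])
    have "R *\<^sub>v (S *\<^sub>v w) = a \<cdot>\<^sub>v x + R *\<^sub>v (S *\<^sub>v w)" unfolding a using x(1) Rc by (intro eq_vecI) auto
    then have "R * S *\<^sub>v w = 0\<^sub>v n" using eq0 assoc_mult_mat_vec[OF Rc Sc w(1)] by simp
    then have "w = 0\<^sub>v k" by (rule frameD(2)[OF RS w(1)])
    then show "v = 0\<^sub>v (1 + k)" unfolding w(2) a by (intro eq_vecI) auto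
  qed (rule Tc)
  moreover have "qf A (T *\<^sub>v v) = 0" if v: "v \<in> carrier_vec (1 + k)" for v
  proof -
    obtain a w where w: "w \<in> carrier_vec k" "T *\<^sub>v v = a \<cdot>\<^sub>v x + R *\<^sub>v (S *\<^sub>v w)"
      using T[OF v] by blast
    have Sw: "S *\<^sub>v w \<in> carrier_vec m" by (rule mult_mat_vec_carrier[OF Sc w(1)])
    have Rz: "R *\<^sub>v (S *\<^sub>v w) \<in> carrier_vec n" by (rule mult_mat_vec_carrier[OF Rc Sw])
    have "qf A (R *\<^sub>v (S *\<^sub>v w)) = 0" using S0[OF w(1)] unfolding qf_congruence[OF A Rc Sw] .
    then show ?thesis unfolding w(2) qf_add_radical[OF A x(1) p px Ax Ax' Rz] R(2)[OF Sw] by simp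
  qed
  ultimately show ?thesis unfolding isotropic_def by auto
qed

text \<open>Shared by the two cases that produce a vector \<open>x\<close>; \<open>IH\<close> stands
  for the hypothesis of the final induction on \<open>n\<close>. Every angle only has to be a limit
  of angles at which \<open>nonneg_frame_reduce\<close> applies, because continuity of
  \<open>lam\<close> carries nonnegativity of the compression over to the limit.\<close>

lemma isotropic_reduction:
  assumes IH: "\<And>m k B. m < n \<Longrightarrow> B \<in> carrier_mat m m \<Longrightarrow> (\<forall>\<xi>. nonneg_frame m k B \<xi>) \<Longrightarrow> isotropic m k B"
    and A: "A \<in> carrier_mat n n" and nn: "\<forall>\<xi>. nonneg_frame n (Suc k) A \<xi>"
    and x: "x \<in> carrier_vec n" "x \<noteq> 0\<^sub>v n" and p: "p \<in> carrier_vec n"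
    and px: "p \<bullet>c x = 0" and Ax: "A *\<^sub>v x = \<alpha> \<cdot>\<^sub>v p" and Ax': "mat_adjoint A *\<^sub>v x = \<beta> \<cdot>\<^sub>v p"
    and c: "\<And>\<xi>. \<exists>s. s \<longlonglongrightarrow> \<xi> \<and> (\<forall>j::nat. p = 0\<^sub>v n \<or>
      exp (\<i> * of_real (s j)) * \<alpha> + exp (- \<i> * of_real (s j)) * \<beta> \<noteq> 0)"
  shows "isotropic n (Suc k) A"
proof -
  define r where "r = complex_of_real (1 / sqrt (sqn x))"
  define u where "u = r \<cdot>\<^sub>v x"
  note u = normalize_vec[OF x, folded r_def, folded u_def]
  have Au: "A *\<^sub>v u = (r * \<alpha>) \<cdot>\<^sub>v p" unfolding u_def mult_mat_vec[OF A x(1)] Ax smult_smult_assoc ..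
  have Au': "mat_adjoint A *\<^sub>v u = (r * \<beta>) \<cdot>\<^sub>v p"
    unfolding u_def mult_mat_vec[OF adjoint_carrier[OF A] x(1)] Ax' smult_smult_assoc ..
  have pu: "p \<bullet>c u = 0" unfolding u_def cdot_smult(2)[OF p x(1)] px by simp
  have u0: "u \<noteq> 0\<^sub>v n" using u(3) sqn_eq_0[OF u(2)] by auto
  obtain m R where R: "m < n" "isom n m R" "\<And>w. w \<in> carrier_vec m \<Longrightarrow> (R *\<^sub>v w) \<bullet>c u = 0"
      "\<And>w. w \<in> carrier_vec m \<Longrightarrow> (R *\<^sub>v w) \<bullet>c p = 0"
    and dec: "\<And>y. y \<in> carrier_vec n \<Longrightarrow> y \<bullet>c p = 0 \<Longrightarrow> 
      (y \<bullet>c u) \<cdot>\<^sub>v u + R *\<^sub>v (mat_adjoint R *\<^sub>v y) = y"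
    using complement_pair[OF u(2,3) p pu] by blast
  note Rc = isomD(1)[OF R(2)]
  define B where "B = mat_adjoint R * A * R"
  have B: "B \<in> carrier_mat m m" unfolding B_def
    by (rule mult_carrier_mat[OF mult_carrier_mat[OF adjoint_carrier[OF Rc] A] Rc])
  have good: "nonneg_frame m k B \<xi>"
    if "p = 0\<^sub>v n \<or> exp (\<i> * of_real \<xi>) * \<alpha> + exp (- \<i> * of_real \<xi>) * \<beta> \<noteq> 0" for \<xi>
    unfolding B_def
  proof (rule nonneg_frame_reduce[OF A u(2) u0 p pu Au Au' _ R(2) R(4) dec])
    have "exp (\<i> * of_real \<xi>) * (r * \<alpha>) + exp (- \<i> * of_real \<xi>) * (r * \<beta>)
      = r * (exp (\<i> * of_real \<xi>) * \<alpha> + exp (- \<i> * of_real \<xi>) * \<beta>)" by (simp add: algebra_simps)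
    then show "p = 0\<^sub>v n \<or> exp (\<i> * of_real \<xi>) * (r * \<alpha>) + exp (- \<i> * of_real \<xi>) * (r * \<beta>) \<noteq> 0"
      using that u(1) by auto
    show "nonneg_frame n (Suc k) A \<xi>" using nn by blast
  qed
  have "nonneg_frame m k B \<xi>" for \<xi>
  proof (cases "k = 0")
    case True
    then show ?thesis using nonneg_frame_0 by simp
  next
    case False
    obtain s where s: "s \<longlonglongrightarrow> \<xi>" and sj: "\<And>j. nonneg_frame m k B (s j)"
      using c[of \<xi>] good by blast
    \<comment> \<open>A frame at one of the approximating angles yields \<open>k \<le> m\<close>,
      which continuity of \<open>lam\<close> on the smaller space presupposes.\<close>
    have k: "1 \<le> k" "k \<le> m"
      using False sj[of 0] frame_dim_le unfolding nonneg_frame_def by auto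
    have "(\<lambda>j. lam k B (s j)) \<longlonglongrightarrow> lam k B \<xi>"
      by (rule isCont_tendsto_compose[OF isCont_lam[OF B k] s])
    moreover have "0 \<le> lam k B (s j)" for j using sj nonneg_frame_iff[OF B k] by blast
    ultimately have "0 \<le> lam k B \<xi>" by (intro LIMSEQ_le_const) auto
    then show ?thesis using nonneg_frame_iff[OF B k] by blast
  qed
  then have "isotropic m k B" using IH[OF R(1) B] by blast
  from isotropic_lift[OF A u(2,3) p pu Au Au' R(2) R(4) R(3) this[unfolded B_def]]
  show ?thesis .
qed

section \<open>Isotropic vectors at a vanishing eigenvalue\<close>

text \<open>Bolzano-Weierstrass for finitely many sequences at once: a monotone subsequence for the
  last one is chosen inside a subsequence that works for the others.\<close>

lemma bounded_convergent_subsequence: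
  fixes f :: "nat \<Rightarrow> nat \<Rightarrow> real"
  assumes "\<And>i j. i < m \<Longrightarrow> \<bar>f i j\<bar> \<le> C"
  shows "\<exists>r. strict_mono r \<and> (\<forall>i<m. convergent (\<lambda>j. f i (r j)))"
  using assms
proof (induction m)
  case 0
  then show ?case by (intro exI[of _ id]) (simp add: strict_mono_def)
next
  case (Suc m)
  then obtain r where r: "strict_mono r" "\<And>i. i < m \<Longrightarrow> convergent (\<lambda>j. f i (r j))" by auto
  obtain q where q: "strict_mono q" "monoseq (\<lambda>j. f m (r (q j)))"
    using seq_monosub[of "\<lambda>j. f m (r j)"] by blast
  have "Bseq (\<lambda>j. f m (r (q j)))" using Suc.prems[of m] by (intro BseqI'[of _ C]) simp
  then have "convergent (\<lambda>j. f m (r (q j)))" using q(2) by (rule Bseq_monoseq_convergent)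
  moreover have "convergent (\<lambda>j. f i (r (q j)))" if "i < m" for i
    using convergent_subseq_convergent[OF r(2)[OF that] q(1)] by (simp add: comp_def)
  ultimately have "\<forall>i<Suc m. convergent (\<lambda>j. f i ((r \<circ> q) j))" by (auto simp: less_Suc_eq)
  then show ?case using strict_mono_o[OF r(1) q(1)] by blast
qed

lemma unit_vec_convergent_subsequence:
  fixes s :: "nat \<Rightarrow> complex vec"
  assumes s: "\<And>j. s j \<in> carrier_vec n" "\<And>j. sqn (s j) = 1"
  shows "\<exists>r l. strict_mono r \<and> l \<in> carrier_vec n \<and> (\<forall>i<n. (\<lambda>j. s (r j) $ i) \<longlonglongrightarrow> l $ i)"
proof -
  define f where "f i j = (if i < n then Re (s j $ i) else Im (s j $ (i - n)))" for i j
  have c: "cmod (s j $ i) \<le> 1" if "i < n" for i j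
  proof -
    have "(cmod (s j $ i))\<^sup>2 \<le> sqn (s j)"
      unfolding sqn_sum[OF s(1)] using that by (intro member_le_sum) auto
    then show ?thesis using s(2) by (simp add: power2_le_iff_abs_le abs_square_le_1)
  qed
  have "\<bar>f i j\<bar> \<le> 1" if "i < n + n" for i j
  proof (cases "i < n")
    case True
    then show ?thesis using order_trans[OF abs_Re_le_cmod c[OF True]] by (simp add: f_def)
  next
    case False
    then have "i - n < n" using that by simp
    from order_trans[OF abs_Im_le_cmod c[OF this]] show ?thesis using False by (simp add: f_def)
  qed
  then obtain r where r: "strict_mono r" "\<And>i. i < n + n \<Longrightarrow> convergent (\<lambda>j. f i (r j))"
    using bounded_convergent_subsequence[of "n + n" f 1] by blast
  define l where "l = vec n (\<lambda>i. Complex (lim (\<lambda>j. f i (r j))) (lim (\<lambda>j. f (n + i) (r j))))"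
  have "(\<lambda>j. s (r j) $ i) \<longlonglongrightarrow> l $ i" if i: "i < n" for i
  proof -
    have "(\<lambda>j. Complex (f i (r j)) (f (n + i) (r j))) \<longlonglongrightarrow> Complex (lim (\<lambda>j. f i (r j))) (lim (\<lambda>j. f (n + i) (r j)))"
      using r(2)[of i] r(2)[of "n + i"] i by (intro tendsto_Complex) (auto simp: convergent_LIMSEQ_iff)
    moreover have "Complex (f i (r j)) (f (n + i) (r j)) = s (r j) $ i" for j
      using i by (simp add: f_def)
    ultimately show ?thesis using i by (simp add: l_def)
  qed
  moreover have "l \<in> carrier_vec n" by (simp add: l_def)
  ultimately show ?thesis using r(1) by blast
qed

lemma tendsto_qf:
  assumes B: "B \<in> carrier_mat n n" and s: "\<And>j. s j \<in> carrier_vec n" and l: "l \<in> carrier_vec n"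
    and lim: "\<And>i. i < n \<Longrightarrow> (\<lambda>j. s j $ i) \<longlonglongrightarrow> l $ i"
  shows "(\<lambda>j. qf B (s j)) \<longlonglongrightarrow> qf B l"
  unfolding qf_sum[OF B s] qf_sum[OF B l] using lim by (intro tendsto_intros) auto

text \<open>If the two values have strictly opposite signs, \<open>x + b y\<close> is isotropic for
  a suitable \<open>b\<close>: its phase removes the cross terms and its modulus balances the
  remaining two.\<close>

lemma isotropic_combination:
  assumes N: "N \<in> carrier_mat n n" "mat_adjoint N = N"
    and x: "x \<in> carrier_vec n" "x \<noteq> 0\<^sub>v n" "Re (qf N x) \<le> 0"
    and y: "y \<in> carrier_vec n" "y \<noteq> 0\<^sub>v n" "0 \<le> Re (qf N y)"
  shows "\<exists>a b. a \<cdot>\<^sub>v x + b \<cdot>\<^sub>v y \<noteq> 0\<^sub>v n \<and> qf N (a \<cdot>\<^sub>v x + b \<cdot>\<^sub>v y) = 0"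
proof -
  have c0: "qf N x = of_real (Re (qf N x))" "qf N y = of_real (Re (qf N y))"
    using qf_hermitian_real[OF N x(1)] qf_hermitian_real[OF N y(1)] .
  consider "qf N x = 0" | "qf N y = 0" | "Re (qf N x) < 0" "0 < Re (qf N y)"
    using x(3) y(3) c0 by (metis less_eq_real_def of_real_0)
  then show ?thesis
  proof cases
    case 1
    have "1 \<cdot>\<^sub>v x + 0 \<cdot>\<^sub>v y = x" using x(1) y(1) by (intro eq_vecI) auto
    then show ?thesis using 1 x(2) by metis
  next
    case 2
    have "0 \<cdot>\<^sub>v x + 1 \<cdot>\<^sub>v y = y" using x(1) y(1) by (intro eq_vecI) auto
    then show ?thesis using 2 y(2) by metis
  next
    case 3
    define f where "f = - Re (qf N x)"
    define g where "g = Re (qf N y)"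
    have fg: "f > 0" "g > 0" using 3 by (auto simp: f_def g_def)
    define c where "c = (N *\<^sub>v x) \<bullet>c y"
    \<comment> \<open>For nonzero \<open>c\<close> the product \<open>u * c\<close> is \<i> times
      the modulus of \<open>c\<close>. Hence \<open>cnj b * c\<close> is purely imaginary for the
      \<open>b\<close> below and cancels against its conjugate.\<close>
    define u where "u = (if c = 0 then 1 else \<i> * cnj c / of_real (cmod c))"
    have u: "cmod u = 1" "Re (u * c) = 0"
    proof -
      show "cmod u = 1" by (simp add: u_def norm_divide norm_mult)
      have "Re (\<i> * (cnj c * c) / of_real (cmod c)) = 0"
        unfolding mult.commute[of "cnj c"] complex_norm_square[symmetric]
        by (simp add: Re_divide_of_real)
      then show "Re (u * c) = 0" by (simp add: u_def mult.assoc)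
    qed
    define b where "b = of_real (sqrt (f / g)) * cnj u"
    have b2: "(cmod b)\<^sup>2 = f / g" using u(1) fg by (simp add: b_def norm_mult)
    have X: "1 \<cdot>\<^sub>v x = x" by (rule one_smult_vec)
    have by': "b \<cdot>\<^sub>v y \<in> carrier_vec n" using y(1) by simp
    have Nx: "N *\<^sub>v x \<in> carrier_vec n" by (rule mult_mat_vec_carrier[OF N(1) x(1)])
    have c1: "(N *\<^sub>v x) \<bullet>c (b \<cdot>\<^sub>v y) = cnj b * c"
      unfolding cdot_smult(2)[OF Nx y(1)] c_def ..
    have c2: "(N *\<^sub>v (b \<cdot>\<^sub>v y)) \<bullet>c x = cnj (cnj b * c)"
      unfolding cdot_adjoint[OF N(1) by' x(1)] N(2) cdot_commute[OF Nx by'] c1 ..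
    have re: "Re (cnj b * c) = 0"
    proof -
      have "cnj b * c = of_real (sqrt (f / g)) * (u * c)" by (simp add: b_def)
      moreover have "Re (of_real k * w) = k * Re w" for k w by simp
      ultimately show ?thesis using u(2) by (simp only: mult_zero_right)
    qed
    have "qf N (1 \<cdot>\<^sub>v x + b \<cdot>\<^sub>v y) = qf N x + of_real (f / g) * qf N y + (cnj b * c + cnj (cnj b * c))"
      unfolding X qf_add[OF N(1) x(1) by'] qf_smult[OF N(1) y(1)] b2 c1 c2 by simp
    also have "cnj b * c + cnj (cnj b * c) = 0" unfolding complex_add_cnj re by simp
    also have "qf N x + of_real (f / g) * qf N y + 0 = of_real (- f + (f / g) * g)"
      unfolding f_def g_def of_real_add of_real_mult using c0 by simp
    also have "\<dots> = 0" using fg by simp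
    finally have 0: "qf N (1 \<cdot>\<^sub>v x + b \<cdot>\<^sub>v y) = 0" .
    \<comment> \<open>If the combination vanished, \<open>x\<close> would be a multiple of
      \<open>y\<close>, and the form could not have opposite signs at the two vectors.\<close>
    have "1 \<cdot>\<^sub>v x + b \<cdot>\<^sub>v y \<noteq> 0\<^sub>v n"
    proof
      assume z: "1 \<cdot>\<^sub>v x + b \<cdot>\<^sub>v y = 0\<^sub>v n"
      have "x = (- b) \<cdot>\<^sub>v y"
      proof (rule eq_vecI)
        fix i assume "i < dim_vec ((- b) \<cdot>\<^sub>v y)"
        then have i: "i < n" using y(1) by simp
        have "(1 \<cdot>\<^sub>v x + b \<cdot>\<^sub>v y) $ i = 0" unfolding z using i by simp
        then show "x $ i = ((- b) \<cdot>\<^sub>v y) $ i" using i x(1) y(1) by (simp add: eq_neg_iff_add_eq_0)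
      qed (use x(1) y(1) in auto)
      then have "qf N x = of_real ((cmod (- b))\<^sup>2) * qf N y" using qf_smult[OF N(1) y(1)] by metis
      then have "qf N x = of_real (f / g) * of_real g" using b2 c0(2) unfolding g_def by simp
      then have "qf N x = of_real f" using fg by simp
      then have "Re (qf N x) = f" by (simp only: Re_complex_of_real)
      then show False using fg(1) unfolding f_def by linarith
    qed
    then show ?thesis using 0 by blast
  qed
qed

lemma exp_i_add: "exp (\<i> * of_real (a + b)) = exp (\<i> * of_real a) * exp (\<i> * of_real b)"
  by (simp add: distrib_left exp_add)

lemma exp_i: "exp (\<i> * of_real a) = Complex (cos a) (sin a)"
  using cis_conv_exp[of a] by (simp add: cis.code)

text \<open>The vector \<open>y\<close> is a limit of unit vectors on which the forms at angles \<open>\<xi>0 + \<eta>\<close> are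
  nonnegative, where \<open>\<eta>\<close> tends to \<open>0\<close> and has the sign \<open>\<sigma>\<close>.\<close>

lemma boundary_kernel_sign:
  assumes A: "A \<in> carrier_mat n n" and k: "1 \<le> k" "k \<le> n"
    and nn: "\<forall>\<xi>. nonneg_frame n k A \<xi>" and l0: "lam k A \<xi>0 = 0" and \<sigma>: "\<sigma> = 1 \<or> \<sigma> = (-1::real)"
  shows "\<exists>y\<in>carrier_vec n. y \<noteq> 0\<^sub>v n \<and> rot \<xi>0 A *\<^sub>v y = 0\<^sub>v n \<and> \<sigma> * Im (exp (\<i> * of_real \<xi>0) * qf A y) \<le> 0"
proof -
  define H where "H = rot \<xi>0 A"
  have H: "H \<in> carrier_mat n n" "mat_adjoint H = H" unfolding H_def using rot_carrier[OF A] rot_hermitian[OF A] by auto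
  obtain P where P: "isom n n P" and ev: "\<forall>j<n. H *\<^sub>v col P j = of_real (eigval_list H ! j) \<cdot>\<^sub>v col P j"
    using spectral_theorem[OF H] by blast
  note Pc = isomD(1)[OF P]
  define d where "d i = eigval_list H ! i" for i
  have dk: "d (k - 1) = 0" using l0 by (simp add: d_def lam_def kth_eigval_def eigval_list_def H_def)
  have d_le: "d i \<le> 0" if "k - 1 \<le> i" "i < n" for i
    using eigval_list(3)[OF H(1) that] dk by (simp add: d_def)
  define g where "g s = exp (\<i> * of_real \<xi>0) * qf A (P *\<^sub>v s)" for s
  have Ps: "P *\<^sub>v s \<in> carrier_vec n" if "s \<in> carrier_vec n" for s by (rule mult_mat_vec_carrier[OF Pc that])
  have reg: "2 * Re (g s) = (\<Sum>i<n. d i * (cmod (s $ i))\<^sup>2)" if s: "s \<in> carrier_vec n" for s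
    using qf_diagonalized[OF H(1) P ev s] qf_rot[OF A Ps[OF s], of \<xi>0]
    unfolding H_def g_def d_def by (metis of_real_eq_iff)
  have neg: "d i * (cmod (s $ i))\<^sup>2 \<le> 0" if "\<forall>i<k - 1. s $ i = 0" "i < n" for s i
    using that d_le[of i] by (cases "i < k - 1") (auto intro: mult_nonpos_nonneg)
  \<comment> \<open>In a \<open>k\<close>-dimensional subspace that is nonnegative at the angle
    \<open>\<xi>0 + \<eta>\<close>, \<open>k - 1\<close> coordinates can be made to vanish. The
    remaining ones belong to eigenvalues of \<open>H\<close> that are at most 0.\<close>
  have ex: "\<exists>s\<in>carrier_vec n. sqn s = 1 \<and> (\<forall>i<k - 1. s $ i = 0) \<and>
      0 \<le> Re (exp (\<i> * of_real \<eta>) * g s)" for \<eta>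
  proof -
    obtain U where U: "frame n k U" 
      and pos: "\<And>v. v \<in> carrier_vec k \<Longrightarrow> 0 \<le> Re (exp (\<i> * of_real (\<xi>0 + \<eta>)) * qf A (U *\<^sub>v v))"
      using nn unfolding nonneg_frame_def by blast
    note Uc = frameD(1)[OF U]
    have "\<exists>v. v \<in> carrier_vec k \<and> v \<noteq> 0\<^sub>v k \<and> (\<forall>i\<in>{..<k - 1}. (mat_adjoint P * U *\<^sub>v v) $ i = 0)"
      by (rule kernel_vector[OF mult_carrier_mat[OF adjoint_carrier[OF Pc] Uc]]) (use k in auto)
    then obtain v where v: "v \<in> carrier_vec k" "v \<noteq> 0\<^sub>v k"
      and z: "\<And>i. i < k - 1 \<Longrightarrow> (mat_adjoint P * U *\<^sub>v v) $ i = 0" by blast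
    have Uv: "U *\<^sub>v v \<in> carrier_vec n" by (rule mult_mat_vec_carrier[OF Uc v(1)])
    have Uv0: "U *\<^sub>v v \<noteq> 0\<^sub>v n" using frameD(2)[OF U v(1)] v(2) by blast
    define t where "t = mat_adjoint P *\<^sub>v (U *\<^sub>v v)"
    have t: "t \<in> carrier_vec n" unfolding t_def by (rule mult_mat_vec_carrier[OF adjoint_carrier[OF Pc] Uv])
    have Pt: "P *\<^sub>v t = U *\<^sub>v v" unfolding t_def by (rule isom_surj[OF P Uv])
    have t0: "t \<noteq> 0\<^sub>v n" using Pt Uv0 mult_zero_vec[OF Pc] by auto
    have tz: "t $ i = 0" if "i < k - 1" for i
      using z[OF that] assoc_mult_mat_vec[OF adjoint_carrier[OF Pc] Uc v(1)] by (simp add: t_def)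
    define r where "r = complex_of_real (1 / sqrt (sqn t))"
    note u = normalize_vec[OF t t0, folded r_def]
    have "P *\<^sub>v (r \<cdot>\<^sub>v t) = U *\<^sub>v (r \<cdot>\<^sub>v v)"
      unfolding mult_mat_vec[OF Pc t] mult_mat_vec[OF Uc v(1)] Pt ..
    then have "0 \<le> Re (exp (\<i> * of_real \<eta>) * g (r \<cdot>\<^sub>v t))"
      using pos[of "r \<cdot>\<^sub>v v"] v(1) unfolding g_def exp_i_add by (simp only: mult_ac smult_carrier_vec)
    moreover have "\<forall>i<k - 1. (r \<cdot>\<^sub>v t) $ i = 0" using tz t k by auto
    ultimately show ?thesis using u by blast
  qed
  \<comment> \<open>The factor 1/2 keeps the modulus of the angle in (0, 1/2], where sine and cosine
    are both positive.\<close>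
  define \<eta> where "\<eta> j = \<sigma> / 2 / real (Suc j)" for j
  have "\<forall>j. \<exists>s. s \<in> carrier_vec n \<and> sqn s = 1 \<and> (\<forall>i<k - 1. s $ i = 0) \<and> 0 \<le> Re (exp (\<i> * of_real (\<eta> j)) * g s)"
    using ex by blast
  then obtain s where s: "\<And>j. s j \<in> carrier_vec n" "\<And>j. sqn (s j) = 1" "\<And>j. \<forall>i<k - 1. s j $ i = 0"
    and ge: "\<And>j. 0 \<le> Re (exp (\<i> * of_real (\<eta> j)) * g (s j))" by metis
  obtain r l where r: "strict_mono r" and l: "l \<in> carrier_vec n" and lim: "\<And>i. i < n \<Longrightarrow> (\<lambda>j. s (r j) $ i) \<longlonglongrightarrow> l $ i"
    using unit_vec_convergent_subsequence[of s n] s(1,2) by blast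
  have "(\<lambda>j. qf (1\<^sub>m n) (s (r j))) \<longlonglongrightarrow> qf (1\<^sub>m n) l"
    by (rule tendsto_qf[OF one_carrier_mat s(1) l lim])
  then have "(\<lambda>j. 1) \<longlonglongrightarrow> complex_of_real (sqn l)" unfolding qf_one[OF s(1)] qf_one[OF l] s(2) by simp
  then have "complex_of_real (sqn l) = 1" by (rule LIMSEQ_unique[OF _ tendsto_const])
  then have l1: "sqn l = 1" by simp
  have lz: "l $ i = 0" if "i < k - 1" for i
  proof -
    have "(\<lambda>j. s (r j) $ i) \<longlonglongrightarrow> l $ i" using that k by (intro lim) simp
    moreover have "s (r j) $ i = 0" for j using s(3) that by blast
    ultimately show ?thesis using LIMSEQ_unique[of "\<lambda>j. s (r j) $ i" "l $ i" 0] by simp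
  qed
  have gB: "g t = exp (\<i> * of_real \<xi>0) * qf (mat_adjoint P * A * P) t" if "t \<in> carrier_vec n" for t
    unfolding g_def qf_congruence[OF A Pc that] ..
  have Bc: "mat_adjoint P * A * P \<in> carrier_mat n n"
    by (rule mult_carrier_mat[OF mult_carrier_mat[OF adjoint_carrier[OF Pc] A] Pc])
  have glim: "(\<lambda>j. g (s (r j))) \<longlonglongrightarrow> g l"
    unfolding gB[OF s(1)] gB[OF l] by (intro tendsto_intros tendsto_qf[OF Bc s(1) l lim])
  have "(\<lambda>j. inverse (real (Suc (r j)))) \<longlonglongrightarrow> 0"
    using LIMSEQ_subseq_LIMSEQ[OF LIMSEQ_inverse_real_of_nat r] by (simp add: comp_def)
  then have "(\<lambda>j. \<sigma> / 2 * inverse (real (Suc (r j)))) \<longlonglongrightarrow> \<sigma> / 2 * 0" by (intro tendsto_intros)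
  then have \<eta>lim: "(\<lambda>j. \<eta> (r j)) \<longlonglongrightarrow> 0" 
    unfolding \<eta>_def by (simp only: divide_inverse mult_zero_right)
  have "(\<lambda>j. Re (exp (\<i> * of_real (\<eta> (r j))) * g (s (r j)))) \<longlonglongrightarrow> Re (exp (\<i> * of_real 0) * g l)"
    by (intro tendsto_intros glim \<eta>lim)
  then have "0 \<le> Re (exp (\<i> * of_real 0) * g l)"
    using ge by (intro LIMSEQ_le_const) auto
  then have "0 \<le> Re (g l)" by simp
  then have "0 \<le> (\<Sum>i<n. d i * (cmod (l $ i))\<^sup>2)" using reg[OF l] by simp
  \<comment> \<open>Every term is nonpositive because the leading coordinates of \<open>l\<close>
    vanish, yet the sum is nonnegative in the limit. So all terms vanish, and \<open>P l\<close>
    lies in the kernel of \<open>H\<close>.\<close>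
  moreover have nl: "\<And>i. i \<in> {..<n} \<Longrightarrow> d i * (cmod (l $ i))\<^sup>2 \<le> 0" using neg lz by simp
  ultimately have "(\<Sum>i<n. d i * (cmod (l $ i))\<^sup>2) = 0" using sum_nonpos[of "{..<n}"] by (meson order_antisym)
  have dl: "d i * (cmod (l $ i))\<^sup>2 = 0" if "i < n" for i
  proof -
    have "(\<Sum>i<n. - (d i * (cmod (l $ i))\<^sup>2)) = 0"
      using \<open>(\<Sum>i<n. d i * (cmod (l $ i))\<^sup>2) = 0\<close> by (simp only: sum_negf minus_zero)
    moreover have "\<And>i. i \<in> {..<n} \<Longrightarrow> 0 \<le> - (d i * (cmod (l $ i))\<^sup>2)" using nl by simp
    ultimately have "\<forall>i\<in>{..<n}. - (d i * (cmod (l $ i))\<^sup>2) = 0"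
      using sum_nonneg_eq_0_iff[OF finite_lessThan, of n "\<lambda>i. - (d i * (cmod (l $ i))\<^sup>2)"] by blast
    then show ?thesis using that by simp
  qed
  have "of_real (d i) * l $ i = 0" if "i < n" for i using dl[OF that] by auto
  then have "vec n (\<lambda>i. of_real (eigval_list H ! i) * l $ i) = 0\<^sub>v n"
    unfolding d_def by (intro eq_vecI) auto
  then have Hl: "H *\<^sub>v (P *\<^sub>v l) = 0\<^sub>v n"
    using mult_vec_diagonalized[OF H(1) Pc ev l] mult_zero_vec[OF Pc] by simp
  \<comment> \<open>With \<open>Re (g (s j)) \<le> 0\<close>, nonnegativity of \<open>cos \<epsilon>
    * Re (g (s j)) - sin \<epsilon> * (\<sigma> * Im (g (s j)))\<close> rules out a positive
    \<open>\<sigma> * Im (g (s j))\<close>.\<close>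
  have "\<sigma> * Im (g (s j)) \<le> 0" for j
  proof -
    have "2 * Re (g (s j)) \<le> 0" unfolding reg[OF s(1)] using neg[OF s(3)] by (intro sum_nonpos) auto
    moreover define \<epsilon> where "\<epsilon> = 1 / 2 / real (Suc j)"
    have \<epsilon>: "0 < \<epsilon>" "\<epsilon> \<le> 1 / 2" by (auto simp: \<epsilon>_def divide_le_eq)
    have tri: "cos (\<eta> j) = cos \<epsilon>" "sin (\<eta> j) = \<sigma> * sin \<epsilon>" using \<sigma> by (auto simp: \<eta>_def \<epsilon>_def)
    have "0 < sin \<epsilon>" using \<epsilon> pi_ge_two by (intro sin_gt_zero) auto
    moreover have "0 < cos \<epsilon>" using \<epsilon> pi_ge_two by (intro cos_gt_zero) auto
    moreover have "Re (exp (\<i> * of_real (\<eta> j)) * g (s j)) = cos \<epsilon> * Re (g (s j)) - sin \<epsilon> * (\<sigma> * Im (g (s j)))"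
      unfolding exp_i using tri by simp
    ultimately show ?thesis using ge[of j]
      by (smt (verit) mult_nonneg_nonpos mult_pos_pos zero_less_mult_pos)
  qed
  moreover have "(\<lambda>j. \<sigma> * Im (g (s (r j)))) \<longlonglongrightarrow> \<sigma> * Im (g l)" by (intro tendsto_intros glim)
  ultimately have "\<sigma> * Im (g l) \<le> 0" by (intro LIMSEQ_le_const2) auto
  moreover have "P *\<^sub>v l \<noteq> 0\<^sub>v n"
  proof
    assume "P *\<^sub>v l = 0\<^sub>v n"
    then have "sqn l = 0" using isom_sqn[OF P l] sqn_eq_0[of "0\<^sub>v n" n] by simp
    then show False using l1 by simp
  qed
  ultimately show ?thesis using Hl Ps[OF l] unfolding g_def H_def by blast
qed

text \<open>\<open>N\<close>, a further quarter turn, is the derivative of the family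
  \<open>rot \<xi> A\<close> at \<open>\<xi>0\<close>. The two signs in
  \<open>boundary_kernel_sign\<close> give kernel vectors at which its form is nonpositive and
  nonnegative. A combination isotropic for \<open>N\<close> stays in the kernel, so both the real
  and the imaginary part of \<open>exp (\<i> * of_real \<xi>0) * qf A x\<close> vanish
  there.\<close>

lemma boundary_isotropic_vector:
  assumes A: "A \<in> carrier_mat n n" and k: "1 \<le> k" "k \<le> n"
    and nn: "\<forall>\<xi>. nonneg_frame n k A \<xi>" and l0: "lam k A \<xi>0 = 0"
  shows "\<exists>x\<in>carrier_vec n. x \<noteq> 0\<^sub>v n \<and> rot \<xi>0 A *\<^sub>v x = 0\<^sub>v n \<and> qf A x = 0"
proof -
  define N where "N = rot (\<xi>0 + pi / 2) A"
  have N: "N \<in> carrier_mat n n" "mat_adjoint N = N" unfolding N_def using rot_carrier[OF A] rot_hermitian[OF A] by auto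
  have qN: "qf N y = of_real (- 2 * Im (exp (\<i> * of_real \<xi>0) * qf A y))" if "y \<in> carrier_vec n" for y
  proof -
    have "exp (\<i> * of_real (pi / 2)) = \<i>" unfolding exp_i by (simp add: complex_eq_iff)
    then have e: "exp (\<i> * of_real (\<xi>0 + pi / 2)) * qf A y = \<i> * (exp (\<i> * of_real \<xi>0) * qf A y)"
      unfolding exp_i_add by (simp only: mult_ac)
    have "Re (\<i> * w) = - Im w" for w by simp
    then show ?thesis unfolding N_def qf_rot[OF A that] e by (simp only: mult_minus_left mult_minus_right)
  qed
  obtain y where y: "y \<in> carrier_vec n" "y \<noteq> 0\<^sub>v n" "rot \<xi>0 A *\<^sub>v y = 0\<^sub>v n" "1 * Im (exp (\<i> * of_real \<xi>0) * qf A y) \<le> 0"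
    using boundary_kernel_sign[OF A k nn l0, of 1] by auto
  obtain x where x: "x \<in> carrier_vec n" "x \<noteq> 0\<^sub>v n" "rot \<xi>0 A *\<^sub>v x = 0\<^sub>v n" "(-1) * Im (exp (\<i> * of_real \<xi>0) * qf A x) \<le> 0"
    using boundary_kernel_sign[OF A k nn l0, of "-1"] by auto
  have "Re (qf N x) \<le> 0" "0 \<le> Re (qf N y)" 
    unfolding qN[OF x(1)] qN[OF y(1)] Re_complex_of_real using x(4) y(4) by linarith+
  then obtain a b where ab: "a \<cdot>\<^sub>v x + b \<cdot>\<^sub>v y \<noteq> 0\<^sub>v n" "qf N (a \<cdot>\<^sub>v x + b \<cdot>\<^sub>v y) = 0"
    using isotropic_combination[OF N x(1,2) _ y(1,2)] by blast
  let ?z = "a \<cdot>\<^sub>v x + b \<cdot>\<^sub>v y"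
  have ax: "a \<cdot>\<^sub>v x \<in> carrier_vec n" and bb: "b \<cdot>\<^sub>v y \<in> carrier_vec n" using x(1) y(1) by auto
  have z: "?z \<in> carrier_vec n" using ax bb by simp
  have Rz: "rot \<xi>0 A *\<^sub>v ?z = 0\<^sub>v n"
    unfolding mult_add_distrib_mat_vec[OF rot_carrier[OF A] ax bb] mult_mat_vec[OF rot_carrier[OF A] x(1)]
      mult_mat_vec[OF rot_carrier[OF A] y(1)] x(3) y(3) by (intro eq_vecI) auto
  have "qf (rot \<xi>0 A) ?z = 0" unfolding qf_def Rz using z by (simp add: cdot_sum[of _ n])
  then have "Re (exp (\<i> * of_real \<xi>0) * qf A ?z) = 0" unfolding qf_rot[OF A z] by (metis mult_eq_0_iff of_real_eq_0_iff zero_neq_numeral)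
  moreover have "Im (exp (\<i> * of_real \<xi>0) * qf A ?z) = 0"
    using ab(2) unfolding qN[OF z] by (metis mult_eq_0_iff neg_equal_0_iff_equal of_real_eq_0_iff zero_neq_numeral)
  ultimately have "exp (\<i> * of_real \<xi>0) * qf A ?z = 0" by (simp only: complex_eq_iff zero_complex.sel)
  then have "qf A ?z = 0" by simp
  then show ?thesis using z ab(1) Rz by blast
qed

section \<open>Isotropic frames\<close>

lemma rot_mult_vec:
  assumes A: "A \<in> carrier_mat n n" and x: "x \<in> carrier_vec n"
  shows "rot \<xi> A *\<^sub>v x = exp (\<i> * of_real \<xi>) \<cdot>\<^sub>v (A *\<^sub>v x) + exp (- \<i> * of_real \<xi>) \<cdot>\<^sub>v (mat_adjoint A *\<^sub>v x)"
proof -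
  have s: "(c \<cdot>\<^sub>m M) *\<^sub>v x = c \<cdot>\<^sub>v (M *\<^sub>v x)" if "M \<in> carrier_mat n n" for c :: complex and M
    using that x by (intro eq_vecI) auto
  show ?thesis unfolding rot_def
    using add_mult_distrib_mat_vec[OF smult_carrier_mat[OF A] smult_carrier_mat[OF adjoint_carrier[OF A]] x]
    unfolding s[OF A] s[OF adjoint_carrier[OF A]] .
qed

text \<open>Kernel vectors fit the reduction: \<open>p = A x\<close> can be taken, with coefficients
  1 and \<open>- exp (2 \<i> \<xi>)\<close>.\<close>

lemma rot_kernel_adjoint:
  assumes A: "A \<in> carrier_mat n n" and x: "x \<in> carrier_vec n" and z: "rot \<xi> A *\<^sub>v x = 0\<^sub>v n"
  shows "mat_adjoint A *\<^sub>v x = (- (exp (\<i> * of_real \<xi>) * exp (\<i> * of_real \<xi>))) \<cdot>\<^sub>v (A *\<^sub>v x)"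
proof (rule eq_vecI)
  let ?e = "exp (\<i> * of_real \<xi>)"
  have Ax: "A *\<^sub>v x \<in> carrier_vec n" by (rule mult_mat_vec_carrier[OF A x])
  have Bx: "mat_adjoint A *\<^sub>v x \<in> carrier_vec n" by (rule mult_mat_vec_carrier[OF adjoint_carrier[OF A] x])
  fix i assume "i < dim_vec ((- (?e * ?e)) \<cdot>\<^sub>v (A *\<^sub>v x))"
  then have i: "i < n" using A by simp
  have "?e * (A *\<^sub>v x) $ i + exp (- \<i> * of_real \<xi>) * (mat_adjoint A *\<^sub>v x) $ i = (rot \<xi> A *\<^sub>v x) $ i"
    unfolding rot_mult_vec[OF A x] using i A by (simp del: index_mult_mat_vec)
  then have "?e * (?e * (A *\<^sub>v x) $ i + exp (- \<i> * of_real \<xi>) * (mat_adjoint A *\<^sub>v x) $ i) = 0"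
    unfolding z using i by simp
  moreover have "?e * exp (- \<i> * of_real \<xi>) = 1" by (simp add: exp_add[symmetric])
  ultimately have "?e * ?e * (A *\<^sub>v x) $ i + (mat_adjoint A *\<^sub>v x) $ i = 0"
    by (metis distrib_left mult.assoc mult_1)
  then show "(mat_adjoint A *\<^sub>v x) $ i = ((- (?e * ?e)) \<cdot>\<^sub>v (A *\<^sub>v x)) $ i"
    using i A by (simp add: add_eq_0_iff del: index_mult_mat_vec)
qed (use A in simp)

text \<open>For \<open>p = A x\<close> the coefficient at the angle \<theta> equals
  \<open>2 \<i> exp (\<i> \<xi>0) sin (\<theta> - \<xi>0)\<close>. It vanishes only at isolated
  angles, which are limits of others.\<close>

lemma isotropic_boundary:
  assumes IH: "\<And>m k B. m < n \<Longrightarrow> B \<in> carrier_mat m m \<Longrightarrow> (\<forall>\<xi>. nonneg_frame m k B \<xi>) \<Longrightarrow> isotropic m k B"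
    and A: "A \<in> carrier_mat n n" and k: "1 \<le> k" "k \<le> n"
    and nn: "\<forall>\<xi>. nonneg_frame n k A \<xi>" and l0: "lam k A \<xi>0 = 0"
  shows "isotropic n k A"
proof -
  obtain x where x: "x \<in> carrier_vec n" "x \<noteq> 0\<^sub>v n" "rot \<xi>0 A *\<^sub>v x = 0\<^sub>v n" "qf A x = 0"
    using boundary_isotropic_vector[OF A k nn l0] by blast
  obtain k' where k': "k = Suc k'" using k(1) by (cases k) auto
  let ?e = "exp (\<i> * of_real \<xi>0)"
  have Ax: "A *\<^sub>v x = 1 \<cdot>\<^sub>v (A *\<^sub>v x)" by (rule one_smult_vec[symmetric])
  have c0: "exp (\<i> * of_real \<theta>) * 1 + exp (- \<i> * of_real \<theta>) * (- (?e * ?e)) \<noteq> 0" if "sin (\<theta> - \<xi>0) \<noteq> 0" for \<theta>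
  proof
    assume "exp (\<i> * of_real \<theta>) * 1 + exp (- \<i> * of_real \<theta>) * (- (?e * ?e)) = 0"
    then have "exp (\<i> * of_real \<theta>) = exp (- \<i> * of_real \<theta>) * (?e * ?e)" by simp
    then have "exp (\<i> * of_real \<theta>) * exp (\<i> * of_real (- \<xi>0)) 
        = exp (- \<i> * of_real \<theta>) * (?e * ?e) * exp (\<i> * of_real (- \<xi>0))" by simp
    then have "exp (\<i> * of_real (\<theta> - \<xi>0)) = exp (\<i> * of_real (\<xi>0 - \<theta>))"
      by (simp add: exp_add[symmetric] algebra_simps)
    then have "sin (\<theta> - \<xi>0) = sin (\<xi>0 - \<theta>)" unfolding exp_i by simp
    moreover have "sin (\<xi>0 - \<theta>) = - sin (\<theta> - \<xi>0)" by (metis minus_diff_eq sin_minus)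
    ultimately show False using that by simp
  qed
  show ?thesis unfolding k'
  proof (rule isotropic_reduction[OF IH A _ x(1,2) mult_mat_vec_carrier[OF A x(1)] _ Ax rot_kernel_adjoint[OF A x(1,3)]])
    show "\<forall>\<xi>. nonneg_frame n (Suc k') A \<xi>" using nn k' by simp
    show "(A *\<^sub>v x) \<bullet>c x = 0" using x(4) by (simp add: qf_def)
    fix \<xi>
    \<comment> \<open>At an exceptional angle the shift lies in (0, 1], hence strictly between 0 and
      \<open>pi\<close>, where the sine is nonzero.\<close>
    define s where "s j = (if sin (\<xi> - \<xi>0) = 0 then \<xi> + inverse (real (Suc j)) else \<xi>)" for j
    have "s \<longlonglongrightarrow> \<xi>"
    proof (cases "sin (\<xi> - \<xi>0) = 0")
      case True
      have "(\<lambda>j. \<xi> + inverse (real (Suc j))) \<longlonglongrightarrow> \<xi> + 0"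
        by (intro tendsto_intros LIMSEQ_inverse_real_of_nat)
      then show ?thesis unfolding s_def using True by simp
    next
      case False
      then have "s = (\<lambda>_. \<xi>)" by (simp add: s_def fun_eq_iff)
      then show ?thesis by simp
    qed
    moreover have "sin (s j - \<xi>0) \<noteq> 0" for j
    proof (cases "sin (\<xi> - \<xi>0) = 0")
      case True
      have e: "0 < inverse (real (Suc j))" "inverse (real (Suc j)) \<le> 1" by (auto simp: inverse_le_1_iff)
      have "0 < sin (inverse (real (Suc j)))" using e pi_ge_two by (intro sin_gt_zero) auto
      moreover have "cos (\<xi> - \<xi>0) \<noteq> 0" using True sin_zero_abs_cos_one by fastforce
      moreover have "s j - \<xi>0 = (\<xi> - \<xi>0) + inverse (real (Suc j))" using True by (simp add: s_def)
      ultimately show ?thesis using True by (simp only: sin_add) simp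
    qed (simp add: s_def)
    ultimately show "\<exists>s. s \<longlonglongrightarrow> \<xi> \<and> (\<forall>j::nat. A *\<^sub>v x = 0\<^sub>v n \<or>
      exp (\<i> * of_real (s j)) * 1 + exp (- \<i> * of_real (s j)) * (- (?e * ?e)) \<noteq> 0)"
      using c0 by blast
  qed
qed

section \<open>Positive \<open>k\<close>-th eigenvalues in dimension at most
  \<open>2 k\<close>\<close>

lemma positive_frame:
  assumes A: "A \<in> carrier_mat n n" and k: "1 \<le> k" "k \<le> n" and pos: "0 < lam k A \<xi>"
  shows "\<exists>U. frame n k U \<and> (\<forall>v\<in>carrier_vec k. v \<noteq> 0\<^sub>v k \<longrightarrow> 0 < Re (exp (\<i> * of_real \<xi>) * qf A (U *\<^sub>v v)))"
proof -
  obtain U where U: "frame n k U" 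
    and ge: "\<And>v. v \<in> carrier_vec k \<Longrightarrow> lam k A \<xi> * sqn (U *\<^sub>v v) \<le> 2 * Re (exp (\<i> * of_real \<xi>) * qf A (U *\<^sub>v v))"
    using le_lam_iff[OF A k, of "lam k A \<xi>" \<xi>] by blast
  have "0 < Re (exp (\<i> * of_real \<xi>) * qf A (U *\<^sub>v v))" if v: "v \<in> carrier_vec k" "v \<noteq> 0\<^sub>v k" for v
  proof -
    have "U *\<^sub>v v \<in> carrier_vec n" by (rule mult_mat_vec_carrier[OF frameD(1)[OF U] v(1)])
    then have "sqn (U *\<^sub>v v) \<noteq> 0" using frameD(2)[OF U v(1)] v(2) sqn_eq_0 by blast
    then have "0 < sqn (U *\<^sub>v v)" using sqn_nonneg[of "U *\<^sub>v v"] by linarith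
    then have "0 < lam k A \<xi> * sqn (U *\<^sub>v v)" using pos by (intro mult_pos_pos)
    then show ?thesis using ge[OF v(1)] by linarith
  qed
  then show ?thesis using U by blast
qed

text \<open>The form at \<xi> is positive on \<open>U\<close> and, being the negative of the one at
  \<open>\<xi> + pi\<close>, negative on \<open>W\<close>. Together with \<open>x\<close> these are
  \<open>2 k + 1 > n\<close> columns, so they are dependent. A kernel vector contributes nothing to
  the form; comparing signs in the relation leaves zero coefficients for \<open>U\<close> and
  \<open>W\<close>, and therefore \<open>x = 0\<close>.\<close>

lemma rot_nonsingular:
  assumes A: "A \<in> carrier_mat n n" and k: "1 \<le> k" "k \<le> n" "n \<le> 2 * k" and pos: "\<And>\<xi>. 0 < lam k A \<xi>"
    and x: "x \<in> carrier_vec n" and z: "rot \<xi> A *\<^sub>v x = 0\<^sub>v n"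
  shows "x = 0\<^sub>v n"
proof -
  define H where "H = rot \<xi> A"
  have H: "H \<in> carrier_mat n n" "mat_adjoint H = H" unfolding H_def using rot_carrier[OF A] rot_hermitian[OF A] by auto
  \<comment> \<open>Written as a multiple of the zero vector so that \<open>qf_add_radical\<close>
    applies to \<open>H\<close> with \<open>p = 0\<close>.\<close>
  have "0\<^sub>v n = (0::complex) \<cdot>\<^sub>v 0\<^sub>v n" by (intro eq_vecI) auto
  then have Hx: "H *\<^sub>v x = 0 \<cdot>\<^sub>v 0\<^sub>v n" using z unfolding H_def by metis
  have qH: "qf H y = of_real (2 * Re (exp (\<i> * of_real \<xi>) * qf A y))" if "y \<in> carrier_vec n" for y
    unfolding H_def by (rule qf_rot[OF A that])
  obtain U where U: "frame n k U" 
    and Up: "\<And>v. v \<in> carrier_vec k \<Longrightarrow> v \<noteq> 0\<^sub>v k \<Longrightarrow> 0 < Re (exp (\<i> * of_real \<xi>) * qf A (U *\<^sub>v v))"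
    using positive_frame[OF A k(1,2) pos] by blast
  obtain W where W: "frame n k W" 
    and Wp': "\<And>v. v \<in> carrier_vec k \<Longrightarrow> v \<noteq> 0\<^sub>v k \<Longrightarrow> 0 < Re (exp (\<i> * of_real (\<xi> + pi)) * qf A (W *\<^sub>v v))"
    using positive_frame[OF A k(1,2) pos] by blast
  have "exp (\<i> * of_real (\<xi> + pi)) = - exp (\<i> * of_real \<xi>)" unfolding exp_i by (simp add: complex_eq_iff)
  then have Wp: "Re (exp (\<i> * of_real \<xi>) * qf A (W *\<^sub>v v)) < 0" if "v \<in> carrier_vec k" "v \<noteq> 0\<^sub>v k" for v
    using Wp'[OF that] by (simp only: mult_minus_left uminus_complex.sel neg_0_less_iff_less)
  note Uc = frameD(1)[OF U] and Wc = frameD(1)[OF W]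
  have xc: "colmat x \<in> carrier_mat n 1" using x by simp
  note Xc = hcat_carrier[OF Uc xc]
  define M where "M = hcat (hcat U (colmat x)) W"
  have Mc: "M \<in> carrier_mat n (k + 1 + k)" unfolding M_def by (rule hcat_carrier[OF Xc Wc])
  have "\<exists>v. v \<in> carrier_vec (k + 1 + k) \<and> v \<noteq> 0\<^sub>v (k + 1 + k) \<and> (\<forall>i\<in>{..<n}. (M *\<^sub>v v) $ i = 0)"
    by (rule kernel_vector[OF Mc]) (use k in auto)
  then obtain v where v: "v \<in> carrier_vec (k + 1 + k)" "v \<noteq> 0\<^sub>v (k + 1 + k)" "\<forall>i\<in>{..<n}. (M *\<^sub>v v) $ i = 0" by blast
  have Mv: "M *\<^sub>v v = 0\<^sub>v n" using v(3) Mc by (intro eq_vecI) auto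
  define b where "b = vec_last v k"
  define a' where "a' = vec_first v (k + 1)"
  define a where "a = vec_first a' k"
  define t where "t = vec_last a' 1"
  have c: "b \<in> carrier_vec k" "a' \<in> carrier_vec (k + 1)" "a \<in> carrier_vec k" "t \<in> carrier_vec 1"
    by (auto simp: a_def b_def a'_def t_def)
  have "a @\<^sub>v t = a'" unfolding a_def t_def by (rule vec_first_last_append[OF c(2)])
  moreover have "a' @\<^sub>v b = v" unfolding a'_def b_def by (rule vec_first_last_append[OF v(1)])
  ultimately have vs: "v = (a @\<^sub>v t) @\<^sub>v b" by simp
  have Ua: "U *\<^sub>v a \<in> carrier_vec n" and Wb: "W *\<^sub>v b \<in> carrier_vec n"
    by (rule mult_mat_vec_carrier[OF Uc c(3)], rule mult_mat_vec_carrier[OF Wc c(1)])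
  have at: "a @\<^sub>v t \<in> carrier_vec (k + 1)" by (rule append_carrier_vec[OF c(3,4)])
  define y where "y = (t $ 0) \<cdot>\<^sub>v x + U *\<^sub>v a"
  have y: "y \<in> carrier_vec n" unfolding y_def using x Ua by simp
  have "M *\<^sub>v v = (U *\<^sub>v a + (t $ 0) \<cdot>\<^sub>v x) + W *\<^sub>v b"
    unfolding vs M_def hcat_mult_vec[OF Xc Wc at c(1)] hcat_mult_vec[OF Uc xc c(3,4)] colmat_mult_vec[OF x c(4)] ..
  also have "U *\<^sub>v a + (t $ 0) \<cdot>\<^sub>v x = y" unfolding y_def using x by (intro comm_add_vec[OF Ua]) simp
  finally have yb: "y + W *\<^sub>v b = 0\<^sub>v n" using Mv by simp
  have y_eq: "y = (- 1) \<cdot>\<^sub>v (W *\<^sub>v b)"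
  proof (rule eq_vecI)
    fix i assume "i < dim_vec ((- 1) \<cdot>\<^sub>v (W *\<^sub>v b))"
    then have i: "i < n" using Wc by simp
    have "(y + W *\<^sub>v b) $ i = 0" unfolding yb using i by simp
    then show "y $ i = ((- 1) \<cdot>\<^sub>v (W *\<^sub>v b)) $ i" using i y Wc
      by (simp add: eq_neg_iff_add_eq_0 del: index_mult_mat_vec)
  qed (use y Wc in simp)
  have "(U *\<^sub>v a) \<bullet>c 0\<^sub>v n = 0" using Ua by (simp add: cdot_sum[of _ n])
  moreover have "0\<^sub>v n \<bullet>c x = 0" using x by (simp add: cdot_sum[of _ n])
  ultimately have "qf H y = qf H (U *\<^sub>v a)"
    unfolding y_def using qf_add_radical[OF H(1) x zero_carrier_vec _ Hx _ Ua, of 0] Hx H(2) by simp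
  then have h1: "Re (exp (\<i> * of_real \<xi>) * qf A y) = Re (exp (\<i> * of_real \<xi>) * qf A (U *\<^sub>v a))"
    unfolding qH[OF y] qH[OF Ua] of_real_eq_iff by simp
  have h2: "Re (exp (\<i> * of_real \<xi>) * qf A y) = Re (exp (\<i> * of_real \<xi>) * qf A (W *\<^sub>v b))"
    unfolding y_eq qf_smult[OF A Wb] by simp
  have q0: "qf A (0\<^sub>v n) = 0" unfolding qf_def using mult_zero_vec[OF A] by (simp add: scalar_prod_def)
  have a0: "a = 0\<^sub>v k"
  proof (rule ccontr)
    assume "a \<noteq> 0\<^sub>v k"
    from Up[OF c(3) this] have p: "0 < Re (exp (\<i> * of_real \<xi>) * qf A (W *\<^sub>v b))" using h1 h2 by simp
    show False
    proof (cases "b = 0\<^sub>v k")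
      case True
      then show ?thesis using p q0 mult_zero_vec[OF Wc] by simp
    next
      case False
      then show ?thesis using p Wp[OF c(1)] by simp
    qed
  qed
  then have "Re (exp (\<i> * of_real \<xi>) * qf A (W *\<^sub>v b)) = 0" using h1 h2 q0 mult_zero_vec[OF Uc] by simp
  then have b0: "b = 0\<^sub>v k" using Wp[OF c(1)] by fastforce
  have t0: "t $ 0 \<noteq> 0"
  proof
    assume "t $ 0 = 0"
    then have "t = 0\<^sub>v 1" using c(4) by (intro eq_vecI) auto
    then have "v = 0\<^sub>v (k + 1 + k)" unfolding vs a0 b0 by (intro eq_vecI) auto
    then show False using v(2) by blast
  qed
  have y0: "y = 0\<^sub>v n" unfolding y_eq b0 mult_zero_vec[OF Wc] by (intro eq_vecI) auto
  have "(t $ 0) \<cdot>\<^sub>v x = y" unfolding y_def a0 mult_zero_vec[OF Uc] using x by (metis right_zero_vec smult_carrier_vec)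
  then have "(t $ 0) \<cdot>\<^sub>v x = 0\<^sub>v n" using y0 by simp
  show ?thesis
  proof (rule eq_vecI)
    fix i assume "i < dim_vec (0\<^sub>v n :: complex vec)"
    then have i: "i < n" by simp
    then have "((t $ 0) \<cdot>\<^sub>v x) $ i = 0" using \<open>(t $ 0) \<cdot>\<^sub>v x = 0\<^sub>v n\<close> by simp
    then show "x $ i = 0\<^sub>v n $ i" using i x t0 by simp
  qed (use x in simp)
qed

text \<open>For invertible \<open>A\<close>, an eigenvector of the inverse of \<open>A\<close> times
  its adjoint serves, with \<open>p = A x\<close>. Two separate coefficients are kept so that a
  singular \<open>A\<close> fits as well, with \<open>\<alpha> = 0\<close>.\<close>

lemma pencil_eigenvector:
  fixes A :: "complex mat"
  assumes A: "A \<in> carrier_mat n n" and n: "0 < n"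
  shows "\<exists>x p \<alpha> \<beta>. x \<in> carrier_vec n \<and> x \<noteq> 0\<^sub>v n \<and> p \<in> carrier_vec n \<and>
    A *\<^sub>v x = \<alpha> \<cdot>\<^sub>v p \<and> mat_adjoint A *\<^sub>v x = \<beta> \<cdot>\<^sub>v p \<and> (\<alpha> \<noteq> 0 \<or> \<beta> \<noteq> 0)"
proof (cases "det A = 0")
  case True
  then obtain x where x: "x \<in> carrier_vec n" "x \<noteq> 0\<^sub>v n" "A *\<^sub>v x = 0\<^sub>v n"
    using det_0_iff_vec_prod_zero[OF A] by blast
  have B: "mat_adjoint A *\<^sub>v x \<in> carrier_vec n" by (rule mult_mat_vec_carrier[OF adjoint_carrier[OF A] x(1)])
  have "A *\<^sub>v x = 0 \<cdot>\<^sub>v (mat_adjoint A *\<^sub>v x)" unfolding x(3) using A by (intro eq_vecI) auto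
  moreover have "mat_adjoint A *\<^sub>v x = 1 \<cdot>\<^sub>v (mat_adjoint A *\<^sub>v x)" by simp
  ultimately show ?thesis
    by (intro exI[of _ x] exI[of _ "mat_adjoint A *\<^sub>v x"] exI[of _ 0] exI[of _ 1] conjI x(1,2) B disjI2 one_neq_zero)
next
  case False
  then have "A \<in> Units (ring_mat TYPE(complex) n ())" by (rule det_non_zero_imp_unit[OF A])
  then obtain C where C: "C \<in> carrier_mat n n" "A * C = 1\<^sub>m n"
    unfolding Units_def ring_mat_simps by blast
  obtain x e where x: "x \<in> carrier_vec n" "x \<noteq> 0\<^sub>v n" "C * mat_adjoint A *\<^sub>v x = e \<cdot>\<^sub>v x"
    using eigenvector_exists[OF mult_carrier_mat[OF C(1) adjoint_carrier[OF A]] n] by blast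
  have Ax: "A *\<^sub>v x \<in> carrier_vec n" by (rule mult_mat_vec_carrier[OF A x(1)])
  have B: "mat_adjoint A *\<^sub>v x \<in> carrier_vec n" by (rule mult_mat_vec_carrier[OF adjoint_carrier[OF A] x(1)])
  have "mat_adjoint A *\<^sub>v x = (A * C) *\<^sub>v (mat_adjoint A *\<^sub>v x)" unfolding C(2) using B by simp
  also have "\<dots> = A *\<^sub>v (C *\<^sub>v (mat_adjoint A *\<^sub>v x))" by (rule assoc_mult_mat_vec[OF A C(1) B])
  also have "C *\<^sub>v (mat_adjoint A *\<^sub>v x) = e \<cdot>\<^sub>v x"
    using assoc_mult_mat_vec[OF C(1) adjoint_carrier[OF A] x(1)] x(3) by simp
  also have "A *\<^sub>v (e \<cdot>\<^sub>v x) = e \<cdot>\<^sub>v (A *\<^sub>v x)" by (rule mult_mat_vec[OF A x(1)])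
  finally have "mat_adjoint A *\<^sub>v x = e \<cdot>\<^sub>v (A *\<^sub>v x)" .
  moreover have "A *\<^sub>v x = 1 \<cdot>\<^sub>v (A *\<^sub>v x)" by simp
  ultimately show ?thesis
    by (intro exI[of _ x] exI[of _ "A *\<^sub>v x"] exI[of _ 1] exI[of _ e] conjI x(1,2) Ax disjI1 one_neq_zero)
qed

text \<open>For nonzero \<alpha> the equation reads
  \<open>exp (2 \<i> \<xi>) = - \<beta> / \<alpha>\<close>, and the right-hand side has modulus 1.
  It is used in contraposition: if no rotation cancels, the moduli differ.\<close>

lemma exists_rotation_cancel:
  fixes \<alpha> \<beta> :: complex
  assumes "cmod \<alpha> = cmod \<beta>"
  shows "\<exists>\<xi>. exp (\<i> * of_real \<xi>) * \<alpha> + exp (- \<i> * of_real \<xi>) * \<beta> = 0"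
proof (cases "\<alpha> = 0")
  case True
  then show ?thesis using assms by auto
next
  case False
  define w where "w = - \<beta> / \<alpha>"
  have "cmod w = 1" using assms[symmetric] False by (simp add: w_def norm_divide)
  then obtain \<theta> where \<theta>: "w = exp (\<i> * of_real \<theta>)"
    by (metis cis_conv_exp rcis_def rcis_cmod_Arg mult_1 of_real_1)
  define \<xi> where "\<xi> = \<theta> / 2"
  have "w = exp (\<i> * of_real \<xi>) * exp (\<i> * of_real \<xi>)"
    unfolding \<theta> \<xi>_def exp_i_add[symmetric] by simp
  then have "exp (- \<i> * of_real \<xi>) * w = exp (\<i> * of_real \<xi>)" by (simp add: exp_add[symmetric])
  then have "exp (- \<i> * of_real \<xi>) * (- \<beta>) = exp (\<i> * of_real \<xi>) * \<alpha>"
    using False unfolding w_def by (simp add: field_simps)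
  then have "exp (\<i> * of_real \<xi>) * \<alpha> = - (exp (- \<i> * of_real \<xi>) * \<beta>)"
    by (simp only: mult_minus_right)
  then show ?thesis by (intro exI[of _ \<xi>]) (simp only: left_minus)
qed

text \<open>The point to check is that \<open>p\<close> is orthogonal to \<open>x\<close>. The value
  \<open>qf A x\<close> and its conjugate are \<alpha> and \<beta> times the same number
  \<open>p \<bullet>c x\<close>; they have equal modulus, whereas \<alpha> and \<beta> do not. No
  angle is exceptional, so constant sequences suffice for
  \<open>isotropic_reduction\<close>.\<close>

lemma isotropic_nonsingular:
  assumes IH: "\<And>m k B. m < n \<Longrightarrow> B \<in> carrier_mat m m \<Longrightarrow> (\<forall>\<xi>. nonneg_frame m k B \<xi>) \<Longrightarrow> isotropic m k B"
    and A: "A \<in> carrier_mat n n" and k: "1 \<le> k" "k \<le> n" "n \<le> 2 * k" and pos: "\<And>\<xi>. 0 < lam k A \<xi>"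
  shows "isotropic n k A"
proof -
  obtain k' where k': "k = Suc k'" using k(1) by (cases k) auto
  have "0 < n" using k by simp
  obtain x p \<alpha> \<beta> where x: "x \<in> carrier_vec n" "x \<noteq> 0\<^sub>v n" and p: "p \<in> carrier_vec n"
    and Ax: "A *\<^sub>v x = \<alpha> \<cdot>\<^sub>v p" and Ax': "mat_adjoint A *\<^sub>v x = \<beta> \<cdot>\<^sub>v p" and ab: "\<alpha> \<noteq> 0 \<or> \<beta> \<noteq> 0"
    using pencil_eigenvector[OF A \<open>0 < n\<close>] by blast
  have c: "exp (\<i> * of_real \<xi>) * \<alpha> + exp (- \<i> * of_real \<xi>) * \<beta> \<noteq> 0" for \<xi>
  proof
    assume z: "exp (\<i> * of_real \<xi>) * \<alpha> + exp (- \<i> * of_real \<xi>) * \<beta> = 0"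
    have "rot \<xi> A *\<^sub>v x = (exp (\<i> * of_real \<xi>) * \<alpha> + exp (- \<i> * of_real \<xi>) * \<beta>) \<cdot>\<^sub>v p"
      unfolding rot_mult_vec[OF A x(1)] Ax Ax' smult_smult_assoc add_smult_distrib_vec ..
    then have "rot \<xi> A *\<^sub>v x = 0\<^sub>v n" unfolding z using p by (intro eq_vecI) auto
    then show False using rot_nonsingular[OF A k pos x(1)] x(2) by blast
  qed
  have "qf A x = \<alpha> * (p \<bullet>c x)" unfolding qf_def Ax by (rule cdot_smult(1)[OF p x(1)])
  moreover have "qf (mat_adjoint A) x = \<beta> * (p \<bullet>c x)"
    unfolding qf_def Ax' by (rule cdot_smult(1)[OF p x(1)])
  ultimately have "cmod \<alpha> * cmod (p \<bullet>c x) = cmod \<beta> * cmod (p \<bullet>c x)" 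
    using qf_adjoint[OF A x(1)] by (metis complex_mod_cnj norm_mult)
  moreover have "cmod \<alpha> \<noteq> cmod \<beta>" using exists_rotation_cancel[of \<alpha> \<beta>] c by blast
  ultimately have px: "p \<bullet>c x = 0" by simp
  show ?thesis unfolding k'
  proof (rule isotropic_reduction[OF IH A _ x p px Ax Ax'])
    show "\<forall>\<xi>. nonneg_frame n (Suc k') A \<xi>"
      using pos nonneg_frame_iff[OF A k(1,2)] less_imp_le unfolding k' by blast
    show "\<exists>s. s \<longlonglongrightarrow> \<xi> \<and> (\<forall>j::nat. p = 0\<^sub>v n \<or>
      exp (\<i> * of_real (s j)) * \<alpha> + exp (- \<i> * of_real (s j)) * \<beta> \<noteq> 0)" for \<xi>
      using c tendsto_const[of \<xi> sequentially] by blast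
  qed
qed

section \<open>Scalar shifts and the case of dimension above \<open>2 k\<close>\<close>

lemma diff_smult_one_carrier [simp]:
  "A \<in> carrier_mat n n \<Longrightarrow> A - \<mu> \<cdot>\<^sub>m 1\<^sub>m n \<in> carrier_mat n n"
  by (rule minus_carrier_mat) simp

lemma qf_diff_smult_one:
  assumes A: "A \<in> carrier_mat n n" and x: "x \<in> carrier_vec n"
  shows "qf (A - \<mu> \<cdot>\<^sub>m 1\<^sub>m n) x = qf A x - \<mu> * of_real (sqn x)"
proof -
  have "A - \<mu> \<cdot>\<^sub>m 1\<^sub>m n = A + (- \<mu>) \<cdot>\<^sub>m 1\<^sub>m n" using A by (intro eq_matI) auto
  then show ?thesis
    using qf_add_mat[OF A smult_carrier_mat[OF one_carrier_mat] x] qf_smult_mat[OF one_carrier_mat x] qf_one[OF x]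
    by simp
qed

text \<open>The shift changes the form by a fixed multiple of the squared norm, so on every subspace
  the admissible lower bounds \<open>c\<close> move by the same amount. Comparing all of them gives
  equality.\<close>

lemma lam_diff_smult_one:
  assumes A: "A \<in> carrier_mat n n" and k: "1 \<le> k" "k \<le> n"
  shows "lam k (A - \<mu> \<cdot>\<^sub>m 1\<^sub>m n) \<xi> = lam k A \<xi> - 2 * Re (exp (\<i> * of_real \<xi>) * \<mu>)"
proof -
  let ?e = "exp (\<i> * of_real \<xi>)"
  have re: "2 * Re (?e * qf (A - \<mu> \<cdot>\<^sub>m 1\<^sub>m n) x) = 2 * Re (?e * qf A x) - 2 * Re (?e * \<mu>) * sqn x"
    if "x \<in> carrier_vec n" for x
  proof -
    have "?e * qf (A - \<mu> \<cdot>\<^sub>m 1\<^sub>m n) x = ?e * qf A x - of_real (sqn x) * (?e * \<mu>)"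
      unfolding qf_diff_smult_one[OF A that] by (simp add: algebra_simps)
    moreover have "Re (of_real r * w) = r * Re w" for r w by simp
    ultimately show ?thesis by (simp only: minus_complex.sel) (simp add: algebra_simps)
  qed
  have "c \<le> lam k (A - \<mu> \<cdot>\<^sub>m 1\<^sub>m n) \<xi> \<longleftrightarrow> c + 2 * Re (?e * \<mu>) \<le> lam k A \<xi>" for c
  proof -
    have "c * sqn (U *\<^sub>v v) \<le> 2 * Re (?e * qf (A - \<mu> \<cdot>\<^sub>m 1\<^sub>m n) (U *\<^sub>v v))
      \<longleftrightarrow> (c + 2 * Re (?e * \<mu>)) * sqn (U *\<^sub>v v) \<le> 2 * Re (?e * qf A (U *\<^sub>v v))"
      if "frame n k U" "v \<in> carrier_vec k" for U v
      unfolding re[OF mult_mat_vec_carrier[OF frameD(1)[OF that(1)] that(2)]] distrib_right by linarith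
    then show ?thesis
      unfolding le_lam_iff[OF A k] le_lam_iff[OF diff_smult_one_carrier[OF A] k] by (simp cong: conj_cong)
  qed
  from this[of "lam k (A - \<mu> \<cdot>\<^sub>m 1\<^sub>m n) \<xi>"] this[of "lam k A \<xi> - 2 * Re (?e * \<mu>)"]
  show ?thesis by linarith
qed

text \<open>\<open>Omega_set\<close> uses angles in \<open>[0, 2 pi)\<close> only, while the
  induction, with its half turns and limits, needs all real ones.\<close>

lemma angle_reduce:
  obtains \<eta> where "\<eta> \<in> {0..<2*pi}" "exp (\<i> * of_real \<eta>) = exp (\<i> * of_real \<xi>)"
proof -
  have "(cos \<xi>)\<^sup>2 + (sin \<xi>)\<^sup>2 = 1" by simp
  then obtain t where "0 \<le> t" "t < 2 * pi" "cos \<xi> = cos t" "sin \<xi> = sin t"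
    using sincos_total_2pi by metis
  then show ?thesis using that[of t] unfolding exp_i by simp
qed

lemma lam_cong:
  assumes "exp (\<i> * of_real \<eta>) = exp (\<i> * of_real \<xi>)"
  shows "lam k A \<eta> = lam k A \<xi>"
proof -
  have "exp (- \<i> * of_real \<eta>) = exp (- \<i> * of_real \<xi>)"
    using assms by (simp only: cnj_exp_i(1)[symmetric])
  then show ?thesis using assms by (simp only: lam_def rot_def)
qed

text \<open>Moving \<open>A\<close> along \<open>A - t I\<close>, \<open>t \<ge> 0\<close>, one first meets the boundary of the region
  described by the eigenvalue condition.\<close>

lemma exists_touching:
  assumes A: "A \<in> carrier_mat n n" and k: "1 \<le> k" "k \<le> n" and pos: "\<And>\<xi>. 0 < lam k A \<xi>"
  shows "\<exists>t>0. (\<forall>\<xi>. 2 * t * cos \<xi> \<le> lam k A \<xi>) \<and> (\<exists>\<xi>. lam k A \<xi> = 2 * t * cos \<xi>)"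
proof -
  \<comment> \<open>By \<open>lam_diff_smult_one\<close>, \<open>T\<close> consists of those
    \<open>t\<close> for which \<open>A - t I\<close> still satisfies the eigenvalue condition. The
    touching value will be its supremum.\<close>
  define T where "T = {t. \<forall>\<xi>. 2 * t * cos \<xi> \<le> lam k A \<xi>}"
  \<comment> \<open>Compactness of \<open>[0, 2 pi]\<close> and periodicity make strict inequality
    uniform; this leaves room for increasing \<open>t\<close>.\<close>
  have inf: "\<exists>d>0. \<forall>\<xi>. d \<le> lam k A \<xi> - 2 * t * cos \<xi>" if "\<And>\<xi>. 2 * t * cos \<xi> < lam k A \<xi>" for t
  proof -
    have "\<exists>M. (\<forall>x. 0 \<le> x \<and> x \<le> 2 * pi \<longrightarrow> M \<le> lam k A x - 2 * t * cos x) \<and>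
        (\<exists>x. 0 \<le> x \<and> x \<le> 2 * pi \<and> lam k A x - 2 * t * cos x = M)"
      using isCont_eq_Lb[of 0 "2 * pi" "\<lambda>x. lam k A x - 2 * t * cos x"] isCont_lam[OF A k]
      by (auto intro!: continuous_intros)
    then obtain M x where M: "\<And>x. 0 \<le> x \<and> x \<le> 2 * pi \<Longrightarrow> M \<le> lam k A x - 2 * t * cos x" "lam k A x - 2 * t * cos x = M"
      by blast
    have "M \<le> lam k A \<xi> - 2 * t * cos \<xi>" for \<xi>
    proof -
      obtain \<eta> where \<eta>: "\<eta> \<in> {0..<2*pi}" "exp (\<i> * of_real \<eta>) = exp (\<i> * of_real \<xi>)" by (rule angle_reduce)
      have "cos \<eta> = cos \<xi>" using \<eta>(2) unfolding exp_i by simp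
      then show ?thesis using M(1)[of \<eta>] \<eta>(1) lam_cong[OF \<eta>(2)] by simp
    qed
    moreover have "M > 0" using M(2) that[of x] by simp
    ultimately show ?thesis by blast
  qed
  have step: "\<exists>e>0. t + e \<in> T" if t: "\<And>\<xi>. 2 * t * cos \<xi> < lam k A \<xi>" for t
  proof -
    obtain d where d: "d > 0" "\<And>\<xi>. d \<le> lam k A \<xi> - 2 * t * cos \<xi>" using inf[OF t] by blast
    have "2 * (t + d / 2) * cos \<xi> \<le> lam k A \<xi>" for \<xi>
    proof -
      have "d * cos \<xi> \<le> d * 1" using d(1) by (intro mult_left_mono) auto
      then show ?thesis using d(2)[of \<xi>] by (simp add: algebra_simps)
    qed
    then show ?thesis using d(1) unfolding T_def by (intro exI[of _ "d / 2"]) auto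
  qed
  have bdd: "t \<le> lam k A 0 / 2" if "t \<in> T" for t using that unfolding T_def by (auto dest: spec[of _ 0])
  then have bdd': "bdd_above T" by (rule bdd_aboveI)
  obtain e where e: "e > 0" "0 + e \<in> T" using step[of 0] pos by auto
  define t where "t = Sup T"
  have et: "e \<le> t" unfolding t_def using e(2) bdd' by (intro cSup_upper) auto
  \<comment> \<open>The constraint limits \<open>t\<close> from above only where the cosine is
    positive. Elsewhere it holds because \<open>t\<close> and \<open>lam\<close> are
    positive.\<close>
  have le: "2 * t * cos \<xi> \<le> lam k A \<xi>" for \<xi>
  proof (cases "cos \<xi> > 0")
    case True
    have "t \<le> lam k A \<xi> / (2 * cos \<xi>)" unfolding t_def
    proof (rule cSup_least)
      fix s assume "s \<in> T"
      then have "2 * s * cos \<xi> \<le> lam k A \<xi>" unfolding T_def by blast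
      then show "s \<le> lam k A \<xi> / (2 * cos \<xi>)" using True by (simp add: field_simps)
    qed (use e in auto)
    then show ?thesis using True by (simp add: field_simps)
  next
    case False
    then have "2 * t * cos \<xi> \<le> 0" using e(1) et by (intro mult_nonneg_nonpos) auto
    then show ?thesis using pos[of \<xi>] by linarith
  qed
  have "\<exists>\<xi>. lam k A \<xi> = 2 * t * cos \<xi>"
  proof (rule ccontr)
    assume "\<not> ?thesis"
    then have "2 * t * cos \<xi> < lam k A \<xi>" for \<xi> using le[of \<xi>] by (metis less_eq_real_def)
    then obtain e' where e': "e' > 0" "t + e' \<in> T" using step by blast
    have "t + e' \<le> t" unfolding t_def using e'(2) bdd' by (intro cSup_upper) (auto simp: t_def)
    then show False using e'(1) by simp
  qed
  then show ?thesis using le e(1) et by (intro exI[of _ t]) auto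
qed

text \<open>The touching shift brings \<open>A - t I\<close> into the boundary case in the same
  dimension \<open>n\<close>, and an isotropic subspace of the shifted matrix is what is wanted for
  \<open>A\<close>.\<close>

lemma positive_multiple_frame:
  assumes IH: "\<And>m k B. m < n \<Longrightarrow> B \<in> carrier_mat m m \<Longrightarrow> (\<forall>\<xi>. nonneg_frame m k B \<xi>) \<Longrightarrow> isotropic m k B"
    and A: "A \<in> carrier_mat n n" and k: "1 \<le> k" "k \<le> n" and pos: "\<And>\<xi>. 0 < lam k A \<xi>"
  shows "\<exists>t>0. \<exists>S. frame n k S \<and> (\<forall>v\<in>carrier_vec k. qf A (S *\<^sub>v v) = of_real t * of_real (sqn (S *\<^sub>v v)))"
proof -
  obtain t \<xi>0 where t: "t > 0" "\<And>\<xi>. 2 * t * cos \<xi> \<le> lam k A \<xi>" "lam k A \<xi>0 = 2 * t * cos \<xi>0"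
    using exists_touching[OF A k pos] by blast
  define B where "B = A - of_real t \<cdot>\<^sub>m 1\<^sub>m n"
  have B: "B \<in> carrier_mat n n" unfolding B_def using A by simp
  have "Re (exp (\<i> * of_real \<xi>) * of_real t) = t * cos \<xi>" for \<xi> unfolding exp_i by simp
  then have lamB: "lam k B \<xi> = lam k A \<xi> - 2 * t * cos \<xi>" for \<xi>
    unfolding B_def lam_diff_smult_one[OF A k] by simp
  have "\<forall>\<xi>. nonneg_frame n k B \<xi>" unfolding nonneg_frame_iff[OF B k] lamB using t(2) by simp
  moreover have "lam k B \<xi>0 = 0" unfolding lamB using t(3) by simp
  ultimately have "isotropic n k B" using isotropic_boundary[OF IH B k] by blast
  then obtain S where S: "frame n k S" "\<And>v. v \<in> carrier_vec k \<Longrightarrow> qf B (S *\<^sub>v v) = 0"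
    unfolding isotropic_def by blast
  have "qf A (S *\<^sub>v v) = of_real t * of_real (sqn (S *\<^sub>v v))" if v: "v \<in> carrier_vec k" for v
    using S(2)[OF v] unfolding B_def qf_diff_smult_one[OF A mult_mat_vec_carrier[OF frameD(1)[OF S(1)] v]] by simp
  then show ?thesis using t(1) S(1) by blast
qed

text \<open>A change of sign is a half turn: \<open>- A\<close> at \<xi> has the same form as
  \<open>A\<close> at \<open>\<xi> + pi\<close>.\<close>

lemma lam_uminus_pos:
  assumes A: "A \<in> carrier_mat n n" and k: "1 \<le> k" "k \<le> n" and pos: "\<And>\<xi>. 0 < lam k A \<xi>"
  shows "0 < lam k ((-1) \<cdot>\<^sub>m A) \<xi>"
proof -
  have B: "(-1) \<cdot>\<^sub>m A \<in> carrier_mat n n" using A by simp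
  have "exp (\<i> * of_real (\<xi> + pi)) = - exp (\<i> * of_real \<xi>)" unfolding exp_i by (simp add: complex_eq_iff)
  then have "exp (\<i> * of_real \<xi>) * qf ((-1) \<cdot>\<^sub>m A) x = exp (\<i> * of_real (\<xi> + pi)) * qf A x" if "x \<in> carrier_vec n" for x
    unfolding qf_smult_mat[OF A that] by simp
  then have "c \<le> lam k ((-1) \<cdot>\<^sub>m A) \<xi> \<longleftrightarrow> c \<le> lam k A (\<xi> + pi)" for c
    unfolding le_lam_iff[OF A k] le_lam_iff[OF B k]
    using mult_mat_vec_carrier[OF frameD(1)] by (metis (no_types, lifting))
  then show ?thesis using pos[of "\<xi> + pi"] by (metis less_le_trans order_refl)
qed

lemma isotropic_interior:
  assumes IH: "\<And>m k B. m < n \<Longrightarrow> B \<in> carrier_mat m m \<Longrightarrow> (\<forall>\<xi>. nonneg_frame m k B \<xi>) \<Longrightarrow> isotropic m k B"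
    and A: "A \<in> carrier_mat n n" and k: "1 \<le> k" "2 * k < n" and pos: "\<And>\<xi>. 0 < lam k A \<xi>"
  shows "isotropic n k A"
proof -
  have kn: "k \<le> n" using k by simp
  obtain t S where t: "t > 0" and S: "frame n k S"
    and qS: "\<And>v. v \<in> carrier_vec k \<Longrightarrow> qf A (S *\<^sub>v v) = of_real t * of_real (sqn (S *\<^sub>v v))"
    using positive_multiple_frame[OF IH A k(1) kn pos] by blast
  have mA: "(-1) \<cdot>\<^sub>m A \<in> carrier_mat n n" using A by simp
  obtain r R where r: "r > 0" and R: "frame n k R"
    and qR': "\<And>v. v \<in> carrier_vec k \<Longrightarrow> qf ((-1) \<cdot>\<^sub>m A) (R *\<^sub>v v) = of_real r * of_real (sqn (R *\<^sub>v v))"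
    using positive_multiple_frame[OF IH mA k(1) kn lam_uminus_pos[OF A k(1) kn pos]] by blast
  note Sc = frameD(1)[OF S] and Rc = frameD(1)[OF R]
  have qR: "qf A (R *\<^sub>v v) = - (of_real r * of_real (sqn (R *\<^sub>v v)))" if v: "v \<in> carrier_vec k" for v
    using qR'[OF v] unfolding qf_smult_mat[OF A mult_mat_vec_carrier[OF Rc v]]
    by (metis mult_minus1 minus_minus)
  define W where "W = hcat S R"
  have Wc: "W \<in> carrier_mat n (k + k)" unfolding W_def by (rule hcat_carrier[OF Sc Rc])
  have Wv: "W *\<^sub>v (v @\<^sub>v w) = S *\<^sub>v v + R *\<^sub>v w" if "v \<in> carrier_vec k" "w \<in> carrier_vec k" for v w
    unfolding W_def by (rule hcat_mult_vec[OF Sc Rc that])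
  \<comment> \<open>At a vector common to both subspaces the form would be nonnegative and
    nonpositive, so the two subspaces meet only in 0.\<close>
  have W: "frame n (k + k) W" unfolding frame_def
  proof (intro conjI ballI impI)
    fix v :: "complex vec" assume v: "v \<in> carrier_vec (k + k)" "W *\<^sub>v v = 0\<^sub>v n"
    define a where "a = vec_first v k"
    define b where "b = vec_last v k"
    have ab: "a \<in> carrier_vec k" "b \<in> carrier_vec k" by (auto simp: a_def b_def)
    have vab: "v = a @\<^sub>v b" unfolding a_def b_def by (rule vec_first_last_append[OF v(1), symmetric])
    have Sa: "S *\<^sub>v a \<in> carrier_vec n" by (rule mult_mat_vec_carrier[OF Sc ab(1)])
    have Rb: "R *\<^sub>v b \<in> carrier_vec n" by (rule mult_mat_vec_carrier[OF Rc ab(2)])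
    have z: "S *\<^sub>v a + R *\<^sub>v b = 0\<^sub>v n" using v(2) unfolding vab Wv[OF ab] .
    have "S *\<^sub>v a = (- 1) \<cdot>\<^sub>v (R *\<^sub>v b)"
    proof (rule eq_vecI)
      fix i assume "i < dim_vec ((- 1) \<cdot>\<^sub>v (R *\<^sub>v b))"
      then have i: "i < n" using Rc by simp
      have "(S *\<^sub>v a + R *\<^sub>v b) $ i = 0" unfolding z using i by simp
      then show "(S *\<^sub>v a) $ i = ((- 1) \<cdot>\<^sub>v (R *\<^sub>v b)) $ i" using i Sc Rc
        by (simp add: eq_neg_iff_add_eq_0 del: index_mult_mat_vec)
    qed (use Sc Rc in simp)
    then have q: "qf A (S *\<^sub>v a) = qf A (R *\<^sub>v b)" using qf_smult[OF A Rb, of "- 1"] by simp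
    then have "complex_of_real (t * sqn (S *\<^sub>v a) + r * sqn (R *\<^sub>v b)) = 0" unfolding qS[OF ab(1)] qR[OF ab(2)] by simp
    then have "t * sqn (S *\<^sub>v a) + r * sqn (R *\<^sub>v b) = 0" by (simp only: of_real_eq_0_iff)
    moreover have "0 \<le> t * sqn (S *\<^sub>v a)" "0 \<le> r * sqn (R *\<^sub>v b)" using t r by auto
    ultimately have "t * sqn (S *\<^sub>v a) = 0" "r * sqn (R *\<^sub>v b) = 0" by linarith+
    then have "S *\<^sub>v a = 0\<^sub>v n" "R *\<^sub>v b = 0\<^sub>v n" using t r sqn_eq_0[OF Sa] sqn_eq_0[OF Rb] by auto
    then have "a = 0\<^sub>v k" "b = 0\<^sub>v k" using frameD(2)[OF S ab(1)] frameD(2)[OF R ab(2)] by auto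
    then show "v = 0\<^sub>v (k + k)" unfolding vab by (intro eq_vecI) auto
  qed (rule Wc)
  define B where "B = mat_adjoint W * A * W"
  have B: "B \<in> carrier_mat (k + k) (k + k)" unfolding B_def
    by (rule mult_carrier_mat[OF mult_carrier_mat[OF adjoint_carrier[OF Wc] A] Wc])
  have one: "1\<^sub>m k \<in> carrier_mat k k" and zero: "0\<^sub>m k k \<in> carrier_mat k k" by auto
  have app: "(1\<^sub>m k @\<^sub>r 0\<^sub>m k k) *\<^sub>v v = v @\<^sub>v 0\<^sub>v k" "(0\<^sub>m k k @\<^sub>r 1\<^sub>m k) *\<^sub>v v = 0\<^sub>v k @\<^sub>v v"
    if "v \<in> carrier_vec k" for v :: "complex vec"
    unfolding mat_mult_append[OF one zero that] mat_mult_append[OF zero one that] zero_mat_mult_vec[OF that]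
      one_mult_mat_vec[OF that] by auto
  have app_eq: "v = 0\<^sub>v k \<and> w = 0\<^sub>v k" if "v @\<^sub>v w = 0\<^sub>v (k + k)" "v \<in> carrier_vec k" "w \<in> carrier_vec k" for v w :: "complex vec"
  proof -
    have "0\<^sub>v (k + k) = 0\<^sub>v k @\<^sub>v (0\<^sub>v k :: complex vec)" by (intro eq_vecI) auto
    then show ?thesis using that append_vec_eq[OF that(2) zero_carrier_vec] by metis
  qed
  have fr: "frame (k + k) k (1\<^sub>m k @\<^sub>r 0\<^sub>m k k)" "frame (k + k) k (0\<^sub>m k k @\<^sub>r 1\<^sub>m k)"
    unfolding frame_def using app app_eq carrier_append_rows[OF one zero] carrier_append_rows[OF zero one]
    by (metis zero_carrier_vec)+
  \<comment> \<open>The form at \<xi> is a nonnegative multiple of \<open>cos \<xi>\<close> on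
    \<open>S\<close> and of \<open>- cos \<xi>\<close> on \<open>R\<close>. The two block matrices
    select these subspaces in the coordinates of \<open>W\<close>.\<close>
  have "nonneg_frame (k + k) k B \<xi>" for \<xi>
  proof (cases "0 \<le> cos \<xi>")
    case True
    have "0 \<le> Re (exp (\<i> * of_real \<xi>) * qf B ((1\<^sub>m k @\<^sub>r 0\<^sub>m k k) *\<^sub>v v))" if v: "v \<in> carrier_vec k" for v
    proof -
      have Sv: "S *\<^sub>v v \<in> carrier_vec n" by (rule mult_mat_vec_carrier[OF Sc v])
      have "v @\<^sub>v 0\<^sub>v k \<in> carrier_vec (k + k)" by (rule append_carrier_vec[OF v zero_carrier_vec])
      then have "qf B ((1\<^sub>m k @\<^sub>r 0\<^sub>m k k) *\<^sub>v v) = qf A (W *\<^sub>v (v @\<^sub>v 0\<^sub>v k))"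
        unfolding B_def app(1)[OF v] by (rule qf_congruence[OF A Wc])
      also have "W *\<^sub>v (v @\<^sub>v 0\<^sub>v k) = S *\<^sub>v v"
        unfolding Wv[OF v zero_carrier_vec] mult_zero_vec[OF Rc] by (rule right_zero_vec[OF Sv])
      finally show ?thesis unfolding qS[OF v] exp_i using True t by simp
    qed
    then show ?thesis unfolding nonneg_frame_def using fr(1) by blast
  next
    case False
    have "0 \<le> Re (exp (\<i> * of_real \<xi>) * qf B ((0\<^sub>m k k @\<^sub>r 1\<^sub>m k) *\<^sub>v v))" if v: "v \<in> carrier_vec k" for v
    proof -
      have Rv: "R *\<^sub>v v \<in> carrier_vec n" by (rule mult_mat_vec_carrier[OF Rc v])
      have "0\<^sub>v k @\<^sub>v v \<in> carrier_vec (k + k)" by (rule append_carrier_vec[OF zero_carrier_vec v])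
      then have "qf B ((0\<^sub>m k k @\<^sub>r 1\<^sub>m k) *\<^sub>v v) = qf A (W *\<^sub>v (0\<^sub>v k @\<^sub>v v))"
        unfolding B_def app(2)[OF v] by (rule qf_congruence[OF A Wc])
      also have "W *\<^sub>v (0\<^sub>v k @\<^sub>v v) = R *\<^sub>v v"
        unfolding Wv[OF zero_carrier_vec v] mult_zero_vec[OF Sc] by (rule left_zero_vec[OF Rv])
      finally show ?thesis unfolding qR[OF v] exp_i using False r by (simp add: mult_nonpos_nonneg)
    qed
    then show ?thesis unfolding nonneg_frame_def using fr(2) by blast
  qed
  moreover have "k + k < n" using k by simp
  ultimately have "isotropic (k + k) k B" using IH[OF _ B] by blast
  then obtain T where T: "frame (k + k) k T" "\<And>v. v \<in> carrier_vec k \<Longrightarrow> qf B (T *\<^sub>v v) = 0"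
    unfolding isotropic_def by blast
  note Tc = frameD(1)[OF T(1)]
  have "qf A (W * T *\<^sub>v v) = 0" if v: "v \<in> carrier_vec k" for v
    unfolding assoc_mult_mat_vec[OF Wc Tc v] qf_congruence[OF A Wc mult_mat_vec_carrier[OF Tc v], symmetric]
    using T(2)[OF v] unfolding B_def .
  then show ?thesis unfolding isotropic_def using frame_mult[OF W T(1)] by blast
qed

section \<open>The induction on the dimension\<close>

lemma isotropic_if_nonneg_frames:
  assumes "A \<in> carrier_mat n n" "\<forall>\<xi>. nonneg_frame n k A \<xi>"
  shows "isotropic n k A"
  using assms
proof (induction n arbitrary: k A rule: less_induct)
  case (less n)
  note A = less.prems(1) and nn = less.prems(2)
  show ?case
  proof (cases "k = 0")
    case True
    then show ?thesis using isotropic_0 by simp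
  next
    case False
    have k: "1 \<le> k" "k \<le> n" using False nn frame_dim_le unfolding nonneg_frame_def by auto
    show ?thesis
    proof (cases "\<exists>\<xi>. lam k A \<xi> = 0")
      case True
      then obtain \<xi>0 where "lam k A \<xi>0 = 0" by blast
      then show ?thesis using isotropic_boundary[OF less.IH A k nn] by blast
    next
      case False
      then have pos: "\<And>\<xi>. 0 < lam k A \<xi>" using nn nonneg_frame_iff[OF A k] by (metis less_eq_real_def)
      show ?thesis
      proof (cases "n \<le> 2 * k")
        case True
        show ?thesis by (rule isotropic_nonsingular[OF less.IH A k True pos])
      next
        case False
        then have "2 * k < n" by simp
        from isotropic_interior[OF less.IH A k(1) this pos] show ?thesis .
      qed
    qed
  qed
qed

section \<open>Projections and the numerical range\<close>

text \<open>The Gram matrix \<open>G\<close> is positive definite; its eigenvectors, scaled by the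
  inverse square roots of the eigenvalues, have orthonormal images under \<open>S\<close>. Keeping
  the factor \<open>T\<close> explicit records that the range of \<open>S\<close> is not
  left.\<close>

lemma orthonormalize_frame:
  assumes S: "frame n k S"
  shows "\<exists>T\<in>carrier_mat k k. isom n k (S * T)"
proof -
  note Sc = frameD(1)[OF S]
  define G where "G = mat_adjoint S * S"
  have G: "G \<in> carrier_mat k k" unfolding G_def by (rule mult_carrier_mat[OF adjoint_carrier[OF Sc] Sc])
  have G': "mat_adjoint G = G"
    unfolding G_def adjoint_mult[OF adjoint_carrier[OF Sc] Sc] adjoint_adjoint[OF Sc] ..
  obtain P where P: "isom k k P" and ev: "\<forall>j<k. G *\<^sub>v col P j = of_real (eigval_list G ! j) \<cdot>\<^sub>v col P j"
    using spectral_theorem[OF G G'] by blast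
  note Pc = isomD(1)[OF P]
  have SS: "(S *\<^sub>v x) \<bullet>c (S *\<^sub>v y) = (G *\<^sub>v x) \<bullet>c y" if x: "x \<in> carrier_vec k" and y: "y \<in> carrier_vec k" for x y
  proof -
    have Sx: "S *\<^sub>v x \<in> carrier_vec n" by (rule mult_mat_vec_carrier[OF Sc x])
    have "(mat_adjoint S *\<^sub>v (S *\<^sub>v x)) \<bullet>c y = (S *\<^sub>v x) \<bullet>c (S *\<^sub>v y)"
      using cdot_adjoint[OF adjoint_carrier[OF Sc] Sx y] unfolding adjoint_adjoint[OF Sc] .
    then show ?thesis unfolding G_def assoc_mult_mat_vec[OF adjoint_carrier[OF Sc] Sc x] ..
  qed
  define d where "d j = eigval_list G ! j" for j
  have p: "col P j \<in> carrier_vec k" if "j < k" for j using Pc that by auto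
  have SP: "(S *\<^sub>v col P j) \<bullet>c (S *\<^sub>v col P i) = (if i = j then of_real (d j) else 0)" if "i < k" "j < k" for i j
  proof -
    have "G *\<^sub>v col P j = of_real (d j) \<cdot>\<^sub>v col P j" using ev that(2) unfolding d_def by blast
    then show ?thesis
      unfolding SS[OF p[OF that(2)] p[OF that(1)]] using isomD(3)[OF P that]
        cdot_smult(1)[OF p[OF that(2)] p[OF that(1)]] by simp
  qed
  have dpos: "0 < d j" if j: "j < k" for j
  proof -
    have "col P j \<noteq> 0\<^sub>v k"
    proof
      assume "col P j = 0\<^sub>v k"
      then have "sqn (col P j) = 0" using sqn_eq_0[OF p[OF j]] by blast
      then show False using isomD(3)[OF P j j] by (simp add: cdot_self)
    qed
    then have "S *\<^sub>v col P j \<noteq> 0\<^sub>v n" using frameD(2)[OF S p[OF j]] by blast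
    then have "sqn (S *\<^sub>v col P j) \<noteq> 0" using sqn_eq_0[OF mult_mat_vec_carrier[OF Sc p[OF j]]] by blast
    moreover have "complex_of_real (sqn (S *\<^sub>v col P j)) = of_real (d j)" using SP[OF j j] by (simp add: cdot_self)
    then have "sqn (S *\<^sub>v col P j) = d j" by (simp only: of_real_eq_iff)
    ultimately show ?thesis using sqn_nonneg[of "S *\<^sub>v col P j"] by linarith
  qed
  define c where "c j = complex_of_real (1 / sqrt (d j))" for j
  define T where "T = P * mat_diag k c"
  have T: "T \<in> carrier_mat k k" unfolding T_def by (rule mult_carrier_mat[OF Pc mat_diag_dim])
  have colT: "col T j = c j \<cdot>\<^sub>v col P j" if j: "j < k" for j
    unfolding T_def mat_diag_mult_right[OF Pc] using j Pc by (intro eq_vecI) auto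
  have "isom n k (S * T)" unfolding isom_iff
  proof (intro conjI allI impI)
    show "S * T \<in> carrier_mat n k" by (rule mult_carrier_mat[OF Sc T])
    fix i j assume ij: "i < k" "j < k"
    have col: "col (S * T) j = c j \<cdot>\<^sub>v (S *\<^sub>v col P j)" if "j < k" for j
      unfolding col_mult2[OF Sc T that] colT[OF that] by (rule mult_mat_vec[OF Sc p[OF that]])
    have Sp: "S *\<^sub>v col P j \<in> carrier_vec n" if "j < k" for j by (rule mult_mat_vec_carrier[OF Sc p[OF that]])
    have Spc: "c i \<cdot>\<^sub>v (S *\<^sub>v col P i) \<in> carrier_vec n" using Sp[OF ij(1)] by simp
    have "col (S * T) j \<bullet>c col (S * T) i = c j * (cnj (c i) * (if i = j then of_real (d j) else 0))"
      unfolding col[OF ij(1)] col[OF ij(2)] cdot_smult(1)[OF Sp[OF ij(2)] Spc]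
        cdot_smult(2)[OF Sp[OF ij(2)] Sp[OF ij(1)]] SP[OF ij] ..
    also have "\<dots> = (if i = j then 1 else 0)"
    proof (cases "i = j")
      case True
      have "1 / sqrt (d j) * (1 / sqrt (d j) * d j) = 1" using dpos[OF ij(2)] by (simp add: real_div_sqrt)
      then have "c j * (cnj (c j) * of_real (d j)) = 1"
        unfolding c_def complex_cnj_complex_of_real of_real_mult[symmetric] by simp
      then show ?thesis using True by simp
    qed simp
    finally show "col (S * T) j \<bullet>c col (S * T) i = (if i = j then 1 else 0)" .
  qed
  then show ?thesis using T by blast
qed

text \<open>Polarization over the complex numbers: evaluation at \<open>x + y\<close> shows that the
  two mixed terms sum to 0, evaluation at \<open>x + \<i> y\<close> that they are equal.\<close>

lemma zero_form_zero_mat: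
  assumes M: "M \<in> carrier_mat k k" and q: "\<And>v. v \<in> carrier_vec k \<Longrightarrow> qf M v = 0"
  shows "M = 0\<^sub>m k k"
proof -
  have bil: "(M *\<^sub>v x) \<bullet>c y = 0" if x: "x \<in> carrier_vec k" and y: "y \<in> carrier_vec k" for x y
  proof -
    have Mx: "M *\<^sub>v x \<in> carrier_vec k" and My: "M *\<^sub>v y \<in> carrier_vec k"
      by (rule mult_mat_vec_carrier[OF M x], rule mult_mat_vec_carrier[OF M y])
    have iy: "\<i> \<cdot>\<^sub>v y \<in> carrier_vec k" using y by simp
    have "(M *\<^sub>v x) \<bullet>c y + (M *\<^sub>v y) \<bullet>c x = 0"
      using qf_add[OF M x y] q[OF add_carrier_vec[OF x y]] q[OF x] q[OF y] by simp
    moreover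
    have "- \<i> * ((M *\<^sub>v x) \<bullet>c y) + \<i> * ((M *\<^sub>v y) \<bullet>c x) = 0"
      using qf_add[OF M x iy] q[OF add_carrier_vec[OF x iy]] q[OF x] q[OF iy]
      unfolding mult_mat_vec[OF M y] cdot_smult(1)[OF My x] cdot_smult(2)[OF Mx y] by simp
    then have "\<i> * ((M *\<^sub>v y) \<bullet>c x - (M *\<^sub>v x) \<bullet>c y) = 0" by (simp only: algebra_simps) simp
    then have "(M *\<^sub>v y) \<bullet>c x = (M *\<^sub>v x) \<bullet>c y" by simp
    ultimately show ?thesis by simp
  qed
  show ?thesis
  proof (rule eq_matI)
    fix i j assume "i < dim_row (0\<^sub>m k k :: complex mat)" "j < dim_col (0\<^sub>m k k :: complex mat)"
    then have ij: "i < k" "j < k" by auto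
    have "(M *\<^sub>v unit_vec k j) \<bullet>c unit_vec k i = (\<Sum>l<k. (if l = i then (M *\<^sub>v unit_vec k j) $ l else 0))"
      unfolding cdot_sum[OF mult_mat_vec_carrier[OF M unit_vec_carrier] unit_vec_carrier]
      using ij by (intro sum.cong refl) (auto simp del: index_mult_mat_vec)
    also have "\<dots> = (M *\<^sub>v unit_vec k j) $ i" using ij by (simp del: index_mult_mat_vec)
    also have "\<dots> = M $$ (i, j)" using ij M by simp
    finally show "M $$ (i, j) = 0\<^sub>m k k $$ (i, j)" using bil[of "unit_vec k j" "unit_vec k i"] ij by simp
  qed (use M in auto)
qed

lemma rank_isom:
  assumes V: "isom n k V"
  shows "vec_space.rank n V = k"
proof -
  interpret vec_space "TYPE(complex)" n .
  note Vc = isomD(1)[OF V]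
  have d: "distinct (cols V)"
    unfolding distinct_conv_nth
  proof (intro allI impI)
    fix i j assume ij: "i < length (cols V)" "j < length (cols V)" "i \<noteq> j"
    then have ij': "i < k" "j < k" using Vc by auto
    show "cols V ! i \<noteq> cols V ! j"
    proof
      assume "cols V ! i = cols V ! j"
      then have "col V i = col V j" using ij by simp
      then show False using isomD(3)[OF V ij'] isomD(3)[OF V ij'(2,2)] ij(3) by simp
    qed
  qed
  have "lin_indpt (set (cols V))"
  proof
    assume "lin_dep (set (cols V))"
    then obtain v where v: "v \<in> carrier_vec k" "v \<noteq> 0\<^sub>v k" "V *\<^sub>v v = 0\<^sub>v n"
      using lin_depE[OF Vc _ d] by blast
    then show False using frameD(2)[OF isom_frame[OF V] v(1)] by blast
  qed
  then show ?thesis by (rule lin_indpt_full_rank[OF Vc d])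
qed

lemma rank_cong_col_space:
  fixes A B :: "complex mat"
  assumes A: "A \<in> carrier_mat n a" and B: "B \<in> carrier_mat n b"
    and AB: "\<And>x. x \<in> carrier_vec a \<Longrightarrow> \<exists>y\<in>carrier_vec b. B *\<^sub>v y = A *\<^sub>v x"
    and BA: "\<And>y. y \<in> carrier_vec b \<Longrightarrow> \<exists>x\<in>carrier_vec a. A *\<^sub>v x = B *\<^sub>v y"
  shows "vec_space.rank n A = vec_space.rank n B"
proof -
  interpret vec_space "TYPE(complex)" n .
  have "col_space A = col_space B"
    unfolding col_space_eq[OF A] col_space_eq[OF B] using A B AB BA by auto
  then show ?thesis unfolding rank_def col_space_def by simp
qed

lemma isom_imp_orth_proj:
  assumes V: "isom n k V"
  shows "orth_proj_rank n k (V * mat_adjoint V)"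
proof -
  note Vc = isomD(1)[OF V]
  have Vac: "mat_adjoint V \<in> carrier_mat k n" by (rule adjoint_carrier[OF Vc])
  have Pc: "V * mat_adjoint V \<in> carrier_mat n n" by (rule mult_carrier_mat[OF Vc Vac])
  have "V * mat_adjoint V * (V * mat_adjoint V) = V * (mat_adjoint V * (V * mat_adjoint V))"
    by (rule assoc_mult_mat[OF Vc Vac Pc])
  also have "mat_adjoint V * (V * mat_adjoint V) = mat_adjoint V * V * mat_adjoint V"
    by (rule assoc_mult_mat[OF Vac Vc Vac, symmetric])
  also have "\<dots> = mat_adjoint V" unfolding isomD(2)[OF V] by (rule left_mult_one_mat[OF Vac])
  finally have idem: "V * mat_adjoint V * (V * mat_adjoint V) = V * mat_adjoint V" .
  have adj: "mat_adjoint (V * mat_adjoint V) = V * mat_adjoint V"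
    unfolding adjoint_mult[OF Vc Vac] adjoint_adjoint[OF Vc] ..
  have "vec_space.rank n (V * mat_adjoint V) = vec_space.rank n V"
  proof (rule rank_cong_col_space[OF Pc Vc])
    fix x :: "complex vec" assume x: "x \<in> carrier_vec n"
    show "\<exists>y\<in>carrier_vec k. V *\<^sub>v y = V * mat_adjoint V *\<^sub>v x"
      using assoc_mult_mat_vec[OF Vc Vac x] mult_mat_vec_carrier[OF Vac x] by metis
  next
    fix y :: "complex vec" assume y: "y \<in> carrier_vec k"
    have "V * mat_adjoint V *\<^sub>v (V *\<^sub>v y) = V *\<^sub>v y"
      unfolding assoc_mult_mat_vec[OF Vc Vac mult_mat_vec_carrier[OF Vc y]] isom_adjoint_mult_vec[OF V y] ..
    then show "\<exists>x\<in>carrier_vec n. V * mat_adjoint V *\<^sub>v x = V *\<^sub>v y"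
      using mult_mat_vec_carrier[OF Vc y] by blast
  qed
  then show ?thesis unfolding orth_proj_rank_def using Pc idem adj rank_isom[OF V] by simp
qed

text \<open>Idempotence leaves only the eigenvalues 0 and 1, and in the decreasing list the ones
  come first. The leading eigenvectors thus span the range of \<open>P\<close>, and the rank
  identifies their number with \<open>k\<close>.\<close>

lemma orth_proj_frame:
  assumes "orth_proj_rank n k P"
  shows "\<exists>V. frame n k V \<and> (\<forall>v\<in>carrier_vec k. P *\<^sub>v (V *\<^sub>v v) = V *\<^sub>v v)"
proof -
  have Pc: "P \<in> carrier_mat n n" and PP: "P * P = P" and P': "mat_adjoint P = P" and rk: "vec_space.rank n P = k"
    using assms unfolding orth_proj_rank_def by auto
  define d where "d j = eigval_list P ! j" for j
  obtain Q where Q: "isom n n Q" and ev: "\<forall>j<n. P *\<^sub>v col Q j = of_real (d j) \<cdot>\<^sub>v col Q j"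
    using spectral_theorem[OF Pc P'] unfolding d_def by blast
  note Qc = isomD(1)[OF Q]
  have d01: "d j = 0 \<or> d j = 1" if j: "j < n" for j
  proof -
    have q: "col Q j \<in> carrier_vec n" using Qc j by auto
    have e: "P *\<^sub>v col Q j = of_real (d j) \<cdot>\<^sub>v col Q j" using ev j by blast
    have "P *\<^sub>v col Q j = P *\<^sub>v (P *\<^sub>v col Q j)"
      using assoc_mult_mat_vec[OF Pc Pc q] PP by simp
    also have "\<dots> = of_real (d j) \<cdot>\<^sub>v (of_real (d j) \<cdot>\<^sub>v col Q j)"
      unfolding e mult_mat_vec[OF Pc q] ..
    finally have "(of_real (d j) \<cdot>\<^sub>v col Q j) \<bullet>c col Q j = (of_real (d j) \<cdot>\<^sub>v (of_real (d j) \<cdot>\<^sub>v col Q j)) \<bullet>c col Q j"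
      using e by simp
    then have "complex_of_real (d j) = of_real (d j * d j)"
      using q isomD(3)[OF Q j j] by (simp add: cdot_smult[OF q q] cdot_smult[of _ n])
    then have "d j = d j * d j" by (simp only: of_real_eq_iff)
    then show ?thesis by auto
  qed
  define r where "r = card {j. j < n \<and> d j = 1}"
  have dec: "d j \<le> d i" if "i \<le> j" "j < n" for i j using eigval_list(3)[OF Pc that] unfolding d_def .
  have rn: "r \<le> n" unfolding r_def using card_mono[of "{..<n}" "{j. j < n \<and> d j = 1}"] by auto
  have d1: "d j = 1" if "j < r" for j
  proof (rule ccontr)
    assume "d j \<noteq> 1"
    have "{i. i < n \<and> d i = 1} \<subseteq> {..<j}"
    proof
      fix i assume i: "i \<in> {i. i < n \<and> d i = 1}"
      show "i \<in> {..<j}"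
      proof (rule ccontr)
        assume "i \<notin> {..<j}"
        then have "d i \<le> d j" using i by (intro dec) auto
        then show False using i d01[of j] \<open>d j \<noteq> 1\<close> that rn by auto
      qed
    qed
    from card_mono[OF _ this] show False using that r_def by simp
  qed
  have d0: "d j = 0" if j: "r \<le> j" "j < n" for j
  proof (rule ccontr)
    assume "d j \<noteq> 0"
    then have j1: "d j = 1" using d01 j by blast
    have "{..j} \<subseteq> {i. i < n \<and> d i = 1}"
    proof
      fix i assume "i \<in> {..j}"
      then have i: "i \<le> j" by simp
      then have "1 \<le> d i" using dec[OF i j(2)] j1 by simp
      then show "i \<in> {i. i < n \<and> d i = 1}" using d01[of i] i j(2) by auto
    qed
    from card_mono[OF _ this] show False using j r_def by simp
  qed
  define V where "V = mat n r (\<lambda>(i, j). Q $$ (i, j))"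
  have V: "isom n r V" unfolding V_def by (rule first_columns(1)[OF Q rn])
  have Vv: "V *\<^sub>v v = Q *\<^sub>v (v @\<^sub>v 0\<^sub>v (n - r))" if "v \<in> carrier_vec r" for v
    unfolding V_def by (rule first_columns(2)[OF Q rn that])
  note Vc = isomD(1)[OF V]
  have PQ: "P *\<^sub>v (Q *\<^sub>v s) = V *\<^sub>v vec_first s r" if s: "s \<in> carrier_vec n" for s
  proof -
    have "vec n (\<lambda>i. of_real (d i) * s $ i) = vec_first s r @\<^sub>v 0\<^sub>v (n - r)"
      using d0 d1 rn by (intro eq_vecI) (auto simp: vec_first_def)
    then show ?thesis
      unfolding mult_vec_diagonalized[OF Pc Qc ev s] Vv[OF vec_first_carrier] by simp
  qed
  have PV: "P *\<^sub>v (V *\<^sub>v v) = V *\<^sub>v v" if v: "v \<in> carrier_vec r" for v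
  proof -
    have s: "v @\<^sub>v 0\<^sub>v (n - r) \<in> carrier_vec n" using append_carrier_vec[OF v zero_carrier_vec[of "n - r"]] rn by simp
    have "vec_first (v @\<^sub>v 0\<^sub>v (n - r)) r = v" using v by (intro eq_vecI) (auto simp: vec_first_def)
    then show ?thesis using PQ[OF s] Vv[OF v] by simp
  qed
  have "vec_space.rank n P = vec_space.rank n V"
  proof (rule rank_cong_col_space[OF Pc Vc])
    fix x :: "complex vec" assume x: "x \<in> carrier_vec n"
    have s: "mat_adjoint Q *\<^sub>v x \<in> carrier_vec n" by (rule mult_mat_vec_carrier[OF adjoint_carrier[OF Qc] x])
    have "P *\<^sub>v x = V *\<^sub>v vec_first (mat_adjoint Q *\<^sub>v x) r" using PQ[OF s] unfolding isom_surj[OF Q x] .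
    then show "\<exists>y\<in>carrier_vec r. V *\<^sub>v y = P *\<^sub>v x" using vec_first_carrier by metis
  next
    fix y :: "complex vec" assume y: "y \<in> carrier_vec r"
    show "\<exists>x\<in>carrier_vec n. P *\<^sub>v x = V *\<^sub>v y" using PV[OF y] mult_mat_vec_carrier[OF Vc y] by blast
  qed
  then have "r = k" using rk rank_isom[OF V] by simp
  then show ?thesis using isom_frame[OF V] PV by blast
qed

text \<open>On the range of \<open>P\<close> the form of \<open>A\<close> agrees with that of
  \<open>P A P\<close>, hence with \<mu> times the squared norm. Conversely, let \<open>V\<close> be
  an orthonormal basis of an isotropic subspace of the shifted matrix: by polarization the
  compression of \<open>A\<close> to it is \<mu> times the identity, and
  \<open>V * mat_adjoint V\<close> is the required projection.\<close>

lemma rank_numerical_range_iff: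
  assumes A: "A \<in> carrier_mat n n"
  shows "\<mu> \<in> rank_numerical_range k A \<longleftrightarrow> isotropic n k (A - \<mu> \<cdot>\<^sub>m 1\<^sub>m n)"
proof
  assume "\<mu> \<in> rank_numerical_range k A"
  then obtain P where P: "orth_proj_rank n k P" and PAP: "P * A * P = \<mu> \<cdot>\<^sub>m P"
    using A unfolding rank_numerical_range_def by auto
  have Pc: "P \<in> carrier_mat n n" and P': "mat_adjoint P = P" using P unfolding orth_proj_rank_def by auto
  obtain V where V: "frame n k V" and PV: "\<And>v. v \<in> carrier_vec k \<Longrightarrow> P *\<^sub>v (V *\<^sub>v v) = V *\<^sub>v v"
    using orth_proj_frame[OF P] by blast
  have "qf (A - \<mu> \<cdot>\<^sub>m 1\<^sub>m n) (V *\<^sub>v v) = 0" if v: "v \<in> carrier_vec k" for v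
  proof -
    have y: "V *\<^sub>v v \<in> carrier_vec n" by (rule mult_mat_vec_carrier[OF frameD(1)[OF V] v])
    have "qf A (V *\<^sub>v v) = qf (mat_adjoint P * A * P) (V *\<^sub>v v)"
      unfolding qf_congruence[OF A Pc y] PV[OF v] ..
    also have "\<dots> = \<mu> * qf P (V *\<^sub>v v)" unfolding P' PAP by (rule qf_smult_mat[OF Pc y])
    also have "qf P (V *\<^sub>v v) = of_real (sqn (V *\<^sub>v v))" unfolding qf_def PV[OF v] by (rule cdot_self)
    finally show ?thesis unfolding qf_diff_smult_one[OF A y] by simp
  qed
  then show "isotropic n k (A - \<mu> \<cdot>\<^sub>m 1\<^sub>m n)" unfolding isotropic_def using V by blast
next
  assume "isotropic n k (A - \<mu> \<cdot>\<^sub>m 1\<^sub>m n)"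
  then obtain S where S: "frame n k S" and S0: "\<And>v. v \<in> carrier_vec k \<Longrightarrow> qf (A - \<mu> \<cdot>\<^sub>m 1\<^sub>m n) (S *\<^sub>v v) = 0"
    unfolding isotropic_def by blast
  obtain T where T: "T \<in> carrier_mat k k" and iso: "isom n k (S * T)" using orthonormalize_frame[OF S] by blast
  define V where "V = S * T"
  have V: "isom n k V" unfolding V_def by (rule iso)
  note Vc = isomD(1)[OF V]
  have Vac: "mat_adjoint V \<in> carrier_mat k n" by (rule adjoint_carrier[OF Vc])
  have AV: "mat_adjoint V * A * V \<in> carrier_mat k k" by (rule mult_carrier_mat[OF mult_carrier_mat[OF Vac A] Vc])
  have "mat_adjoint V * A * V - \<mu> \<cdot>\<^sub>m 1\<^sub>m k = 0\<^sub>m k k"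
  proof (rule zero_form_zero_mat)
    show "mat_adjoint V * A * V - \<mu> \<cdot>\<^sub>m 1\<^sub>m k \<in> carrier_mat k k" by (rule diff_smult_one_carrier[OF AV])
    fix v :: "complex vec" assume v: "v \<in> carrier_vec k"
    have Tv: "T *\<^sub>v v \<in> carrier_vec k" by (rule mult_mat_vec_carrier[OF T v])
    have Vv: "V *\<^sub>v v \<in> carrier_vec n" by (rule mult_mat_vec_carrier[OF Vc v])
    have "V *\<^sub>v v = S *\<^sub>v (T *\<^sub>v v)" unfolding V_def by (rule assoc_mult_mat_vec[OF frameD(1)[OF S] T v])
    then have "qf (A - \<mu> \<cdot>\<^sub>m 1\<^sub>m n) (V *\<^sub>v v) = 0" using S0[OF Tv] by simp
    then show "qf (mat_adjoint V * A * V - \<mu> \<cdot>\<^sub>m 1\<^sub>m k) v = 0"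
      unfolding qf_diff_smult_one[OF AV v] qf_diff_smult_one[OF A Vv] qf_congruence[OF A Vc v] isom_sqn[OF V v] .
  qed
  note M0 = this
  have AV_eq: "mat_adjoint V * A * V = \<mu> \<cdot>\<^sub>m 1\<^sub>m k"
  proof (rule eq_matI)
    fix i j assume "i < dim_row (\<mu> \<cdot>\<^sub>m 1\<^sub>m k)" "j < dim_col (\<mu> \<cdot>\<^sub>m 1\<^sub>m k)"
    then have ij: "i < k" "j < k" by auto
    have "(mat_adjoint V * A * V - \<mu> \<cdot>\<^sub>m 1\<^sub>m k) $$ (i, j) = 0" unfolding M0 using ij by simp
    moreover have "(mat_adjoint V * A * V - \<mu> \<cdot>\<^sub>m 1\<^sub>m k) $$ (i, j)
        = (mat_adjoint V * A * V) $$ (i, j) - (\<mu> \<cdot>\<^sub>m 1\<^sub>m k) $$ (i, j)"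
      using ij by (intro index_minus_mat(1)) auto
    ultimately show "(mat_adjoint V * A * V) $$ (i, j) = (\<mu> \<cdot>\<^sub>m 1\<^sub>m k) $$ (i, j)" by simp
  qed (use carrier_matD[OF AV] in auto)
  have VA: "mat_adjoint V * A \<in> carrier_mat k n" by (rule mult_carrier_mat[OF Vac A])
  have "V * mat_adjoint V * A * (V * mat_adjoint V) = V * (mat_adjoint V * A) * V * mat_adjoint V"
    unfolding assoc_mult_mat[OF Vc Vac A] by (rule assoc_mult_mat[OF mult_carrier_mat[OF Vc VA] Vc Vac, symmetric])
  also have "V * (mat_adjoint V * A) * V = V * (mat_adjoint V * A * V)" by (rule assoc_mult_mat[OF Vc VA Vc])
  also have "V * (mat_adjoint V * A * V) * mat_adjoint V = \<mu> \<cdot>\<^sub>m (V * mat_adjoint V)"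
    unfolding AV_eq mult_smult_distrib[OF Vc one_carrier_mat] right_mult_one_mat[OF Vc]
    by (rule mult_smult_assoc_mat[OF Vc Vac])
  finally have "V * mat_adjoint V * A * (V * mat_adjoint V) = \<mu> \<cdot>\<^sub>m (V * mat_adjoint V)" .
  then show "\<mu> \<in> rank_numerical_range k A"
    unfolding rank_numerical_range_def using isom_imp_orth_proj[OF V] A by auto
qed

lemma Omega_set_iff:
  assumes A: "A \<in> carrier_mat n n" and k: "1 \<le> k" "k \<le> n"
  shows "\<mu> \<in> Omega_set k A \<longleftrightarrow> (\<forall>\<xi>\<in>{0..<2*pi}. 0 \<le> lam k (A - \<mu> \<cdot>\<^sub>m 1\<^sub>m n) \<xi>)"
proof -
  let ?B = "A - \<mu> \<cdot>\<^sub>m 1\<^sub>m n"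
  have "dim_row A = n" using A by simp
  then have "\<mu> \<in> Omega_set k A \<longleftrightarrow> (\<forall>\<xi>\<in>{0..<2*pi}. k \<le> size {#x \<in># herm_eigvals (rot \<xi> ?B). 0 \<le> x#})"
    unfolding Omega_set_def rot_def Let_def by simp
  then show ?thesis
    unfolding le_kth_eigval_count[OF rot_carrier[OF diff_smult_one_carrier[OF A]] k] lam_def .
qed

theorem theorem2p2:
  fixes A :: "complex mat" and n k :: nat
  assumes "A \<in> carrier_mat n n" and "1 \<le> k" and "k \<le> n"
  shows "rank_numerical_range k A = Omega_set k A \<and>
    Omega_set k A = (\<Inter>\<xi>\<in>{0..<2*pi}.
      {\<mu>. Re (exp (\<i> * of_real \<xi>) * \<mu> + exp (- \<i> * of_real \<xi>) * cnj \<mu>)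
            \<le> kth_eigval k (exp (\<i> * of_real \<xi>) \<cdot>\<^sub>m A + exp (- \<i> * of_real \<xi>) \<cdot>\<^sub>m mat_adjoint A)})"
proof
  note A = assms(1) and k = assms(2,3)
  have B: "A - \<mu> \<cdot>\<^sub>m 1\<^sub>m n \<in> carrier_mat n n" for \<mu> by (rule diff_smult_one_carrier[OF A])
  have all: "(\<forall>\<xi>\<in>{0..<2*pi}. 0 \<le> lam k M \<xi>) \<longleftrightarrow> (\<forall>\<xi>. 0 \<le> lam k M \<xi>)" for M
    by (metis angle_reduce lam_cong)
  have "isotropic n k (A - \<mu> \<cdot>\<^sub>m 1\<^sub>m n) \<longleftrightarrow> (\<forall>\<xi>. 0 \<le> lam k (A - \<mu> \<cdot>\<^sub>m 1\<^sub>m n) \<xi>)" for \<mu>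
  proof
    assume "isotropic n k (A - \<mu> \<cdot>\<^sub>m 1\<^sub>m n)"
    then have "nonneg_frame n k (A - \<mu> \<cdot>\<^sub>m 1\<^sub>m n) \<xi>" for \<xi>
      unfolding isotropic_def nonneg_frame_def by auto
    then show "\<forall>\<xi>. 0 \<le> lam k (A - \<mu> \<cdot>\<^sub>m 1\<^sub>m n) \<xi>" using nonneg_frame_iff[OF B k] by blast
  next
    assume "\<forall>\<xi>. 0 \<le> lam k (A - \<mu> \<cdot>\<^sub>m 1\<^sub>m n) \<xi>"
    then show "isotropic n k (A - \<mu> \<cdot>\<^sub>m 1\<^sub>m n)"
      using isotropic_if_nonneg_frames[OF B] nonneg_frame_iff[OF B k] by blast
  qed
  then show "rank_numerical_range k A = Omega_set k A"
    using rank_numerical_range_iff[OF A] Omega_set_iff[OF A k] all by blast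
  have re: "Re (exp (\<i> * of_real \<xi>) * \<mu> + exp (- \<i> * of_real \<xi>) * cnj \<mu>) = 2 * Re (exp (\<i> * of_real \<xi>) * \<mu>)" for \<xi> \<mu>
    unfolding cnj_exp_i(1)[symmetric] complex_cnj_mult[symmetric] complex_add_cnj Re_complex_of_real ..
  \<comment> \<open>The shift by \<mu> lowers \<open>lam\<close> by exactly the left-hand side of
    the half-plane inequality, so each angle contributes its own half-plane.\<close>
  have "0 \<le> lam k (A - \<mu> \<cdot>\<^sub>m 1\<^sub>m n) \<xi> \<longleftrightarrow>
    Re (exp (\<i> * of_real \<xi>) * \<mu> + exp (- \<i> * of_real \<xi>) * cnj \<mu>) \<le> kth_eigval k (rot \<xi> A)" for \<mu> \<xi>
    unfolding re lam_def[symmetric] lam_diff_smult_one[OF A k] by linarith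
  then show "Omega_set k A = (\<Inter>\<xi>\<in>{0..<2*pi}.
      {\<mu>. Re (exp (\<i> * of_real \<xi>) * \<mu> + exp (- \<i> * of_real \<xi>) * cnj \<mu>)
            \<le> kth_eigval k (exp (\<i> * of_real \<xi>) \<cdot>\<^sub>m A + exp (- \<i> * of_real \<xi>) \<cdot>\<^sub>m mat_adjoint A)})"
    unfolding rot_def using Omega_set_iff[OF A k] by blast
qed

end
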